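(* Let $k$ be a field, let $\mathfrak q=(q_{ij})$ be an $n\times n$ multiplicatively antisymmetric matrix with entries in $k^\times$, and let $\Lambda_{\mathfrak q}$ be the corresponding $n$-dimensional quantum torus with generators $X_1^{\pm1},\dots,X_n^{\pm1}$. Let $p_1,\dots,p_n\in k^\times$ and let $\sigma$ be the scalar automorphism of $\Lambda_{\mathfrak q}$ defined by $\sigma(X_i)=p_iX_i$ for $i=1,\dots,n$. Consider the skew Laurent extension $\Lambda^\ast_{\mathfrak q,\sigma}=\Lambda_{\mathfrak q}[Y^{\pm1};\sigma]$. Let $\mathscr G(\Lambda_{\mathfrak q})$ be the subgroup of $k^\times$ generated by all the $q_{ij}$, and let $\mathscr H_\sigma$ be the subgroup of $k^\times$ generated by $p_1,\dots,p_n$. Assume $\mathscr G(\Lambda_{\mathfrak q})\cap\mathscr H_\sigma=\{1\}$. Let $\mathscr V(\Lambda_{\mathfrak q})$ be the set of Gelfand–Kirillov dimensions of simple $\Lambda_{\mathfrak q}$-modules and $\mathscr V(\Lambda^\ast_{\mathfrak q,\sigma})$ the set of Gelfand–Kirillov dimensions of simple $\Lambda^\ast_{\mathfrak q,\sigma}$-modules. Then \[\mathscr V(\Lambda^\ast_{\mathfrak q,\sigma})\subseteq\{\operatorname{rk}(\mathscr H_\sigma),\operatorname{rk}(\mathscr H_\sigma)+1,\dots,n\}\cup\{u+1\mid u\in\mathscr V(\Lambda_{\mathfrak q})\}.\]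
   Context: An $n\times n$ matrix $\mathfrak q=(q_{ij})$ over $k^\times=k\setminus\{0\}$ is multiplicatively antisymmetric if $q_{ii}=1$ and $q_{ji}=q_{ij}^{-1}$ for all $i,j$. The $n$-dimensional quantum torus $\Lambda_{\mathfrak q}$ is the associative $k$-algebra generated by $X_1,\dots,X_n$ and their inverses subject to $X_iX_j=q_{ij}X_jX_i$ for all $i,j$. The skew Laurent extension $\Lambda_{\mathfrak q}[Y^{\pm1};\sigma]$ is the ring of Laurent polynomials in $Y$ with coefficients in $\Lambda_{\mathfrak q}$, with multiplication determined by $Ya=\sigma(a)Y$ for $a\in\Lambda_{\mathfrak q}$. $\operatorname{rk}$ denotes the torsion-free rank of an abelian group. Gelfand–Kirillov dimension is measured relative to $k$. *)

theory Defs
  imports Complex_Main "HOL-Library.Function_Algebras" "HOL-Library.Extended_Real"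
    "HOL-Library.Liminf_Limsup" "HOL-Library.Extended_Nat"
begin

record ('a, 'k) kalg =
  acar  :: "'a set"
  aadd  :: "'a \<Rightarrow> 'a \<Rightarrow> 'a"
  azero :: 'a
  amul  :: "'a \<Rightarrow> 'a \<Rightarrow> 'a"
  aone  :: 'a
  asmul :: "'k \<Rightarrow> 'a \<Rightarrow> 'a"

record ('a, 'm) kmod =
  mcar  :: "'m set"
  madd  :: "'m \<Rightarrow> 'm \<Rightarrow> 'm"
  mzero :: 'm
  mact  :: "'a \<Rightarrow> 'm \<Rightarrow> 'm"

text \<open>Left module over the algebra A (k acts through the scalars c*1 of A).\<close>
definition is_kmodule :: "('a, 'k, 'x) kalg_scheme \<Rightarrow> ('a, 'm, 'y) kmod_scheme \<Rightarrow> bool" where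
  "is_kmodule A M \<longleftrightarrow>
     mzero M \<in> mcar M \<and>
     (\<forall>x\<in>mcar M. \<forall>y\<in>mcar M. madd M x y \<in> mcar M) \<and>
     (\<forall>a\<in>acar A. \<forall>x\<in>mcar M. mact M a x \<in> mcar M) \<and>
     (\<forall>x\<in>mcar M. \<forall>y\<in>mcar M. \<forall>z\<in>mcar M. madd M (madd M x y) z = madd M x (madd M y z)) \<and>
     (\<forall>x\<in>mcar M. \<forall>y\<in>mcar M. madd M x y = madd M y x) \<and>
     (\<forall>x\<in>mcar M. madd M (mzero M) x = x) \<and>
     (\<forall>x\<in>mcar M. \<exists>y\<in>mcar M. madd M x y = mzero M) \<and>
     (\<forall>a\<in>acar A. \<forall>x\<in>mcar M. \<forall>y\<in>mcar M. mact M a (madd M x y) = madd M (mact M a x) (mact M a y)) \<and>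
     (\<forall>a\<in>acar A. \<forall>b\<in>acar A. \<forall>x\<in>mcar M. mact M (aadd A a b) x = madd M (mact M a x) (mact M b x)) \<and>
     (\<forall>a\<in>acar A. \<forall>b\<in>acar A. \<forall>x\<in>mcar M. mact M (amul A a b) x = mact M a (mact M b x)) \<and>
     (\<forall>x\<in>mcar M. mact M (aone A) x = x)"

definition is_submodule :: "('a, 'k, 'x) kalg_scheme \<Rightarrow> ('a, 'm, 'y) kmod_scheme \<Rightarrow> 'm set \<Rightarrow> bool" where
  "is_submodule A M N \<longleftrightarrow> N \<subseteq> mcar M \<and> mzero M \<in> N \<and>
     (\<forall>x\<in>N. \<forall>y\<in>N. madd M x y \<in> N) \<and> (\<forall>a\<in>acar A. \<forall>x\<in>N. mact M a x \<in> N)"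

definition is_simple :: "('a, 'k, 'x) kalg_scheme \<Rightarrow> ('a, 'm, 'y) kmod_scheme \<Rightarrow> bool" where
  "is_simple A M \<longleftrightarrow> is_kmodule A M \<and> mcar M \<noteq> {mzero M} \<and>
     (\<forall>N. is_submodule A M N \<longrightarrow> N = {mzero M} \<or> N = mcar M)"

definition lin_comb :: "('v \<Rightarrow> 'v \<Rightarrow> 'v) \<Rightarrow> 'v \<Rightarrow> ('k \<Rightarrow> 'v \<Rightarrow> 'v) \<Rightarrow> 'k list \<Rightarrow> 'v list \<Rightarrow> 'v" where
  "lin_comb add zero smul cs xs = foldr (\<lambda>(c, x) acc. add (smul c x) acc) (zip cs xs) zero"

definition lin_indep :: "('v \<Rightarrow> 'v \<Rightarrow> 'v) \<Rightarrow> 'v \<Rightarrow> ('k::zero \<Rightarrow> 'v \<Rightarrow> 'v) \<Rightarrow> 'v list \<Rightarrow> bool" where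
  "lin_indep add zero smul xs \<longleftrightarrow>
     (\<forall>cs. length cs = length xs \<and> lin_comb add zero smul cs xs = zero \<longrightarrow> (\<forall>c\<in>set cs. c = 0))"

text \<open>rank S = dimension of the k-span of S (maximal size of an independent family in S).\<close>
definition rank :: "('v \<Rightarrow> 'v \<Rightarrow> 'v) \<Rightarrow> 'v \<Rightarrow> ('k::zero \<Rightarrow> 'v \<Rightarrow> 'v) \<Rightarrow> 'v set \<Rightarrow> enat" where
  "rank add zero smul S = Sup {enat (length xs) | xs. distinct xs \<and> set xs \<subseteq> S \<and> lin_indep add zero smul xs}"

definition is_subspace :: "'v set \<Rightarrow> ('v \<Rightarrow> 'v \<Rightarrow> 'v) \<Rightarrow> 'v \<Rightarrow> ('k \<Rightarrow> 'v \<Rightarrow> 'v) \<Rightarrow> 'v set \<Rightarrow> bool" where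
  "is_subspace car add zero smul W \<longleftrightarrow> W \<subseteq> car \<and> zero \<in> W \<and>
     (\<forall>x\<in>W. \<forall>y\<in>W. add x y \<in> W) \<and> (\<forall>c. \<forall>x\<in>W. smul c x \<in> W)"

definition msmul :: "('a, 'k, 'x) kalg_scheme \<Rightarrow> ('a, 'm, 'y) kmod_scheme \<Rightarrow> 'k \<Rightarrow> 'm \<Rightarrow> 'm" where
  "msmul A M c x = mact M (asmul A c (aone A)) x"

text \<open>V^N F: products v_1 \<cdot> ... \<cdot> v_N \<cdot> f (its k-span is the subspace V^N F).\<close>
definition prods :: "('a, 'm, 'y) kmod_scheme \<Rightarrow> 'a set \<Rightarrow> 'm set \<Rightarrow> nat \<Rightarrow> 'm set" where
  "prods M V F N = {foldr (mact M) vs f | vs f. set vs \<subseteq> V \<and> length vs = N \<and> f \<in> F}"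

definition gk_growth :: "('a, 'k::zero, 'x) kalg_scheme \<Rightarrow> ('a, 'm, 'y) kmod_scheme \<Rightarrow> 'a set \<Rightarrow> 'm set \<Rightarrow> ereal" where
  "gk_growth A M V F = limsup (\<lambda>N. ereal (ln (real (the_enat (rank (madd M) (mzero M) (msmul A M) (prods M V F N))))
                                          / ln (real N)))"

definition GKdim :: "('a, 'k::zero, 'x) kalg_scheme \<Rightarrow> ('a, 'm, 'y) kmod_scheme \<Rightarrow> ereal" where
  "GKdim A M = (SUP VF \<in> {(V, F). is_subspace (acar A) (aadd A) (azero A) (asmul A) V \<and> aone A \<in> V \<and>
                                  rank (aadd A) (azero A) (asmul A) V < \<infinity> \<and>
                                  is_subspace (mcar M) (madd M) (mzero M) (msmul A M) F \<and>
                                  rank (madd M) (mzero M) (msmul A M) F < \<infinity>}.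
                  gk_growth A M (fst VF) (snd VF))"

text \<open>GK dimensions of simple A-modules.  Every simple module is cyclic, hence isomorphic
  to A/I for a maximal left ideal I, whose elements are subsets of the element type of A;
  so modules with carrier of type 'a set represent all simple modules up to isomorphism.\<close>
definition GK_simple_values :: "('a, 'k::zero, 'x) kalg_scheme \<Rightarrow> ereal set" where
  "GK_simple_values A = {GKdim A M | M :: ('a, 'a set) kmod. is_simple A M}"

text \<open>Element f of the N-dimensional quantum torus = finitely supported function on Z^N
  (exponent vectors a, with a i = 0 for i \<ge> N); f = sum f(a) X^a with the ordered monomial
  X^a = X_0^(a 0) \<cdots> X_(N-1)^(a (N-1)); generators indexed 0..N-1.\<close>
definition qt_mons :: "nat \<Rightarrow> (nat \<Rightarrow> int) set" where
  "qt_mons N = {a. \<forall>i\<ge>N. a i = 0}"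

definition qt_coef :: "(nat \<Rightarrow> nat \<Rightarrow> 'k::field) \<Rightarrow> nat \<Rightarrow> (nat \<Rightarrow> int) \<Rightarrow> (nat \<Rightarrow> int) \<Rightarrow> 'k" where
  "qt_coef Q N a b = (\<Prod>i<N. \<Prod>j<i. (Q i j) powi (a i * b j))"

definition qt_mul :: "(nat \<Rightarrow> nat \<Rightarrow> 'k::field) \<Rightarrow> nat \<Rightarrow> ((nat \<Rightarrow> int) \<Rightarrow> 'k) \<Rightarrow> ((nat \<Rightarrow> int) \<Rightarrow> 'k) \<Rightarrow> ((nat \<Rightarrow> int) \<Rightarrow> 'k)" where
  "qt_mul Q N f g = (\<lambda>m. \<Sum>a\<in>{a. f a \<noteq> 0}. \<Sum>b\<in>{b. g b \<noteq> 0}.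
      if (\<lambda>i. a i + b i) = m then f a * g b * qt_coef Q N a b else 0)"

definition quantum_torus :: "(nat \<Rightarrow> nat \<Rightarrow> 'k::field) \<Rightarrow> nat \<Rightarrow> ((nat \<Rightarrow> int) \<Rightarrow> 'k, 'k) kalg" where
  "quantum_torus Q N =
     \<lparr> acar = {f. finite {a. f a \<noteq> 0} \<and> {a. f a \<noteq> 0} \<subseteq> qt_mons N},
       aadd = (+), azero = 0, amul = qt_mul Q N,
       aone = (\<lambda>a. if a = (\<lambda>_. 0) then 1 else 0),
       asmul = (\<lambda>c f. \<lambda>a. c * f a) \<rparr>"

text \<open>The scalar automorphism sigma(X_i) = p_i X_i, i.e. sigma(X^a) = (prod p_i^(a_i)) X^a.\<close>
definition scalar_aut :: "(nat \<Rightarrow> 'k::field) \<Rightarrow> nat \<Rightarrow> ((nat \<Rightarrow> int) \<Rightarrow> 'k) \<Rightarrow> ((nat \<Rightarrow> int) \<Rightarrow> 'k)" where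
  "scalar_aut p N f = (\<lambda>a. (\<Prod>i<N. (p i) powi (a i)) * f a)"

definition sigma_pow :: "('a, 'k, 'x) kalg_scheme \<Rightarrow> ('a \<Rightarrow> 'a) \<Rightarrow> int \<Rightarrow> 'a \<Rightarrow> 'a" where
  "sigma_pow A \<sigma> i = (if 0 \<le> i then \<sigma> ^^ nat i else (inv_into (acar A) \<sigma>) ^^ nat (- i))"

text \<open>Skew Laurent extension A[Y^{\<plusminus>1}; sigma]: element g = sum_m g(m) Y^m (coefficients on the
  left, finitely supported), with Y a = sigma(a) Y, so (a Y^i)(b Y^j) = a sigma^i(b) Y^(i+j).\<close>
definition sl_mul :: "('a::comm_monoid_add, 'k, 'x) kalg_scheme \<Rightarrow> ('a \<Rightarrow> 'a) \<Rightarrow> (int \<Rightarrow> 'a) \<Rightarrow> (int \<Rightarrow> 'a) \<Rightarrow> (int \<Rightarrow> 'a)" where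
  "sl_mul A \<sigma> f g = (\<lambda>m. \<Sum>i\<in>{i. f i \<noteq> 0}. \<Sum>j\<in>{j. g j \<noteq> 0}.
      if i + j = m then amul A (f i) (sigma_pow A \<sigma> i (g j)) else 0)"

definition skew_laurent :: "('a::comm_monoid_add, 'k, 'x) kalg_scheme \<Rightarrow> ('a \<Rightarrow> 'a) \<Rightarrow> (int \<Rightarrow> 'a, 'k) kalg" where
  "skew_laurent A \<sigma> =
     \<lparr> acar = {f. finite {m. f m \<noteq> 0} \<and> (\<forall>m. f m \<in> acar A)},
       aadd = (+), azero = 0, amul = sl_mul A \<sigma>,
       aone = (\<lambda>m. if m = 0 then aone A else 0),
       asmul = (\<lambda>c f. \<lambda>m. asmul A c (f m)) \<rparr>"

definition subgroup_gen :: "'k::field set \<Rightarrow> 'k set" where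
  "subgroup_gen S = {prod_list (map2 (powi) xs es) | xs es. set xs \<subseteq> S \<and> length es = length xs}"

definition mult_indep :: "'k::field list \<Rightarrow> bool" where
  "mult_indep xs \<longleftrightarrow> (\<forall>es. length es = length xs \<and> prod_list (map2 (powi) xs es) = 1 \<longrightarrow> (\<forall>e\<in>set es. e = 0))"

definition tf_rank :: "'k::field set \<Rightarrow> enat" where
  "tf_rank H = Sup {enat (length xs) | xs. distinct xs \<and> set xs \<subseteq> H \<and> mult_indep xs}"

end

theory Submission
  imports Defs "HOL-Analysis.Analysis" "HOL-Library.Poly_Mapping" "HOL-Computational_Algebra.Primes"
    "HOL-Real_Asymp.Real_Asymp"
begin


text \<open>The skew Laurent extension is the quantum torus of rank \<open>n + 1\<close> with last generator \<open>Y\<close>. For a simple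
  module \<open>M = \<Lambda>\<^sup>* / J\<close> the GK dimension is the largest size \<open>e\<close> of a set \<open>I\<close> of generators whose subtorus
  \<open>k * \<int>\<^sup>I\<close> meets \<open>J\<close> trivially: the monomials that are standard for a Groebner order form a down-closed
  set, so their number in a box is governed by the coordinate orthants they contain.

  If every such \<open>I\<close> of size \<open>e\<close> contains \<open>Y\<close>, a cyclic \<open>\<Lambda>\<close>-submodule \<open>N\<close> of least rank over
  the subtorus of \<open>I - {Y}\<close> has independent translates \<open>Y\<^sup>i N\<close>; hence \<open>N\<close> is simple, and its GK dimension is \<open>e - 1\<close>.

  Otherwise choose \<open>I\<close> inside \<open>\<Lambda>\<close> and suppose that \<open>rk H\<^sub>\<sigma> > e\<close>. Then no nontrivial power of some \<open>p\<^sub>j\<close> is a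
  product of powers of the \<open>p\<^sub>i\<close>, \<open>i \<in> I\<close>. A generic valuation of \<open>k * \<int>\<^sup>I\<close> extends to weights (slopes) of \<open>X\<^sub>j\<close>
  and \<open>Y\<close> for which the initial module is nonzero. On it some monomials \<open>a\<close> in \<open>X\<^sub>I, X\<^sub>j\<close> and \<open>c\<close> in \<open>X\<^sub>I, Y\<close>
  of weight \<open>0\<close> act algebraically, so they commute after replacing \<open>a\<close> by a power. The commutator is an element
  of \<open>H\<^sub>\<sigma>\<close> times an element of \<open>G(\<Lambda>)\<close>, so both are \<open>1\<close>, which contradicts the choice of \<open>j\<close>.\<close>

section \<open>Preliminaries\<close>

text \<open>Two standard tools are replaced by elementary counting. The whole exponent lattice
  carries no well-founded monomial order, so rewriting is done orthant by orthant. The division ring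
  of fractions of a subtorus is never built: fractions appear as relations with cleared
  denominators, combined by means of the Ore property, which is itself a consequence of growth. The
  valuation uses logarithms of primes, under which distinct exponents have distinct values. This
  makes lowest terms unique, and later forces the weight-zero exponents in \<open>X_I\<close> and
  one further generator to be multiples of a single exponent, so that a commutative algebra in one
  monomial acts in that direction. The main obstacle is to find one pair of slopes that serves
  \<open>X_j\<close> and \<open>Y\<close> at once. If every pair failed, compactness would give a
  uniform gap; a quadratic potential, whose gradient selects the slopes at each monomial, would then
  push the valuation of the generator above 0, its true value.\<close>

lemma kernel_nontrivial:
  fixes c :: "'a \<Rightarrow> 'b \<Rightarrow> 'k::field"
  assumes "finite X" "finite Y" "card Y < card X"
  shows "\<exists>g. (\<exists>x\<in>X. g x \<noteq> 0) \<and> (\<forall>y\<in>Y. (\<Sum>x\<in>X. g x * c x y) = 0)"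
  using assms(2,1,3)
proof (induction Y arbitrary: X c rule: finite_induct)
  case empty
  then have "X \<noteq> {}" by auto
  then show ?case by (intro exI[of _ "\<lambda>_. 1"]) auto
next
  case (insert y Y)
  show ?case
  proof (cases "\<forall>x\<in>X. c x y = 0")
    case True
    have "card Y < card X" using insert by simp
    from insert.IH[OF insert.prems(1) this, of c] True show ?thesis by auto
  next
    case False
    then obtain r where r: "r \<in> X" "c r y \<noteq> 0" by auto
    define X' where "X' = X - {r}"
    have X': "finite X'" "X = insert r X'" "r \<notin> X'" using r insert.prems by (auto simp: X'_def)
    have "card Y < card X'" using insert.prems insert.hyps X' by simp
    from insert.IH[OF X'(1) this, of "\<lambda>x y'. c x y' - c x y / c r y * c r y'"]
    obtain g where g: "\<exists>x\<in>X'. g x \<noteq> 0"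
      "\<forall>y'\<in>Y. (\<Sum>x\<in>X'. g x * (c x y' - c x y / c r y * c r y')) = 0" by blast
    \<comment> \<open>The pivot coefficient solves equation \<open>y\<close>; substituting it turns
      the remaining equations into those solved by the induction hypothesis.\<close>
    define g' where "g' = (\<lambda>x. if x = r then - (\<Sum>x\<in>X'. g x * c x y / c r y) else g x)"
    have s: "(\<Sum>x\<in>X. g' x * c x y') = (\<Sum>x\<in>X'. g x * (c x y' - c x y / c r y * c r y'))" for y'
    proof -
      have "(\<Sum>x\<in>X. g' x * c x y') = g' r * c r y' + (\<Sum>x\<in>X'. g' x * c x y')"
        using X' by simp
      also have "(\<Sum>x\<in>X'. g' x * c x y') = (\<Sum>x\<in>X'. g x * c x y')"
        using X' by (intro sum.cong) (auto simp: g'_def)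
      finally show ?thesis
        by (simp add: g'_def algebra_simps sum_subtractf sum_distrib_left sum_distrib_right)
    qed
    have "(\<Sum>x\<in>X. g' x * c x y) = 0" unfolding s using r by simp
    moreover have "\<exists>x\<in>X. g' x \<noteq> 0" using g(1) X' by (auto simp: g'_def)
    ultimately show ?thesis using g(2) s by (intro exI[of _ g']) auto
  qed
qed

section \<open>Exponent vectors with prescribed support, and boxes of them\<close>

definition exps :: "nat set \<Rightarrow> (nat \<Rightarrow> int) set" where
  "exps S = {a. \<forall>i. i \<notin> S \<longrightarrow> a i = 0}"

lemma exps_zero [simp]: "0 \<in> exps S" and exps_add: "a \<in> exps S \<Longrightarrow> b \<in> exps S \<Longrightarrow> a + b \<in> exps S"
  and exps_uminus: "a \<in> exps S \<Longrightarrow> - a \<in> exps S"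
  and exps_diff: "a \<in> exps S \<Longrightarrow> b \<in> exps S \<Longrightarrow> a - b \<in> exps S"
  by (auto simp: exps_def)

lemma exps_mono: "S \<subseteq> T \<Longrightarrow> exps S \<subseteq> exps T"
  by (auto simp: exps_def)

lemma qt_mons_eq_exps: "qt_mons N = exps {..<N}"
  by (auto simp: qt_mons_def exps_def)

lemma exps_box:
  fixes D :: "nat \<Rightarrow> int set"
  assumes "finite S" "\<And>i. i \<in> S \<Longrightarrow> finite (D i)"
  shows "finite {a \<in> exps S. \<forall>i\<in>S. a i \<in> D i}"
    and "card {a \<in> exps S. \<forall>i\<in>S. a i \<in> D i} = (\<Prod>i\<in>S. card (D i))"
proof -
  define F where "F = (\<lambda>g i. if i \<in> S then g i else (0::int))"
  have eq: "{a \<in> exps S. \<forall>i\<in>S. a i \<in> D i} = F ` PiE S D"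
  proof (intro set_eqI iffI)
    fix a assume "a \<in> {a \<in> exps S. \<forall>i\<in>S. a i \<in> D i}"
    then have "restrict a S \<in> PiE S D" "a = F (restrict a S)"
      by (auto simp: F_def exps_def fun_eq_iff)
    then show "a \<in> F ` PiE S D" by blast
  qed (auto simp: F_def exps_def)
  have "inj_on F (PiE S D)"
  proof (rule inj_onI)
    fix x y assume x: "x \<in> PiE S D" "y \<in> PiE S D" and e: "F x = F y"
    show "x = y"
    proof (rule PiE_ext[OF x])
      fix i assume "i \<in> S"
      then show "x i = y i" using fun_cong[OF e, of i] by (simp add: F_def)
    qed
  qed
  moreover have "finite (PiE S D)" using assms by (intro finite_PiE) auto
  ultimately show "finite {a \<in> exps S. \<forall>i\<in>S. a i \<in> D i}"
    "card {a \<in> exps S. \<forall>i\<in>S. a i \<in> D i} = (\<Prod>i\<in>S. card (D i))"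
    unfolding eq using assms by (auto simp: card_image card_PiE)
qed

text \<open>Cubes have nonnegative exponents because they are filled by products of monomials with
  exponents 0 and 1; the symmetric boxes below serve for upper bounds.\<close>

definition ecube :: "nat set \<Rightarrow> nat \<Rightarrow> (nat \<Rightarrow> int) set" where
  "ecube S m = {a \<in> exps S. \<forall>i\<in>S. a i \<in> {0..int m}}"

definition ebox :: "nat set \<Rightarrow> nat \<Rightarrow> (nat \<Rightarrow> int) set" where
  "ebox S m = {a \<in> exps S. \<forall>i\<in>S. a i \<in> {- int m..int m}}"

lemma ecube: assumes "finite S" shows "finite (ecube S m)" "card (ecube S m) = Suc m ^ card S"
  unfolding ecube_def using exps_box[OF assms, of "\<lambda>_. {0..int m}"] by (auto simp: nat_add_distrib)

lemma finite_ebox: "finite S \<Longrightarrow> finite (ebox S m)"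
  unfolding ebox_def using exps_box[of S "\<lambda>_. {- int m..int m}"] by auto

lemma ebox_exps: "ebox S m \<subseteq> exps S" and ecube_exps: "ecube S m \<subseteq> exps S"
  and ecube_ebox: "ecube S m \<subseteq> ebox S m"
  by (auto simp: ebox_def ecube_def)

lemma ebox_mono: "m \<le> m' \<Longrightarrow> ebox S m \<subseteq> ebox S m'"
  by (fastforce simp: ebox_def)

lemma ebox_add: "a \<in> ebox S m \<Longrightarrow> b \<in> ebox S m' \<Longrightarrow> a + b \<in> ebox S (m + m')"
  by (fastforce simp: ebox_def exps_add)

lemma ecube_mono: "I \<subseteq> S \<Longrightarrow> ecube I m \<subseteq> ecube S m"
  by (auto simp: ecube_def exps_def)

lemma ecube_zero [simp]: "0 \<in> ecube S m"
  by (auto simp: ecube_def)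

lemma finite_subset_ebox:
  assumes "finite A" "A \<subseteq> exps S" "finite S" shows "\<exists>m. A \<subseteq> ebox S m"
  using assms(1,2)
proof (induction A)
  case (insert a A)
  then obtain m where m: "A \<subseteq> ebox S m" by auto
  define m' where "m' = nat (\<Sum>i\<in>S. \<bar>a i\<bar>)"
  have "\<bar>a i\<bar> \<le> int m'" if "i \<in> S" for i
    using member_le_sum[OF that, of "\<lambda>i. \<bar>a i\<bar>"] assms(3) by (auto simp: m'_def)
  then have "a \<in> ebox S m'" using insert by (auto simp: ebox_def abs_le_iff minus_le_iff)
  then have "insert a A \<subseteq> ebox S (max m m')" using m ebox_mono[of m "max m m'" S] ebox_mono[of m' "max m m'" S] by auto
  then show ?case by blast
qed auto

subsection \<open>A generic linear form on exponent vectors\<close>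

definition prim :: "nat \<Rightarrow> nat" where
  "prim = (SOME f. inj f \<and> range f \<subseteq> {p. prime p})"

lemma prim: "inj prim" "prime (prim i)"
proof -
  have "\<exists>f::nat\<Rightarrow>nat. inj f \<and> range f \<subseteq> {p. prime p}"
    using primes_infinite infinite_countable_subset by blast
  from someI_ex[OF this] show "inj prim" "prime (prim i)" unfolding prim_def[symmetric] by auto
qed

text \<open>Logarithms of distinct primes are linearly independent over the rationals, so \<open>height\<close> is injective.\<close>

definition wt :: "nat \<Rightarrow> real" where "wt i = ln (real (prim i))"

lemma wt_ge: "wt i \<ge> ln 2"
  unfolding wt_def using prime_ge_2_nat[OF prim(2), of i] by (subst ln_le_cancel_iff) auto

lemma wt_pos: "wt i > 0"
  using wt_ge[of i] by (smt (verit) ln_gt_zero)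

definition height :: "nat set \<Rightarrow> (nat \<Rightarrow> int) \<Rightarrow> real" where
  "height S a = (\<Sum>i\<in>S. real_of_int (a i) * wt i)"

lemma height_add: "height S (a + b) = height S a + height S b"
  and height_zero [simp]: "height S 0 = 0"
  and height_uminus: "height S (- a) = - height S a"
  and height_diff: "height S (a - b) = height S a - height S b"
  by (simp_all add: height_def algebra_simps sum.distrib sum_negf sum_subtractf)

text \<open>Split \<open>a\<close> into its positive and negative parts. Height 0 says that two
  products of prime powers have the same logarithm, so they are the same number, and comparing the
  multiplicity of \<open>prim i\<close> gives \<open>nat (a i) = nat (- a i)\<close>.\<close>

lemma height_eq_0:
  assumes "finite S" "height S a = 0" "i \<in> S" shows "a i = 0"
proof -
  define P where "P = (\<lambda>e. \<Prod>i\<in>S. prim i ^ nat (e i))"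
  have lnP: "ln (real (P e)) = (\<Sum>i\<in>S. real (nat (e i)) * wt i)" for e
  proof -
    have "ln (real (P e)) = ln (\<Prod>i\<in>S. real (prim i) ^ nat (e i))" by (simp add: P_def)
    also have "\<dots> = (\<Sum>i\<in>S. ln (real (prim i) ^ nat (e i)))"
      using prime_gt_0_nat[OF prim(2)] by (intro ln_prod assms) auto
    also have "\<dots> = (\<Sum>i\<in>S. real (nat (e i)) * wt i)"
      using prime_gt_0_nat[OF prim(2)] by (intro sum.cong refl) (auto simp: wt_def ln_realpow)
    finally show ?thesis .
  qed
  have pos: "P e > 0" for e unfolding P_def using prime_gt_0_nat[OF prim(2)] by (intro prod_pos) auto
  have "real_of_int x = real (nat x) - real (nat (- x))" for x by (cases "x \<ge> 0") auto
  then have "real (nat x) * w - real (nat (- x)) * w = real_of_int x * w" for x w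
    by (simp add: left_diff_distrib)
  then have "ln (real (P a)) - ln (real (P (- a))) = height S a"
    unfolding lnP height_def sum_subtractf[symmetric] by simp
  then have "ln (real (P a)) = ln (real (P (- a)))" using assms(2) by simp
  then have eq: "P a = P (- a)" using pos by simp
  have mult: "multiplicity (prim i) (P e) = nat (e i)" for e
  proof -
    have P: "P e = (\<Prod>p\<in>prim ` S. p ^ nat (e (inv prim p)))"
      unfolding P_def using prim(1) by (subst prod.reindex) (auto simp: inj_on_def inj_def)
    show ?thesis
      unfolding P by (subst multiplicity_prod_prime_powers) (use assms prim in auto)
  qed
  from arg_cong[OF eq, of "multiplicity (prim i)"] show ?thesis unfolding mult by simp
qed

lemma height_inj: "finite S \<Longrightarrow> inj_on (height S) (exps S)"
proof (rule inj_onI)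
  fix a b assume S: "finite S" and "a \<in> exps S" "b \<in> exps S" and "height S a = height S b"
  then have "a - b \<in> exps S" "height S (a - b) = 0" by (auto simp: exps_diff height_diff)
  then have "(a - b) i = 0" for i using height_eq_0[OF S, of "a - b" i] by (cases "i \<in> S") (auto simp: exps_def)
  then show "a = b" by (auto simp: fun_eq_iff)
qed

section \<open>Twisted group algebras of free abelian groups\<close>

type_synonym 'k ta = "(nat \<Rightarrow> int) \<Rightarrow>\<^sub>0 'k"

abbreviation keys :: "('a \<Rightarrow>\<^sub>0 'b::zero) \<Rightarrow> 'a set" where "keys \<equiv> Poly_Mapping.keys"
abbreviation lookup :: "('a \<Rightarrow>\<^sub>0 'b::zero) \<Rightarrow> 'a \<Rightarrow> 'b" where "lookup \<equiv> Poly_Mapping.lookup"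
abbreviation single :: "'a \<Rightarrow> 'b \<Rightarrow> 'a \<Rightarrow>\<^sub>0 'b::zero" where "single \<equiv> Poly_Mapping.single"

definition sc :: "'k::field \<Rightarrow> 'k ta \<Rightarrow> 'k ta" where
  "sc c f = Poly_Mapping.map ((*) c) f"

lemma lookup_sc [simp]: "lookup (sc c f) a = c * lookup f a"
  by (simp add: sc_def Poly_Mapping.map.rep_eq when_def)

lemma sc_simps: "sc c (f + g) = sc c f + sc c g" "sc (c + d) f = sc c f + sc d f" "sc c (sc d f) = sc (c * d) f"
  "sc 1 f = f" "sc 0 f = 0" "sc c 0 = 0" "sc c (- f) = - sc c f" "sc c (single a d) = single a (c * d)"
  "sc c (f - g) = sc c f - sc c g" "sc (- c) f = - sc c f"
  by (auto intro!: poly_mapping_eqI simp: lookup_add lookup_minus algebra_simps lookup_single when_def)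

lemma sc_sum: "sc c (sum F A) = (\<Sum>i\<in>A. sc c (F i))"
  by (intro poly_mapping_eqI) (simp add: lookup_sum sum_distrib_left)

lemma keys_sc: "keys (sc c f) \<subseteq> keys f"
  by (auto simp: in_keys_iff)

lemma keys_sc_eq: "c \<noteq> 0 \<Longrightarrow> keys (sc c f) = keys f"
  by (auto simp: in_keys_iff)

lemma pm_sum: "f = (\<Sum>a\<in>keys f. single a (lookup f a))"
proof (rule poly_mapping_eqI)
  fix k
  have "(\<Sum>a\<in>keys f. lookup (single a (lookup f a)) k) = (\<Sum>a\<in>keys f. if k = a then lookup f k else 0)"
    by (intro sum.cong) (auto simp: lookup_single when_def)
  also have "\<dots> = lookup f k" by (simp add: in_keys_iff)
  finally show "lookup f k = lookup (\<Sum>a\<in>keys f. single a (lookup f a)) k" by (simp add: lookup_sum)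
qed

lemma pm_sum_super: "finite A \<Longrightarrow> keys f \<subseteq> A \<Longrightarrow> f = (\<Sum>a\<in>A. single a (lookup f a))"
  by (subst pm_sum) (rule sum.mono_neutral_left, auto simp: in_keys_iff)

text \<open>The subtorus of the generators in \<open>S\<close>. All subtori live in one type, so
  restricting scalars to fewer generators is an inclusion of sets.\<close>

definition RS :: "nat set \<Rightarrow> 'k::zero ta set" where
  "RS S = {f. keys f \<subseteq> exps S}"

lemma RS_mono: "S \<subseteq> T \<Longrightarrow> RS S \<subseteq> RS T"
  using exps_mono unfolding RS_def by blast

lemma RS_lookup: "f \<in> RS S \<longleftrightarrow> (\<forall>a. a \<notin> exps S \<longrightarrow> lookup f a = 0)"
  by (auto simp: RS_def in_keys_iff)

lemma RS_closed [simp, intro]: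
  fixes f :: "'k::field ta"
  shows "0 \<in> RS S" "f \<in> RS S \<Longrightarrow> g \<in> RS S \<Longrightarrow> f + g \<in> RS S" "f \<in> RS S \<Longrightarrow> g \<in> RS S \<Longrightarrow> f - g \<in> RS S"
    "f \<in> RS S \<Longrightarrow> - f \<in> RS S" "f \<in> RS S \<Longrightarrow> sc c f \<in> RS S"
  by (auto simp: RS_lookup lookup_add lookup_minus)

lemma RS_single: "a \<in> exps S \<Longrightarrow> single a c \<in> RS S"
  by (auto simp: RS_lookup lookup_single when_def)

lemma RS_sum: "(\<And>i. i \<in> A \<Longrightarrow> F i \<in> RS S) \<Longrightarrow> sum F A \<in> (RS S :: 'k::field ta set)"
  by (induction A rule: infinite_finite_induct) auto

text \<open>\<open>f\<close> stands for the sum of the \<open>f(a) X\<^sup>a\<close>. The cocycle is bimultiplicative, as it is for ordered monomials.\<close>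

locale twisted =
  fixes \<kappa> :: "(nat \<Rightarrow> int) \<Rightarrow> (nat \<Rightarrow> int) \<Rightarrow> 'k::field"
  assumes \<kappa>_nz [simp]: "\<kappa> a b \<noteq> 0"
    and \<kappa>_add_left: "\<kappa> (a + b) c = \<kappa> a c * \<kappa> b c"
    and \<kappa>_add_right: "\<kappa> a (b + c) = \<kappa> a b * \<kappa> a c"
begin

lemma \<kappa>_zero [simp]: "\<kappa> 0 a = 1" "\<kappa> a 0 = 1"
proof -
  have "\<kappa> 0 a * \<kappa> 0 a = \<kappa> 0 a * 1" using \<kappa>_add_left[of 0 0 a] by simp
  then show "\<kappa> 0 a = 1" using mult_left_cancel[OF \<kappa>_nz] by blast
  have "\<kappa> a 0 * \<kappa> a 0 = \<kappa> a 0 * 1" using \<kappa>_add_right[of a 0 0] by simp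
  then show "\<kappa> a 0 = 1" using mult_left_cancel[OF \<kappa>_nz] by blast
qed

definition tm :: "'k ta \<Rightarrow> 'k ta \<Rightarrow> 'k ta" (infixl "\<otimes>" 70) where
  "f \<otimes> g = (\<Sum>a\<in>keys f. \<Sum>b\<in>keys g. single (a + b) (\<kappa> a b * lookup f a * lookup g b))"

text \<open>Lets several elements be expanded over one common finite support, as the additivity
  proofs need.\<close>

lemma tm_super:
  assumes "finite A" "keys f \<subseteq> A" "finite B" "keys g \<subseteq> B"
  shows "f \<otimes> g = (\<Sum>a\<in>A. \<Sum>b\<in>B. single (a + b) (\<kappa> a b * lookup f a * lookup g b))"
proof -
  have "f \<otimes> g = (\<Sum>a\<in>keys f. \<Sum>b\<in>B. single (a + b) (\<kappa> a b * lookup f a * lookup g b))"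
    unfolding tm_def by (intro sum.cong refl sum.mono_neutral_left) (use assms in \<open>auto simp: in_keys_iff\<close>)
  also have "\<dots> = (\<Sum>a\<in>A. \<Sum>b\<in>B. single (a + b) (\<kappa> a b * lookup f a * lookup g b))"
    by (intro sum.mono_neutral_left) (use assms in \<open>auto simp: in_keys_iff\<close>)
  finally show ?thesis .
qed

lemma tm_add_left: "(f + f') \<otimes> g = f \<otimes> g + f' \<otimes> g"
proof -
  let ?A = "keys f \<union> keys f'" and ?B = "keys g"
  have "(f + f') \<otimes> g = (\<Sum>a\<in>?A. \<Sum>b\<in>?B. single (a + b) (\<kappa> a b * lookup (f + f') a * lookup g b))"
    using keys_add[of f f'] by (intro tm_super) auto
  also have "\<dots> = (\<Sum>a\<in>?A. \<Sum>b\<in>?B. single (a + b) (\<kappa> a b * lookup f a * lookup g b)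
      + single (a + b) (\<kappa> a b * lookup f' a * lookup g b))"
    by (intro sum.cong refl) (simp add: lookup_add distrib_left distrib_right single_add)
  also have "\<dots> = f \<otimes> g + f' \<otimes> g"
    by (simp only: sum.distrib tm_super[of ?A f ?B g] tm_super[of ?A f' ?B g] finite_Un finite_keys Un_upper1 Un_upper2 order_refl)
  finally show ?thesis .
qed

lemma tm_add_right: "g \<otimes> (f + f') = g \<otimes> f + g \<otimes> f'"
proof -
  let ?A = "keys f \<union> keys f'" and ?B = "keys g"
  have "g \<otimes> (f + f') = (\<Sum>b\<in>?B. \<Sum>a\<in>?A. single (b + a) (\<kappa> b a * lookup g b * lookup (f + f') a))"
    using keys_add[of f f'] by (intro tm_super) auto
  also have "\<dots> = (\<Sum>b\<in>?B. \<Sum>a\<in>?A. single (b + a) (\<kappa> b a * lookup g b * lookup f a)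
      + single (b + a) (\<kappa> b a * lookup g b * lookup f' a))"
    by (intro sum.cong refl) (simp add: lookup_add distrib_left distrib_right single_add)
  also have "\<dots> = g \<otimes> f + g \<otimes> f'"
    by (simp only: sum.distrib tm_super[of ?B g ?A f] tm_super[of ?B g ?A f'] finite_Un finite_keys Un_upper1 Un_upper2 order_refl)
  finally show ?thesis .
qed

lemma tm_zero [simp]: "0 \<otimes> f = 0" "f \<otimes> 0 = 0"
  by (simp_all add: tm_def)

lemma tm_uminus: "(- f) \<otimes> g = - (f \<otimes> g)" "f \<otimes> (- g) = - (f \<otimes> g)"
proof -
  have "(- f) \<otimes> g + f \<otimes> g = 0" by (simp add: tm_add_left[symmetric])
  then show "(- f) \<otimes> g = - (f \<otimes> g)" by (simp add: add_eq_0_iff2)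
  have "f \<otimes> (- g) + f \<otimes> g = 0" by (simp add: tm_add_right[symmetric])
  then show "f \<otimes> (- g) = - (f \<otimes> g)" by (simp add: add_eq_0_iff2)
qed

lemma tm_diff: "(f - f') \<otimes> g = f \<otimes> g - f' \<otimes> g" "g \<otimes> (f - f') = g \<otimes> f - g \<otimes> f'"
  using tm_add_left[of f "- f'" g] tm_add_right[of g f "- f'"] by (simp_all add: tm_uminus)

lemma tm_sum: "(sum F A) \<otimes> g = (\<Sum>i\<in>A. F i \<otimes> g)" "g \<otimes> (sum F A) = (\<Sum>i\<in>A. g \<otimes> F i)"
  by (induction A rule: infinite_finite_induct) (auto simp: tm_add_left tm_add_right)

lemma tm_single: "single a c \<otimes> single b d = single (a + b) (\<kappa> a b * c * d)"
  by (subst tm_super[of "{a}" _ "{b}"]) auto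

text \<open>Both sides are additive in each argument, so monomials suffice; for them
  bimultiplicativity of \<open>\<kappa>\<close> gives the cocycle identity.\<close>

lemma tm_assoc: "(f \<otimes> g) \<otimes> h = f \<otimes> (g \<otimes> h)"
proof -
  have s: "(single a c \<otimes> single b d) \<otimes> single e x = single a c \<otimes> (single b d \<otimes> single e x)" for a b e c d x
    by (simp add: tm_single \<kappa>_add_left \<kappa>_add_right add.assoc algebra_simps)
  have s2: "(f \<otimes> single b d) \<otimes> single e x = f \<otimes> (single b d \<otimes> single e x)" for b e d x
    by (subst (1 2) pm_sum[of f]) (simp only: tm_sum s)
  have s3: "(f \<otimes> g) \<otimes> single e x = f \<otimes> (g \<otimes> single e x)" for e x
    by (subst (1 2) pm_sum[of g]) (simp only: tm_sum s2)
  show ?thesis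
    by (subst (1 2) pm_sum[of h]) (simp only: tm_sum s3)
qed

lemma tm_one [simp]: "single 0 1 \<otimes> f = f" "f \<otimes> single 0 1 = f"
proof -
  have "single 0 1 \<otimes> f = (\<Sum>a\<in>keys f. single a (lookup f a))"
    by (subst tm_super[of "{0}" _ "keys f"]) auto
  then show "single 0 1 \<otimes> f = f" using pm_sum[of f] by simp
  have "f \<otimes> single 0 1 = (\<Sum>a\<in>keys f. single a (lookup f a))"
    by (subst tm_super[of "keys f" _ "{0}"]) auto
  then show "f \<otimes> single 0 1 = f" using pm_sum[of f] by simp
qed

lemma sc_eq_tm: "sc c f = single 0 c \<otimes> f"
proof -
  have "single 0 c \<otimes> f = (\<Sum>a\<in>keys f. sc c (single a (lookup f a)))"
    by (subst tm_super[of "{0}" _ "keys f"]) (auto simp: sc_simps)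
  then show ?thesis using pm_sum[of f] by (metis sc_sum)
qed

lemma tm_one' [simp]: "1 \<otimes> f = f" "f \<otimes> 1 = f"
  using tm_one[of f] by simp_all

lemma tm_sc: "sc c f \<otimes> g = sc c (f \<otimes> g)" "f \<otimes> sc c g = sc c (f \<otimes> g)"
proof -
  show "sc c f \<otimes> g = sc c (f \<otimes> g)" by (simp only: sc_eq_tm tm_assoc)
  have "f \<otimes> single 0 c = sc c f"
  proof -
    have "f \<otimes> single 0 c = (\<Sum>a\<in>keys f. sc c (single a (lookup f a)))"
      by (subst tm_super[of "keys f" _ "{0}"]) (auto simp: sc_simps mult.commute)
    then show ?thesis using pm_sum[of f] by (metis sc_sum)
  qed
  then show "f \<otimes> sc c g = sc c (f \<otimes> g)" by (metis sc_eq_tm tm_assoc)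
qed

lemma lookup_tm: "lookup (f \<otimes> g) m = (\<Sum>a\<in>keys f. \<Sum>b\<in>keys g. if a + b = m then \<kappa> a b * lookup f a * lookup g b else 0)"
  by (simp add: tm_def lookup_sum lookup_single when_def)

lemma keys_tm: "keys (f \<otimes> g) \<subseteq> {a + b | a b. a \<in> keys f \<and> b \<in> keys g}"
proof (rule subsetI, rule ccontr)
  fix m assume m: "m \<in> keys (f \<otimes> g)" "m \<notin> {a + b | a b. a \<in> keys f \<and> b \<in> keys g}"
  have "lookup (f \<otimes> g) m = 0"
    unfolding lookup_tm using m(2) by (intro sum.neutral ballI) auto
  then show False using m(1) by (simp add: in_keys_iff)
qed

lemma RS_tm [simp, intro]: "f \<in> RS S \<Longrightarrow> g \<in> RS S \<Longrightarrow> f \<otimes> g \<in> RS S"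
  unfolding RS_def using keys_tm[of f g] exps_add by blast

definition mon :: "(nat \<Rightarrow> int) \<Rightarrow> 'k ta" where "mon a = single a 1"

lemma mon_RS: "a \<in> exps S \<Longrightarrow> mon a \<in> RS S"
  by (simp add: mon_def RS_single)

lemma mon_zero [simp]: "mon 0 \<otimes> f = f" "f \<otimes> mon 0 = f"
  unfolding mon_def by (rule tm_one)+

lemma keys_mon [simp]: "keys (mon a) = {a}"
  by (simp add: mon_def)

lemma mon_nz [simp]: "mon a \<noteq> 0"
proof
  assume "mon a = 0"
  then have "keys (mon a) = {}" by simp
  then show False by simp
qed

lemma mon_mon: "mon a \<otimes> mon b = sc (\<kappa> a b) (mon (a + b))"
  by (simp add: mon_def tm_single sc_simps)

lemma mon_inverse: "mon (- a) \<otimes> (mon a \<otimes> f) = sc (\<kappa> (- a) a) f"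
  "mon a \<otimes> (mon (- a) \<otimes> f) = sc (\<kappa> a (- a)) f"
  by (simp_all add: tm_assoc[symmetric] mon_mon tm_sc)

lemma lookup_mon_tm: "lookup (mon a \<otimes> f) m = \<kappa> a (m - a) * lookup f (m - a)"
proof -
  have "mon a \<otimes> f = (\<Sum>b\<in>keys f. single (a + b) (\<kappa> a b * lookup f b))"
    by (subst tm_super[of "{a}" _ "keys f"]) (auto simp: mon_def)
  then have "lookup (mon a \<otimes> f) m = (\<Sum>b\<in>keys f. if a + b = m then \<kappa> a b * lookup f b else 0)"
    by (simp add: lookup_sum lookup_single when_def)
  also have "\<dots> = (\<Sum>b\<in>keys f. if b = m - a then \<kappa> a (m - a) * lookup f (m - a) else 0)"
    by (intro sum.cong) (auto simp: algebra_simps)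
  also have "\<dots> = \<kappa> a (m - a) * lookup f (m - a)" by (simp add: in_keys_iff)
  finally show ?thesis .
qed

lemma keys_mon_tm: "keys (mon a \<otimes> f) = (\<lambda>b. a + b) ` keys f"
proof -
  have "m \<in> keys (mon a \<otimes> f) \<longleftrightarrow> m - a \<in> keys f" for m by (simp add: in_keys_iff lookup_mon_tm)
  moreover have "m \<in> (\<lambda>b. a + b) ` keys f \<longleftrightarrow> m - a \<in> keys f" for m
  proof
    assume "m - a \<in> keys f"
    then show "m \<in> (\<lambda>b. a + b) ` keys f" by (intro image_eqI[of _ _ "m - a"]) simp_all
  qed auto
  ultimately show ?thesis by blast
qed

lemma mon_sum: "f = (\<Sum>a\<in>keys f. sc (lookup f a) (mon a))"
  using pm_sum[of f] by (simp add: mon_def sc_simps)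

lemma mon_sum_super: "finite A \<Longrightarrow> keys f \<subseteq> A \<Longrightarrow> f = (\<Sum>a\<in>A. sc (lookup f a) (mon a))"
  using pm_sum_super[of A f] by (simp add: mon_def sc_simps)

text \<open>The commutator of two monomials: \<open>mon a \<otimes> mon b\<close> is
  \<open>chi a b\<close> times \<open>mon b \<otimes> mon a\<close>.\<close>

definition chi :: "(nat \<Rightarrow> int) \<Rightarrow> (nat \<Rightarrow> int) \<Rightarrow> 'k" where
  "chi a b = \<kappa> a b / \<kappa> b a"

lemma chi_nz [simp]: "chi a b \<noteq> 0" by (simp add: chi_def)

lemma chi_add: "chi (a + b) c = chi a c * chi b c" "chi a (b + c) = chi a b * chi a c"
  by (simp_all add: chi_def \<kappa>_add_left \<kappa>_add_right)

text \<open>Conjugation by \<open>mon a\<close>. It rescales coefficients without moving exponents,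
  so subtori and bounds on heights are preserved.\<close>

definition tconj :: "(nat \<Rightarrow> int) \<Rightarrow> 'k ta \<Rightarrow> 'k ta" where
  "tconj a f = (\<Sum>b\<in>keys f. single b (chi a b * lookup f b))"

lemma lookup_tconj [simp]: "lookup (tconj a f) b = chi a b * lookup f b"
proof -
  have "lookup (tconj a f) b = (\<Sum>b'\<in>keys f. if b = b' then chi a b * lookup f b else 0)"
    unfolding tconj_def lookup_sum by (intro sum.cong) (auto simp: lookup_single when_def)
  then show ?thesis by (simp add: in_keys_iff)
qed

lemma keys_tconj [simp]: "keys (tconj a f) = keys f"
  by (auto simp: in_keys_iff)

lemma tconj_RS [simp]: "tconj a f \<in> RS S \<longleftrightarrow> f \<in> RS S"
  by (simp add: RS_def)

lemma tconj_zero_iff [simp]: "tconj a f = 0 \<longleftrightarrow> f = 0"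
  by (simp only: keys_eq_empty[symmetric] keys_tconj)

lemma mon_tconj: "mon a \<otimes> f = tconj a f \<otimes> mon a"
proof -
  have s: "mon a \<otimes> single b c = single b (chi a b * c) \<otimes> mon a" for b c
    by (simp add: mon_def tm_single chi_def add.commute)
  show ?thesis
    by (subst (1) pm_sum[of f]) (simp only: tm_sum s tconj_def)
qed

subsection \<open>Leading terms; the Ore property\<close>

definition vmin :: "nat set \<Rightarrow> 'k ta \<Rightarrow> real" where
  "vmin S f = Min (height S ` keys f)"

text \<open>Stated as a lower bound so that it remains meaningful for 0, where \<open>vmin\<close>
  takes the minimum of an empty set.\<close>

definition vge :: "nat set \<Rightarrow> 'k ta \<Rightarrow> real \<Rightarrow> bool" where
  "vge S f s \<longleftrightarrow> (\<forall>b\<in>keys f. s \<le> height S b)"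

lemma vmin_vge: "vge S f (vmin S f)"
  by (auto simp: vge_def vmin_def)

lemma vmin_attained: "f \<noteq> 0 \<Longrightarrow> \<exists>a\<in>keys f. height S a = vmin S f"
proof -
  assume "f \<noteq> 0"
  then have "Min (height S ` keys f) \<in> height S ` keys f" by (intro Min_in) auto
  then show ?thesis by (auto simp: vmin_def)
qed

lemma vge_tm: "vge S f s \<Longrightarrow> vge S g t \<Longrightarrow> vge S (f \<otimes> g) (s + t)"
  unfolding vge_def using keys_tm[of f g] by (fastforce simp: height_add)

lemma vge_add: "vge S f s \<Longrightarrow> vge S g s \<Longrightarrow> vge S (f + g) s"
  unfolding vge_def using keys_add[of f g] by blast

lemma vge_tconj [simp]: "vge S (tconj a f) s = vge S f s" and vmin_tconj [simp]: "vmin S (tconj a f) = vmin S f"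
  by (simp_all add: vge_def vmin_def)

text \<open>Since \<open>height\<close> is injective, the lowest exponents of \<open>f\<close> and
  \<open>g\<close> are unique, and their sum arises from no other pair of exponents. So the lowest
  term of the product cannot cancel: the algebra is a domain and \<open>vmin\<close> is a valuation
  on it.\<close>

lemma tm_lead:
  assumes S: "finite S" and f: "f \<in> RS S" "f \<noteq> 0" and g: "g \<in> RS S" "g \<noteq> 0"
  shows "f \<otimes> g \<noteq> 0" "vmin S (f \<otimes> g) = vmin S f + vmin S g"
proof -
  obtain a0 where a0: "a0 \<in> keys f" "height S a0 = vmin S f" using vmin_attained[OF f(2)] by blast
  obtain b0 where b0: "b0 \<in> keys g" "height S b0 = vmin S g" using vmin_attained[OF g(2)] by blast
  have key: "a = a0 \<and> b = b0" if "a \<in> keys f" "b \<in> keys g" "a + b = a0 + b0" for a b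
  proof -
    have "height S a \<ge> vmin S f" "height S b \<ge> vmin S g"
      using vmin_vge[of S f] vmin_vge[of S g] that by (auto simp: vge_def)
    moreover have "height S a + height S b = height S a0 + height S b0"
      using arg_cong[OF that(3), of "height S"] by (simp add: height_add)
    ultimately have "height S a = height S a0" using a0 b0 by simp
    then have "a = a0" using f(1) that a0 by (intro inj_onD[OF height_inj[OF S]]) (auto simp: RS_def)
    then show ?thesis using that by simp
  qed
  have "lookup (f \<otimes> g) (a0 + b0) = (\<Sum>a\<in>keys f. \<Sum>b\<in>keys g. if a = a0 \<and> b = b0 then \<kappa> a b * lookup f a * lookup g b else 0)"
    unfolding lookup_tm using key by (intro sum.cong refl) auto
  also have "\<dots> = (\<Sum>a\<in>keys f. if a = a0 then \<kappa> a b0 * lookup f a * lookup g b0 else 0)"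
    using b0 by (intro sum.cong refl) auto
  also have "\<dots> = \<kappa> a0 b0 * lookup f a0 * lookup g b0" using a0 by simp
  finally have k: "a0 + b0 \<in> keys (f \<otimes> g)" using a0 b0 by (auto simp: in_keys_iff)
  then show nz: "f \<otimes> g \<noteq> 0" by auto
  have "vmin S (f \<otimes> g) \<le> vmin S f + vmin S g"
    unfolding vmin_def[of S "f \<otimes> g"] using k a0 b0 by (intro Min_le) (auto simp: height_add intro!: image_eqI[of _ _ "a0 + b0"])
  moreover have "vge S (f \<otimes> g) (vmin S f + vmin S g)" by (intro vge_tm vmin_vge)
  moreover obtain c where "c \<in> keys (f \<otimes> g)" "height S c = vmin S (f \<otimes> g)" using vmin_attained[OF nz] by blast
  ultimately show "vmin S (f \<otimes> g) = vmin S f + vmin S g" by (force simp: vge_def)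
qed

end

section \<open>Growth of cyclic modules\<close>

definition orth :: "nat set \<Rightarrow> nat set \<Rightarrow> (nat \<Rightarrow> int) set" where
  "orth S P = {a \<in> exps S. \<forall>i\<in>S. if i \<in> P then a i \<ge> 0 else a i \<le> 0}"

text \<open>Its sublevel sets are finite, unlike those of \<open>height\<close>, so rewriting that
  decreases it terminates. The price is that it is additive only inside one orthant.\<close>

definition abs_height :: "nat set \<Rightarrow> (nat \<Rightarrow> int) \<Rightarrow> real" where
  "abs_height S a = (\<Sum>i\<in>S. real_of_int \<bar>a i\<bar> * wt i)"

lemma orth_add: "a \<in> orth S P \<Longrightarrow> b \<in> orth S P \<Longrightarrow> a + b \<in> orth S P"
  unfolding orth_def by (fastforce simp: exps_add split: if_splits)

lemma abs_height_add: "a \<in> orth S P \<Longrightarrow> b \<in> orth S P \<Longrightarrow> abs_height S (a + b) = abs_height S a + abs_height S b"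
  unfolding abs_height_def sum.distrib[symmetric]
proof (intro sum.cong refl)
  fix i assume "a \<in> orth S P" "b \<in> orth S P" "i \<in> S"
  then have "if i \<in> P then a i \<ge> 0 \<and> b i \<ge> 0 else a i \<le> 0 \<and> b i \<le> 0" by (auto simp: orth_def)
  then have "\<bar>(a + b) i\<bar> = \<bar>a i\<bar> + \<bar>b i\<bar>" by (auto split: if_splits)
  then show "real_of_int \<bar>(a + b) i\<bar> * wt i = real_of_int \<bar>a i\<bar> * wt i + real_of_int \<bar>b i\<bar> * wt i"
    by (simp add: distrib_right)
qed

text \<open>Changing the signs of the coordinates outside \<open>P\<close> turns
  \<open>abs_height\<close> on this orthant into \<open>height\<close>.\<close>

lemma abs_height_inj:
  assumes S: "finite S" and a: "a \<in> orth S P" and b: "b \<in> orth S P" and eq: "abs_height S a = abs_height S b"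
  shows "a = b"
proof -
  define fl where "fl = (\<lambda>(a::nat\<Rightarrow>int) i. if i \<in> P then a i else - a i)"
  have e: "fl a \<in> exps S" "fl b \<in> exps S" using a b by (auto simp: orth_def exps_def fl_def)
  have h: "height S (fl x) = abs_height S x" if "x \<in> orth S P" for x
    unfolding height_def abs_height_def using that by (intro sum.cong refl) (auto simp: fl_def orth_def split: if_splits)
  have "fl a = fl b" by (rule inj_onD[OF height_inj[OF S] _ e]) (simp add: h a b eq)
  then have "fl a i = fl b i" for i by simp
  then have "a i = b i" for i unfolding fl_def by (metis neg_equal_iff_equal)
  then show "a = b" by (rule ext)
qed

lemma abs_height_coord:
  assumes S: "finite S" and "i \<in> S" shows "real_of_int \<bar>a i\<bar> * ln 2 \<le> abs_height S a"
proof -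
  have "real_of_int \<bar>a i\<bar> * ln 2 \<le> real_of_int \<bar>a i\<bar> * wt i" using wt_ge[of i] by (intro mult_left_mono) auto
  also have "\<dots> \<le> abs_height S a"
    unfolding abs_height_def using wt_pos assms by (intro member_le_sum) (auto simp: less_imp_le)
  finally show ?thesis .
qed

lemma finite_abs_height_le: assumes S: "finite S" shows "finite {a \<in> exps S. abs_height S a \<le> t}"
proof (rule finite_subset)
  show "{a \<in> exps S. abs_height S a \<le> t} \<subseteq> ebox S (nat \<lceil>t / ln 2\<rceil>)"
  proof
    fix a assume a: "a \<in> {a \<in> exps S. abs_height S a \<le> t}"
    have "\<bar>a i\<bar> \<le> int (nat \<lceil>t / ln 2\<rceil>)" if "i \<in> S" for i
    proof -
      have "real_of_int \<bar>a i\<bar> * ln 2 \<le> t" using abs_height_coord[OF S that, of a] a by simp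
      then have "real_of_int \<bar>a i\<bar> \<le> t / ln 2" by (simp add: field_simps)
      then show ?thesis by linarith
    qed
    then show "a \<in> ebox S (nat \<lceil>t / ln 2\<rceil>)" using a by (auto simp: ebox_def abs_le_iff minus_le_iff)
  qed
qed (rule finite_ebox[OF S])

context twisted
begin

definition left_sub :: "nat set \<Rightarrow> 'k ta set \<Rightarrow> bool" where
  "left_sub S K \<longleftrightarrow> 0 \<in> K \<and> (\<forall>f\<in>K. \<forall>g\<in>K. f + g \<in> K) \<and> (\<forall>g\<in>RS S. \<forall>f\<in>K. g \<otimes> f \<in> K)"

lemma left_subD:
  assumes "left_sub S K"
  shows "0 \<in> K" "f \<in> K \<Longrightarrow> g \<in> K \<Longrightarrow> f + g \<in> K" "g \<in> RS S \<Longrightarrow> f \<in> K \<Longrightarrow> g \<otimes> f \<in> K"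
    "f \<in> K \<Longrightarrow> sc c f \<in> K" "f \<in> K \<Longrightarrow> - f \<in> K" "f \<in> K \<Longrightarrow> g \<in> K \<Longrightarrow> f - g \<in> K"
proof -
  show 1: "0 \<in> K" "\<And>f g. f \<in> K \<Longrightarrow> g \<in> K \<Longrightarrow> f + g \<in> K" "\<And>f g. g \<in> RS S \<Longrightarrow> f \<in> K \<Longrightarrow> g \<otimes> f \<in> K"
    using assms by (auto simp: left_sub_def)
  show 2: "sc c f \<in> K" if "f \<in> K" for f c using 1(3)[OF RS_single[of 0 S c] that] by (simp add: sc_eq_tm)
  show 3: "- f \<in> K" if "f \<in> K" for f using 2[OF that, of "-1"] by (simp add: sc_simps)
  show "f - g \<in> K" if "f \<in> K" "g \<in> K" using 1(2)[OF that(1) 3[OF that(2)]] by simp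
qed

lemma left_sub_sum: "left_sub S K \<Longrightarrow> (\<And>i. i \<in> A \<Longrightarrow> F i \<in> K) \<Longrightarrow> sum F A \<in> K"
  by (induction A rule: infinite_finite_induct) (auto simp: left_subD)

lemma left_sub_mono: "left_sub S K \<Longrightarrow> T \<subseteq> S \<Longrightarrow> left_sub T K"
  using RS_mono[of T S] by (auto simp: left_sub_def)

text \<open>In the cyclic module modulo \<open>K\<close> this says that no nonzero element of the
  subtorus of \<open>I\<close> kills the generator.\<close>

definition free :: "'k ta set \<Rightarrow> nat set \<Rightarrow> bool" where
  "free K I \<longleftrightarrow> (\<forall>f\<in>RS I. f \<in> K \<longrightarrow> f = 0)"

definition ann :: "'k ta set \<Rightarrow> 'k ta \<Rightarrow> 'k ta set" where
  "ann J z = {f. f \<otimes> z \<in> J}"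

lemma left_sub_ann: "left_sub S J \<Longrightarrow> left_sub S (ann J z)"
  by (auto simp: left_sub_def ann_def tm_add_left tm_assoc)

definition spans :: "(nat \<Rightarrow> int) set \<Rightarrow> (nat \<Rightarrow> int) set \<Rightarrow> 'k ta set \<Rightarrow> bool" where
  "spans T A K \<longleftrightarrow> (\<forall>a\<in>A. \<exists>f. keys f \<subseteq> T \<and> mon a - f \<in> K)"

lemma spansD:
  assumes K: "left_sub S K" and T: "spans T A K" and g: "keys g \<subseteq> A"
  shows "\<exists>f. keys f \<subseteq> T \<and> g - f \<in> K"
proof -
  obtain F where F: "\<And>a. a \<in> A \<Longrightarrow> keys (F a) \<subseteq> T \<and> mon a - F a \<in> K"
    using T unfolding spans_def by metis
  let ?f = "\<Sum>a\<in>keys g. sc (lookup g a) (F a)"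
  have "keys ?f \<subseteq> (\<Union>a\<in>keys g. keys (sc (lookup g a) (F a)))" by (rule keys_sum)
  also have "\<dots> \<subseteq> T" using keys_sc F g by blast
  finally have 1: "keys ?f \<subseteq> T" .
  have "g - ?f = (\<Sum>a\<in>keys g. sc (lookup g a) (mon a)) - ?f" using mon_sum[of g] by simp
  also have "\<dots> = (\<Sum>a\<in>keys g. sc (lookup g a) (mon a - F a))" by (simp add: sc_simps sum_subtractf)
  also have "\<dots> \<in> K" using F g by (intro left_sub_sum[OF K] left_subD(4)[OF K]) auto
  finally show ?thesis using 1 by blast
qed

text \<open>Standard monomials are taken separately in each of the orthants of the exponent lattice, so that
  the order by \<open>abs_height\<close> is a monomial order.\<close>

definition std :: "nat set \<Rightarrow> nat set \<Rightarrow> 'k ta set \<Rightarrow> (nat \<Rightarrow> int) set" where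
  "std S P K = {a \<in> orth S P. \<not> (\<exists>f. keys f \<subseteq> {b \<in> orth S P. abs_height S b < abs_height S a} \<and> mon a - f \<in> K)}"

text \<open>Multiply the rewriting rule of \<open>a\<close> by \<open>mon c\<close>; additivity of
  \<open>abs_height\<close> in the orthant keeps the new terms below \<open>c + a\<close>.\<close>

lemma nonstd_add:
  assumes K: "left_sub S K" and a: "a \<in> orth S P" "a \<notin> std S P K" and c: "c \<in> orth S P"
  shows "c + a \<notin> std S P K"
proof -
  obtain f where f: "keys f \<subseteq> {b \<in> orth S P. abs_height S b < abs_height S a}" "mon a - f \<in> K"
    using a by (auto simp: std_def)
  let ?f = "sc (inverse (\<kappa> c a)) (mon c \<otimes> f)"
  have "keys ?f \<subseteq> (\<lambda>b. c + b) ` keys f" using keys_sc[of _ "mon c \<otimes> f"] by (simp add: keys_mon_tm)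
  also have "\<dots> \<subseteq> {b \<in> orth S P. abs_height S b < abs_height S (c + a)}"
    using f(1) c a(1) by (auto simp: orth_add abs_height_add)
  finally have 1: "keys ?f \<subseteq> {b \<in> orth S P. abs_height S b < abs_height S (c + a)}" .
  have "c \<in> exps S" using c by (auto simp: orth_def)
  then have "sc (inverse (\<kappa> c a)) (mon c \<otimes> (mon a - f)) \<in> K"
    using f(2) by (intro left_subD(4)[OF K] left_subD(3)[OF K] mon_RS)
  moreover have "sc (inverse (\<kappa> c a)) (mon c \<otimes> (mon a - f)) = mon (c + a) - ?f"
    by (simp add: tm_diff mon_mon sc_simps)
  ultimately show ?thesis using 1 by (auto simp: std_def)
qed

text \<open>A nonzero relation inside the subtorus of \<open>I\<close> can be translated into any
  orthant. Its leading exponent \<open>a0\<close> is then nonstandard and vanishes outside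
  \<open>I\<close>, so every exponent of the orthant that is large on \<open>I\<close> is
  \<open>a0\<close> plus an element of the orthant.\<close>

lemma nonstd_exists:
  assumes S: "finite S" and K: "left_sub S K" and I: "I \<subseteq> S" and nf: "\<not> free K I"
  shows "\<exists>t::nat. \<forall>a\<in>orth S P. (\<forall>i\<in>I. \<bar>a i\<bar> \<ge> int t) \<longrightarrow> a \<notin> std S P K"
proof -
  have fI: "finite I" using S I finite_subset by auto
  obtain f where f: "f \<in> RS I" "f \<in> K" "f \<noteq> 0" using nf by (auto simp: free_def)
  obtain M where M: "keys f \<subseteq> ebox I M" using finite_subset_ebox[of "keys f" I] f fI by (auto simp: RS_def)
  \<comment> \<open>This translation moves the box of radius \<open>M\<close> into the orthant
    \<open>P\<close>, with coordinates of absolute value at most \<open>2 * M\<close>, the threshold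
    chosen below.\<close>
  define s where "s = (\<lambda>i. if i \<in> I then (if i \<in> P then int M else - int M) else 0)"
  define f' where "f' = mon s \<otimes> f"
  have sS: "s \<in> exps S" using I by (auto simp: s_def exps_def)
  have f'K: "f' \<in> K" unfolding f'_def using f(2) sS by (intro left_subD(3)[OF K] mon_RS)
  have keys: "b \<in> orth S P \<and> b \<in> exps I \<and> (\<forall>i\<in>I. \<bar>b i\<bar> \<le> 2 * int M)" if bk: "b \<in> keys f'" for b
  proof -
    obtain c where c: "b = s + c" "c \<in> ebox I M" using bk M unfolding f'_def keys_mon_tm by blast
    have ci: "\<bar>c i\<bar> \<le> int M" if "i \<in> I" for i using c(2) that by (auto simp: ebox_def)
    have bi: "b i = 0" if "i \<notin> I" for i using that c by (auto simp: s_def ebox_def exps_def)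
    have "if i \<in> P then b i \<ge> 0 else b i \<le> 0" for i
      using ci[of i] bi[of i] by (cases "i \<in> I") (auto simp: c(1) s_def abs_le_iff)
    moreover have "\<forall>i\<in>I. \<bar>b i\<bar> \<le> 2 * int M" using ci by (force simp: c(1) s_def)
    ultimately show ?thesis using bi I by (auto simp: orth_def exps_def)
  qed
  have "keys f' \<noteq> {}" using f(3) by (simp add: f'_def keys_mon_tm)
  then have "Max (abs_height S ` keys f') \<in> abs_height S ` keys f'" by (intro Max_in) auto
  then obtain a0 where a0: "a0 \<in> keys f'" "abs_height S a0 = Max (abs_height S ` keys f')" by auto
  have lt: "abs_height S b < abs_height S a0" if "b \<in> keys f'" "b \<noteq> a0" for b
  proof -
    have "abs_height S b \<le> abs_height S a0" unfolding a0(2) using that by (intro Max_ge) auto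
    moreover have "abs_height S b \<noteq> abs_height S a0" using abs_height_inj[OF S, of b P a0] keys that a0 by blast
    ultimately show ?thesis by simp
  qed
  define c0 where "c0 = lookup f' a0"
  have c0: "c0 \<noteq> 0" using a0 by (simp add: c0_def in_keys_iff)
  let ?g = "mon a0 - sc (inverse c0) f'"
  have "keys ?g \<subseteq> {b \<in> orth S P. abs_height S b < abs_height S a0}"
  proof
    fix b assume "b \<in> keys ?g"
    then have "lookup ?g b \<noteq> 0" by (simp add: in_keys_iff)
    then have "b \<in> keys f' \<and> b \<noteq> a0"
      using c0 a0 by (auto simp: lookup_minus mon_def lookup_single when_def c0_def in_keys_iff split: if_splits)
    then show "b \<in> {b \<in> orth S P. abs_height S b < abs_height S a0}" using keys lt by auto
  qed
  moreover have "mon a0 - ?g \<in> K" using f'K by (simp add: left_subD[OF K])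
  ultimately have ns: "a0 \<notin> std S P K" by (auto simp: std_def)
  show ?thesis
  proof (intro exI[of _ "2 * M"] ballI impI)
    fix a assume a: "a \<in> orth S P" "\<forall>i\<in>I. \<bar>a i\<bar> \<ge> int (2 * M)"
    have "if i \<in> P then (a - a0) i \<ge> 0 else (a - a0) i \<le> 0" if "i \<in> S" for i
    proof (cases "i \<in> I")
      case True
      then have "\<bar>a0 i\<bar> \<le> 2 * int M" "\<bar>a i\<bar> \<ge> 2 * int M" using a keys[OF a0(1)] by auto
      moreover have "if i \<in> P then a i \<ge> 0 else a i \<le> 0" using a(1) that by (auto simp: orth_def)
      ultimately show ?thesis by (auto split: if_splits)
    next
      case False
      then have "a0 i = 0" using keys[OF a0(1)] by (auto simp: exps_def)
      then show ?thesis using a(1) that by (auto simp: orth_def)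
    qed
    moreover have "a - a0 \<in> exps S" using a(1) keys[OF a0(1)] by (auto simp: orth_def exps_diff)
    ultimately have "a - a0 \<in> orth S P" by (simp only: orth_def mem_Collect_eq simp_thms) blast
    from nonstd_add[OF K _ ns this] keys[OF a0(1)] show "a \<notin> std S P K" by simp
  qed
qed

text \<open>A standard exponent has at most \<open>e\<close> large coordinates, because
  \<open>e + 1\<close> of them would index a set that is not free. So the standard exponents lie in
  finitely many boxes, each with at most \<open>e\<close> sides that grow with
  \<open>m\<close>.\<close>

lemma std_card:
  assumes S: "finite S" and K: "left_sub S K" and e: "\<And>I. I \<subseteq> S \<Longrightarrow> free K I \<Longrightarrow> card I \<le> e"
  shows "\<exists>D. \<forall>m. finite (std S P K \<inter> ebox S m) \<and> card (std S P K \<inter> ebox S m) \<le> D * (2 * m + 1) ^ e"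
proof -
  have "\<forall>I\<in>{I. I \<subseteq> S \<and> card I = Suc e}.
      \<exists>t::nat. \<forall>a\<in>orth S P. (\<forall>i\<in>I. \<bar>a i\<bar> \<ge> int t) \<longrightarrow> a \<notin> std S P K"
  proof
    fix I assume I: "I \<in> {I. I \<subseteq> S \<and> card I = Suc e}"
    then have "\<not> free K I" using e[of I] by auto
    then show "\<exists>t::nat. \<forall>a\<in>orth S P. (\<forall>i\<in>I. \<bar>a i\<bar> \<ge> int t) \<longrightarrow> a \<notin> std S P K"
      using nonstd_exists[OF S K] I by blast
  qed
  from bchoice[OF this] obtain t where
    t0: "\<forall>I\<in>{I. I \<subseteq> S \<and> card I = Suc e}. \<forall>a\<in>orth S P. (\<forall>i\<in>I. \<bar>a i\<bar> \<ge> int (t I)) \<longrightarrow> a \<notin> std S P K" ..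
  have t: "a \<notin> std S P K" if "I \<subseteq> S" "card I = Suc e" "a \<in> orth S P" "\<And>i. i \<in> I \<Longrightarrow> \<bar>a i\<bar> \<ge> int (t I)" for I a
    using t0 that by simp
  have fin: "finite {I. I \<subseteq> S \<and> card I = Suc e}" using S by simp
  \<comment> \<open>The sum serves as one threshold above all the \<open>t I\<close>.\<close>
  define tt where "tt = (\<Sum>I\<in>{I. I \<subseteq> S \<and> card I = Suc e}. t I)"
  have tt: "t I \<le> tt" if "I \<subseteq> S" "card I = Suc e" for I
    unfolding tt_def using that fin by (intro member_le_sum) auto
  have small: "card {i\<in>S. \<bar>a i\<bar> \<ge> int tt} \<le> e" if a: "a \<in> std S P K" for a
  proof (rule ccontr)
    assume "\<not> ?thesis"
    then obtain I where I: "I \<subseteq> {i\<in>S. \<bar>a i\<bar> \<ge> int tt}" "card I = Suc e"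
      using obtain_subset_with_card_n[of "Suc e" "{i\<in>S. \<bar>a i\<bar> \<ge> int tt}"] by (metis not_less_eq_eq)
    then have "I \<subseteq> S" by auto
    have "\<bar>a i\<bar> \<ge> int (t I)" if "i \<in> I" for i
    proof -
      have "\<bar>a i\<bar> \<ge> int tt" using I(1) that by auto
      then show ?thesis using tt[OF \<open>I \<subseteq> S\<close> I(2)] by linarith
    qed
    moreover have "a \<in> orth S P" using a by (simp add: std_def)
    ultimately show False using t[OF \<open>I \<subseteq> S\<close> I(2)] a by blast
  qed
  define Dm where "Dm = (\<lambda>I m (i::nat). if i \<in> I then {- int m..int m} else {- int tt..int tt})"
  define Bx where "Bx = (\<lambda>I m. {a \<in> exps S. \<forall>i\<in>S. a i \<in> Dm I m i})"
  let ?SS = "{I. I \<subseteq> S \<and> card I \<le> e}"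
  have sub: "std S P K \<inter> ebox S m \<subseteq> (\<Union>I\<in>?SS. Bx I m)" for m
  proof
    fix a assume a: "a \<in> std S P K \<inter> ebox S m"
    let ?I = "{i\<in>S. \<bar>a i\<bar> \<ge> int tt}"
    have ai: "a i \<in> Dm ?I m i" if "i \<in> S" for i
      using a that unfolding Dm_def ebox_def by (cases "i \<in> ?I") auto
    have "a \<in> exps S" using a by (simp add: ebox_def)
    then have "a \<in> Bx ?I m" using ai by (simp only: Bx_def mem_Collect_eq) blast
    moreover have "?I \<in> ?SS" using small[of a] a by blast
    ultimately show "a \<in> (\<Union>I\<in>?SS. Bx I m)" by (rule UN_I[rotated])
  qed
  have finSS: "finite ?SS" using S by simp
  have cardBx: "finite (Bx I m)" "card (Bx I m) \<le> (2 * tt + 1) ^ card S * (2 * m + 1) ^ e" if "I \<in> ?SS" for I m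
  proof -
    have f: "\<And>i. i \<in> S \<Longrightarrow> finite (Dm I m i)" by (auto simp: Dm_def)
    show "finite (Bx I m)" unfolding Bx_def by (rule exps_box(1)[OF S f])
    have "card (Bx I m) = (\<Prod>i\<in>S. card (Dm I m i))" unfolding Bx_def by (rule exps_box(2)[OF S f])
    also have "\<dots> \<le> (\<Prod>i\<in>S. (2 * tt + 1) * (if i \<in> I then 2 * m + 1 else 1))"
    proof (rule prod_mono)
      fix i
      have "card {- int tt..int tt} = 2 * tt + 1" "card {- int m..int m} = 2 * m + 1" by simp_all
      then show "0 \<le> card (Dm I m i) \<and> card (Dm I m i) \<le> (2 * tt + 1) * (if i \<in> I then 2 * m + 1 else 1)"
        unfolding Dm_def by (cases "i \<in> I") simp_all
    qed
    also have "\<dots> = (2 * tt + 1) ^ card S * (\<Prod>i\<in>S. (if i \<in> I then 2 * m + 1 else 1))"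
      by (simp only: prod.distrib prod_constant)
    also have "(\<Prod>i\<in>S. (if i \<in> I then 2 * m + 1 else 1)) = (2 * m + 1) ^ card (S \<inter> I)"
      by (simp only: prod.inter_restrict[OF S, symmetric] prod_constant)
    also have "S \<inter> I = I" using that by auto
    also have "(2 * tt + 1) ^ card S * (2 * m + 1) ^ card I \<le> (2 * tt + 1) ^ card S * (2 * m + 1) ^ e"
      using that by (intro mult_left_mono power_increasing) auto
    finally show "card (Bx I m) \<le> (2 * tt + 1) ^ card S * (2 * m + 1) ^ e" .
  qed
  show ?thesis
  proof (intro exI[of _ "card ?SS * (2 * tt + 1) ^ card S"] allI)
    fix m
    have fU: "finite (\<Union>I\<in>?SS. Bx I m)" by (rule finite_UN_I[OF finSS cardBx(1)])
    have "card (std S P K \<inter> ebox S m) \<le> card (\<Union>I\<in>?SS. Bx I m)" by (rule card_mono[OF fU sub])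
    also have "\<dots> \<le> (\<Sum>I\<in>?SS. card (Bx I m))" by (rule card_UN_le[OF finSS])
    also have "\<dots> \<le> of_nat (card ?SS) * ((2 * tt + 1) ^ card S * (2 * m + 1) ^ e)"
      by (rule sum_bounded_above, rule cardBx(2))
    finally show "finite (std S P K \<inter> ebox S m) \<and> card (std S P K \<inter> ebox S m) \<le> card ?SS * (2 * tt + 1) ^ card S * (2 * m + 1) ^ e"
      using finite_subset[OF sub fU] by (simp only: mult.assoc of_nat_id simp_thms)
  qed
qed

text \<open>Rewriting a nonstandard exponent lowers \<open>abs_height\<close>, and only finitely
  many exponents of the orthant lie below a given one, so the process stops.\<close>

lemma std_spans:
  assumes S: "finite S" and K: "left_sub S K" and a: "a \<in> orth S P"
  shows "\<exists>f. keys f \<subseteq> {b \<in> std S P K. abs_height S b \<le> abs_height S a} \<and> mon a - f \<in> K"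
  using a
proof (induction "card {b \<in> orth S P. abs_height S b < abs_height S a}" arbitrary: a rule: less_induct)
  case less
  show ?case
  proof (cases "a \<in> std S P K")
    case True
    then show ?thesis using left_subD(1)[OF K] by (intro exI[of _ "mon a"]) auto
  next
    case False
    then obtain f where f: "keys f \<subseteq> {b \<in> orth S P. abs_height S b < abs_height S a}" "mon a - f \<in> K"
      using less.prems by (auto simp: std_def)
    have fin: "finite {b \<in> orth S P. abs_height S b < abs_height S a}"
      by (rule finite_subset[OF _ finite_abs_height_le[OF S, of "abs_height S a"]]) (auto simp: orth_def)
    have "spans {b \<in> std S P K. abs_height S b \<le> abs_height S a} (keys f) K"
      unfolding spans_def
    proof
      fix b assume "b \<in> keys f"
      then have b: "b \<in> orth S P" "abs_height S b < abs_height S a" using f by auto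
      have "card {c \<in> orth S P. abs_height S c < abs_height S b} < card {c \<in> orth S P. abs_height S c < abs_height S a}"
        using b by (intro psubset_card_mono[OF fin]) auto
      from less.hyps[OF this b(1)] b(2)
      show "\<exists>f. keys f \<subseteq> {b \<in> std S P K. abs_height S b \<le> abs_height S a} \<and> mon b - f \<in> K"
        by (smt (verit) mem_Collect_eq subset_iff)
    qed
    from spansD[OF K this order_refl] obtain g where
      g: "keys g \<subseteq> {b \<in> std S P K. abs_height S b \<le> abs_height S a}" "f - g \<in> K" by blast
    have "mon a - g \<in> K" using left_subD(2)[OF K f(2) g(2)] by simp
    then show ?thesis using g(1) by blast
  qed
qed

text \<open>Every exponent lies in some orthant, and rewriting there ends in standard exponents
  whose size is linear in \<open>m\<close>; \<open>std_card\<close> counts these.\<close>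

lemma growth:
  assumes S: "finite S" and K: "left_sub S K" and e: "\<And>I. I \<subseteq> S \<Longrightarrow> free K I \<Longrightarrow> card I \<le> e"
  shows "\<exists>C::nat. \<forall>m. \<exists>T. T \<subseteq> exps S \<and> finite T \<and> card T \<le> C * (m + 1) ^ e \<and> spans T (ebox S m) K"
proof -
  have "\<forall>P. \<exists>D. \<forall>m. finite (std S P K \<inter> ebox S m) \<and> card (std S P K \<inter> ebox S m) \<le> D * (2 * m + 1) ^ e"
    using std_card[OF S K e] by blast
  then obtain D where D: "\<And>P m. finite (std S P K \<inter> ebox S m)"
    "\<And>P m. card (std S P K \<inter> ebox S m) \<le> D P * (2 * m + 1) ^ e" by metis
  \<comment> \<open>Rewriting never raises \<open>abs_height\<close>, which on
    \<open>ebox S m\<close> is at most \<open>m\<close> times the sum of the weights, while each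
    unit of a coordinate contributes at least \<open>ln 2\<close>. Hence the rewritten exponents
    stay in \<open>ebox S (c * m)\<close>.\<close>
  define c where "c = nat \<lceil>(\<Sum>i\<in>S. wt i) / ln 2\<rceil>"
  define DD where "DD = (\<Sum>P\<in>Pow S. D P)"
  show ?thesis
  proof (intro exI[of _ "DD * (2 * (c + 1)) ^ e"] allI)
    fix m
    let ?T = "\<Union>P\<in>Pow S. std S P K \<inter> ebox S (c * m)"
    have T1: "?T \<subseteq> exps S" using ebox_exps by blast
    have T2: "finite ?T" using S by (intro finite_UN_I D(1)) simp
    have "card ?T \<le> (\<Sum>P\<in>Pow S. card (std S P K \<inter> ebox S (c * m)))" using S by (intro card_UN_le) auto
    also have "\<dots> \<le> (\<Sum>P\<in>Pow S. D P * (2 * (c * m) + 1) ^ e)" by (intro sum_mono D)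
    also have "\<dots> = DD * (2 * (c * m) + 1) ^ e" by (simp add: DD_def sum_distrib_right)
    also have "\<dots> \<le> DD * (2 * (c + 1) * (m + 1)) ^ e"
      by (intro mult_left_mono power_mono) auto
    finally have T3: "card ?T \<le> DD * (2 * (c + 1)) ^ e * (m + 1) ^ e" by (simp only: power_mult_distrib mult.assoc)
    have "spans ?T (ebox S m) K"
      unfolding spans_def
    proof
      fix a assume a: "a \<in> ebox S m"
      define P where "P = {i\<in>S. a i \<ge> 0}"
      have aP: "a \<in> orth S P" using a by (auto simp: orth_def P_def ebox_def)
      obtain f where f: "keys f \<subseteq> {b \<in> std S P K. abs_height S b \<le> abs_height S a}" "mon a - f \<in> K"
        using std_spans[OF S K aP] by blast
      have "abs_height S a \<le> (\<Sum>i\<in>S. real m * wt i)"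
        unfolding abs_height_def using a wt_pos by (intro sum_mono mult_right_mono) (auto simp: ebox_def less_imp_le)
      then have ha: "abs_height S a \<le> real m * (\<Sum>i\<in>S. wt i)" by (simp add: sum_distrib_left)
      have "{b \<in> std S P K. abs_height S b \<le> abs_height S a} \<subseteq> ebox S (c * m)"
      proof
        fix b assume b: "b \<in> {b \<in> std S P K. abs_height S b \<le> abs_height S a}"
        have "\<bar>b i\<bar> \<le> int (c * m)" if "i \<in> S" for i
        proof -
          have "real_of_int \<bar>b i\<bar> * ln 2 \<le> real m * (\<Sum>i\<in>S. wt i)"
            using abs_height_coord[OF S that, of b] b ha by simp
          then have "real_of_int \<bar>b i\<bar> \<le> ((\<Sum>i\<in>S. wt i) / ln 2) * real m" by (simp add: field_simps)
          also have "\<dots> \<le> real c * real m" unfolding c_def by (intro mult_right_mono) linarith+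
          finally have "real_of_int \<bar>b i\<bar> \<le> real_of_int (int (c * m))" by simp
          then show ?thesis by (simp only: of_int_le_iff)
        qed
        then show "b \<in> ebox S (c * m)" using b by (auto simp: ebox_def std_def orth_def abs_le_iff minus_le_iff)
      qed
      moreover have "P \<in> Pow S" by (auto simp: P_def)
      ultimately have "keys f \<subseteq> ?T" using f(1) by blast
      then show "\<exists>f. keys f \<subseteq> ?T \<and> mon a - f \<in> K" using f(2) by blast
    qed
    then show "\<exists>T. T \<subseteq> exps S \<and> finite T \<and> card T \<le> DD * (2 * (c + 1)) ^ e * (m + 1) ^ e \<and> spans T (ebox S m) K"
      using T1 T2 T3 by blast
  qed
qed

end

section \<open>Ranks over twisted group algebras of subgroups\<close>

context twisted
begin

definition indep :: "nat set \<Rightarrow> 'k ta set \<Rightarrow> nat \<Rightarrow> (nat \<Rightarrow> 'k ta) \<Rightarrow> bool" where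
  "indep I J r m \<longleftrightarrow> (\<forall>g. (\<forall>l<r. g l \<in> RS I) \<longrightarrow> (\<Sum>l<r. g l \<otimes> m l) \<in> J \<longrightarrow> (\<forall>l<r. g l = 0))"

lemma indepD: "indep I J r m \<Longrightarrow> (\<And>l. l < r \<Longrightarrow> g l \<in> RS I) \<Longrightarrow> (\<Sum>l<r. g l \<otimes> m l) \<in> J \<Longrightarrow> l < r \<Longrightarrow> g l = 0"
  by (simp add: indep_def)

text \<open>A dimension count. Multiplying \<open>r\<close> independent elements by the monomials of
  a cube gives \<open>r * (c + 1) ^ card I\<close> linearly independent ones, which live in a space
  whose dimension is at most a constant times the same power of \<open>c + 1\<close>. The constant
  does not depend on the elements, so it bounds \<open>r\<close>.\<close>

lemma finite_rank:
  fixes k :: nat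
  assumes S: "finite S" and I: "I \<subseteq> S" and J: "left_sub S J"
    and z: "\<And>i I'. i < k \<Longrightarrow> I' \<subseteq> S \<Longrightarrow> free (ann J (zs i)) I' \<Longrightarrow> card I' \<le> card I"
  shows "\<exists>B. \<forall>r m. (\<forall>l<r. \<exists>f. (\<forall>i<k. f i \<in> RS S) \<and> m l - (\<Sum>i<k. f i \<otimes> zs i) \<in> J) \<longrightarrow>
    indep I J r m \<longrightarrow> r \<le> B"
proof -
  define e where "e = card I"
  have fI: "finite I" using S I finite_subset by auto
  have "\<forall>i. \<exists>C::nat. i < k \<longrightarrow> (\<forall>m. \<exists>T. T \<subseteq> exps S \<and> finite T \<and> card T \<le> C * (m + 1) ^ e \<and> spans T (ebox S m) (ann J (zs i)))"
  proof
    fix i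
    show "\<exists>C::nat. i < k \<longrightarrow> (\<forall>m. \<exists>T. T \<subseteq> exps S \<and> finite T \<and> card T \<le> C * (m + 1) ^ e \<and> spans T (ebox S m) (ann J (zs i)))"
    proof (cases "i < k")
      case True
      from growth[OF S left_sub_ann[OF J] z[OF True], folded e_def] show ?thesis by simp
    qed simp
  qed
  from choice[OF this] obtain C where C0: "\<forall>i. i < k \<longrightarrow>
    (\<forall>m. \<exists>T. T \<subseteq> exps S \<and> finite T \<and> card T \<le> C i * (m + 1) ^ e \<and> spans T (ebox S m) (ann J (zs i)))" ..
  have C: "\<exists>T. T \<subseteq> exps S \<and> finite T \<and> card T \<le> C i * (m + 1) ^ e \<and> spans T (ebox S m) (ann J (zs i))"
    if "i < k" for i m using C0 that by simp
  \<comment> \<open>If the coefficients have exponents in \<open>ebox S c\<close>, their multiples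
    by the cube have exponents in \<open>ebox S (2 * c)\<close>; comparing \<open>2 * c + 1\<close>
    with \<open>c + 1\<close> costs the factor \<open>2 ^ e\<close>.\<close>
  define B where "B = (\<Sum>i<k. C i) * 2 ^ e"
  have "r \<le> B" if m: "\<forall>l<r. \<exists>f. (\<forall>i<k. f i \<in> RS S) \<and> m l - (\<Sum>i<k. f i \<otimes> zs i) \<in> J"
    and ind: "indep I J r m" for r m
  proof (rule ccontr)
    assume "\<not> r \<le> B"
    then have rB: "B < r" by simp
    have "\<forall>l. \<exists>f. l < r \<longrightarrow> (\<forall>i<k. f i \<in> RS S) \<and> m l - (\<Sum>i<k. f i \<otimes> zs i) \<in> J" using m by blast
    from choice[OF this] obtain f where
      f0: "\<forall>l. l < r \<longrightarrow> (\<forall>i<k. f l i \<in> RS S) \<and> m l - (\<Sum>i<k. f l i \<otimes> zs i) \<in> J" ..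
    have f: "\<And>l i. l < r \<Longrightarrow> i < k \<Longrightarrow> f l i \<in> RS S"
      "\<And>l. l < r \<Longrightarrow> m l - (\<Sum>i<k. f l i \<otimes> zs i) \<in> J" using f0 by simp_all
    have "finite (\<Union>l\<in>{..<r}. \<Union>i\<in>{..<k}. keys (f l i))" by auto
    moreover have "(\<Union>l\<in>{..<r}. \<Union>i\<in>{..<k}. keys (f l i)) \<subseteq> exps S" using f(1) by (auto simp: RS_def)
    ultimately obtain c where c: "(\<Union>l\<in>{..<r}. \<Union>i\<in>{..<k}. keys (f l i)) \<subseteq> ebox S c"
      using finite_subset_ebox[OF _ _ S] by blast
    have "\<forall>i. \<exists>T. i < k \<longrightarrow> T \<subseteq> exps S \<and> finite T \<and> card T \<le> C i * (2 * c + 1) ^ e \<and> spans T (ebox S (2 * c)) (ann J (zs i))"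
    proof
      fix i
      show "\<exists>T. i < k \<longrightarrow> T \<subseteq> exps S \<and> finite T \<and> card T \<le> C i * (2 * c + 1) ^ e \<and> spans T (ebox S (2 * c)) (ann J (zs i))"
        using C[of i "2 * c"] by (cases "i < k") simp_all
    qed
    from choice[OF this] obtain T where
      T0: "\<forall>i. i < k \<longrightarrow> T i \<subseteq> exps S \<and> finite (T i) \<and> card (T i) \<le> C i * (2 * c + 1) ^ e \<and> spans (T i) (ebox S (2 * c)) (ann J (zs i))" ..
    have T: "\<And>i. i < k \<Longrightarrow> finite (T i)"
      "\<And>i. i < k \<Longrightarrow> card (T i) \<le> C i * (2 * c + 1) ^ e"
      "\<And>i. i < k \<Longrightarrow> spans (T i) (ebox S (2 * c)) (ann J (zs i))" using T0 by simp_all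
    let ?Q = "ecube I c"
    have QS: "?Q \<subseteq> ebox S c" using ecube_mono[OF I] ecube_ebox by blast
    define H where "H = (\<lambda>l b i. SOME h. keys h \<subseteq> T i \<and> mon b \<otimes> f l i - h \<in> ann J (zs i))"
    have H: "keys (H l b i) \<subseteq> T i" "mon b \<otimes> f l i - H l b i \<in> ann J (zs i)" if "l < r" "b \<in> ?Q" "i < k" for l b i
    proof -
      have "keys (f l i) \<subseteq> ebox S c" using c that by auto
      then have "keys (mon b \<otimes> f l i) \<subseteq> ebox S (c + c)"
        using that(2) QS by (auto simp: keys_mon_tm intro!: ebox_add)
      then have "keys (mon b \<otimes> f l i) \<subseteq> ebox S (2 * c)" by (simp add: mult_2)
      from spansD[OF left_sub_ann[OF J] T(3)[OF that(3)] this]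
      have "\<exists>h. keys h \<subseteq> T i \<and> mon b \<otimes> f l i - h \<in> ann J (zs i)" .
      from someI_ex[OF this] show "keys (H l b i) \<subseteq> T i" "mon b \<otimes> f l i - H l b i \<in> ann J (zs i)"
        by (auto simp: H_def)
    qed
    define X where "X = {..<r} \<times> ?Q"
    define Yy where "Yy = Sigma {..<k} T"
    have fX: "finite X" "finite Yy" using ecube(1)[OF fI] T(1) by (auto simp: X_def Yy_def)
    have "card Yy = (\<Sum>i<k. card (T i))" using T(1) by (simp add: Yy_def card_SigmaI)
    also have "\<dots> \<le> (\<Sum>i<k. C i * (2 * c + 1) ^ e)" using T(2) by (intro sum_mono) auto
    also have "\<dots> = (\<Sum>i<k. C i) * (2 * c + 1) ^ e" by (simp add: sum_distrib_right)
    also have "\<dots> \<le> (\<Sum>i<k. C i) * (2 * (c + 1)) ^ e" by (intro mult_left_mono power_mono) auto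
    also have "\<dots> = B * (c + 1) ^ e" by (simp only: B_def power_mult_distrib mult.assoc)
    also have "\<dots> < r * (c + 1) ^ e" using rB by simp
    also have "r * (c + 1) ^ e = card X" using ecube(2)[OF fI, of c] by (simp add: X_def card_cartesian_product e_def)
    finally have "card Yy < card X" .
    \<comment> \<open>Unknowns are the coefficients on the cube of the multipliers
      \<open>G l\<close>, equations the coefficients of the reduced forms \<open>H\<close>; a
      nonzero solution is a relation between the \<open>m l\<close>.\<close>
    from kernel_nontrivial[OF fX this, of "\<lambda>x y. lookup (H (fst x) (snd x) (fst y)) (snd y)"]
    obtain g where g: "\<exists>x\<in>X. g x \<noteq> 0" "\<And>y. y \<in> Yy \<Longrightarrow> (\<Sum>x\<in>X. g x * lookup (H (fst x) (snd x) (fst y)) (snd y)) = 0"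
      by blast
    have zero: "(\<Sum>x\<in>X. sc (g x) (H (fst x) (snd x) i)) = 0" if i: "i < k" for i
    proof (rule poly_mapping_eqI)
      fix t
      show "lookup (\<Sum>x\<in>X. sc (g x) (H (fst x) (snd x) i)) t = lookup 0 t"
      proof (cases "t \<in> T i")
        case True
        then have "(i, t) \<in> Yy" using i by (auto simp: Yy_def)
        from g(2)[OF this] show ?thesis by (simp add: lookup_sum)
      next
        case False
        have "lookup (H (fst x) (snd x) i) t = 0" if "x \<in> X" for x
        proof -
          have "keys (H (fst x) (snd x) i) \<subseteq> T i" using that i by (intro H) (auto simp: X_def)
          then show ?thesis using False by (auto simp: in_keys_iff)
        qed
        then show ?thesis by (simp add: lookup_sum)
      qed
    qed
    define G where "G = (\<lambda>l. \<Sum>b\<in>?Q. sc (g (l, b)) (mon b))"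
    have G: "G l \<in> RS I" for l
      unfolding G_def by (intro RS_sum RS_closed mon_RS) (use ecube_exps in auto)
    have lG: "lookup (G l) b = g (l, b)" if "b \<in> ?Q" for l b
    proof -
      have "lookup (G l) b = (\<Sum>b'\<in>?Q. if b = b' then g (l, b) else 0)"
        unfolding G_def lookup_sum by (intro sum.cong) (auto simp: mon_def lookup_single when_def)
      then show ?thesis using that ecube(1)[OF fI] by simp
    qed
    define D where "D = (\<lambda>x i. mon (snd x) \<otimes> f (fst x) i - H (fst x) (snd x) i)"
    have DJ: "D x i \<otimes> zs i \<in> J" if "x \<in> X" "i < k" for x i
      using H(2)[of "fst x" "snd x" i] that by (auto simp: D_def X_def ann_def)
    have "(\<Sum>l<r. G l \<otimes> m l) = (\<Sum>l<r. \<Sum>b\<in>?Q. sc (g (l, b)) (mon b \<otimes> m l))"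
      by (simp add: G_def tm_sum tm_sc)
    also have "\<dots> = (\<Sum>x\<in>X. sc (g x) (mon (snd x) \<otimes> m (fst x)))"
      unfolding X_def by (subst sum.cartesian_product) (simp add: case_prod_beta)
    also have "\<dots> = (\<Sum>x\<in>X. sc (g x) (mon (snd x) \<otimes> (m (fst x) - (\<Sum>i<k. f (fst x) i \<otimes> zs i))
        + (\<Sum>i<k. D x i \<otimes> zs i) + (\<Sum>i<k. H (fst x) (snd x) i \<otimes> zs i)))"
      by (intro sum.cong refl arg_cong[of _ _ "sc _"])
        (simp add: tm_diff tm_sum tm_assoc D_def sum_subtractf)
    also have "\<dots> = (\<Sum>x\<in>X. sc (g x) (mon (snd x) \<otimes> (m (fst x) - (\<Sum>i<k. f (fst x) i \<otimes> zs i))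
        + (\<Sum>i<k. D x i \<otimes> zs i))) + (\<Sum>x\<in>X. \<Sum>i<k. sc (g x) (H (fst x) (snd x) i) \<otimes> zs i)"
      by (simp add: sc_simps sum.distrib sc_sum tm_sc)
    also have "(\<Sum>x\<in>X. \<Sum>i<k. sc (g x) (H (fst x) (snd x) i) \<otimes> zs i)
        = (\<Sum>i<k. (\<Sum>x\<in>X. sc (g x) (H (fst x) (snd x) i)) \<otimes> zs i)"
      by (subst sum.swap) (simp add: tm_sum)
    also have "\<dots> = 0" using zero by simp
    finally have eq: "(\<Sum>l<r. G l \<otimes> m l) = (\<Sum>x\<in>X. sc (g x) (mon (snd x) \<otimes> (m (fst x) - (\<Sum>i<k. f (fst x) i \<otimes> zs i))
        + (\<Sum>i<k. D x i \<otimes> zs i)))" by simp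
    have "\<dots> \<in> J"
    proof (intro left_sub_sum[OF J] left_subD(4)[OF J] left_subD(2)[OF J])
      fix x assume x: "x \<in> X"
      have "snd x \<in> exps S" using x QS ebox_exps by (fastforce simp: X_def)
      then show "mon (snd x) \<otimes> (m (fst x) - (\<Sum>i<k. f (fst x) i \<otimes> zs i)) \<in> J"
        using f(2)[of "fst x"] x by (intro left_subD(3)[OF J] mon_RS) (auto simp: X_def)
      show "D x i \<otimes> zs i \<in> J" if "i \<in> {..<k}" for i using DJ[OF x] that by simp
    qed
    then have GJ: "(\<Sum>l<r. G l \<otimes> m l) \<in> J" using eq by simp
    have G0: "G l = 0" if "l < r" for l by (rule indepD[where g = G, OF ind G GJ that])
    obtain x where "x \<in> X" "g x \<noteq> 0" using g(1) by blast
    then show False using G0[of "fst x"] lG[of "snd x" "fst x"] by (simp add: X_def mem_Times_iff)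
  qed
  then show ?thesis by (intro exI[of _ B] allI impI)
qed

lemma left_sub_zero: "left_sub S {0}"
  by (auto simp: left_sub_def)

lemma indep_Suc: "indep I J (Suc r) m \<Longrightarrow> indep I J r m"
  unfolding indep_def
proof (intro allI impI)
  fix g l assume a: "\<forall>g. (\<forall>l<Suc r. g l \<in> RS I) \<longrightarrow> (\<Sum>l<Suc r. g l \<otimes> m l) \<in> J \<longrightarrow> (\<forall>l<Suc r. g l = 0)"
    and g: "\<forall>l<r. g l \<in> RS I" "(\<Sum>l<r. g l \<otimes> m l) \<in> J" "l < r"
  define g' where "g' = (\<lambda>l. if l < r then g l else 0)"
  have "(\<Sum>l<Suc r. g' l \<otimes> m l) = (\<Sum>l<r. g l \<otimes> m l)" by (simp add: g'_def)
  moreover have "\<forall>l<Suc r. g' l \<in> RS I" using g(1) by (simp add: g'_def)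
  ultimately have "g' l = 0" using a g by (metis less_Suc_eq)
  then show "g l = 0" using g(3) by (simp add: g'_def)
qed

lemma indep_le: "r \<le> r' \<Longrightarrow> indep I J r' m \<Longrightarrow> indep I J r m"
  by (induction rule: inc_induct) (auto intro: indep_Suc)

lemma tm_domain: "finite I \<Longrightarrow> f \<in> RS I \<Longrightarrow> g \<in> RS I \<Longrightarrow> f \<otimes> g = 0 \<Longrightarrow> f = 0 \<or> g = 0"
  using tm_lead(1) by blast

text \<open>If \<open>f\<close> and \<open>g\<close> had no common left multiple, then \<open>f, f g, f g\<^sup>2, \<dots>\<close> would be independent,
  contradicting the growth of the algebra.\<close>

lemma ore:
  assumes I: "finite I" and f: "f \<in> RS I" and g: "g \<in> RS I" "g \<noteq> 0"
  shows "\<exists>a\<in>RS I. \<exists>b\<in>RS I. a \<noteq> 0 \<and> a \<otimes> f = b \<otimes> g"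
proof (rule ccontr)
  assume no: "\<not> ?thesis"
  define m where "m = (\<lambda>l. ((\<lambda>x. x \<otimes> g) ^^ l) f)"
  have m0: "m 0 = f" and mS: "m (Suc l) = m l \<otimes> g" for l by (simp_all add: m_def)
  have mR: "m l \<in> RS I" for l by (induction l) (use f g in \<open>auto simp: m0 mS\<close>)
  have ind: "indep I {0} r m" for r
  proof (induction r)
    case (Suc r)
    show ?case unfolding indep_def
    proof (intro allI impI)
      fix c l assume c: "\<forall>l<Suc r. c l \<in> RS I" "(\<Sum>l<Suc r. c l \<otimes> m l) \<in> {0}" and l: "l < Suc r"
      let ?s = "\<Sum>l<r. c (Suc l) \<otimes> m l"
      have sR: "?s \<in> RS I" using c(1) mR by (intro RS_sum RS_tm) auto
      have s0: "c 0 \<otimes> f + ?s \<otimes> g = 0"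
        using c(2) by (simp add: sum.lessThan_Suc_shift m0 mS tm_sum tm_assoc del: sum.lessThan_Suc)
      \<comment> \<open>A nonzero \<open>c 0\<close> would give the forbidden common multiple. Once
        it vanishes, \<open>g\<close> cancels on the right and leaves a relation of length
        \<open>r\<close>.\<close>
      then have "c 0 \<otimes> f = (- ?s) \<otimes> g" by (simp add: tm_uminus eq_neg_iff_add_eq_0)
      moreover have "c 0 \<in> RS I" using c(1) by simp
      ultimately have c0: "c 0 = 0" using no RS_closed(4)[OF sR] by blast
      then have s1: "?s \<in> {0}" using s0 tm_domain[OF I sR g(1)] g(2) by simp
      have cR: "c (Suc l) \<in> RS I" if "l < r" for l using c(1) that by (meson Suc_mono)
      have "c (Suc l) = 0" if "l < r" for l by (rule indepD[OF Suc cR s1 that])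
      then show "c l = 0" using c0 l by (cases l) auto
    qed
  qed (simp add: indep_def)
  \<comment> \<open>The algebra itself is the cyclic module with left ideal \<open>{0}\<close> and
    generator \<open>mon 0\<close>, to which \<open>finite_rank\<close> applies.\<close>
  have "\<exists>B. \<forall>r m. (\<forall>l<r. \<exists>f. (\<forall>i<(1::nat). f i \<in> RS I) \<and> m l - (\<Sum>i<(1::nat). f i \<otimes> mon 0) \<in> {0}) \<longrightarrow>
    indep I {0} r m \<longrightarrow> r \<le> B"
    by (rule finite_rank[OF I order_refl left_sub_zero]) (use I in \<open>auto intro: card_mono\<close>)
  then obtain B where B: "\<And>r m. (\<forall>l<r. \<exists>f. (\<forall>i<(1::nat). f i \<in> RS I) \<and> m l - (\<Sum>i<(1::nat). f i \<otimes> mon 0) \<in> {0}) \<Longrightarrow>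
    indep I {0} r m \<Longrightarrow> r \<le> B" by blast
  have "Suc B \<le> B"
  proof (rule B[OF _ ind])
    show "\<forall>l<Suc B. \<exists>f. (\<forall>i<(1::nat). f i \<in> RS I) \<and> m l - (\<Sum>i<(1::nat). f i \<otimes> mon 0) \<in> {0}"
      by (intro allI impI exI[of _ "\<lambda>_. m _"]) (simp add: mR)
  qed
  then show False by simp
qed

text \<open>A simple module is represented by a maximal left ideal \<open>J\<close>, and its elements by representatives modulo \<open>J\<close>.\<close>

definition maximal_left :: "nat set \<Rightarrow> 'k ta set \<Rightarrow> bool" where
  "maximal_left N J \<longleftrightarrow> left_sub N J \<and> J \<subseteq> RS N \<and> mon 0 \<notin> J \<and> (\<forall>f\<in>RS N. f \<notin> J \<longrightarrow> (\<exists>g\<in>RS N. mon 0 - g \<otimes> f \<in> J))"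

section \<open>Torsion over a subtorus\<close>

definition tors :: "nat set \<Rightarrow> nat set \<Rightarrow> 'k ta set \<Rightarrow> 'k ta set" where
  "tors N I J = {f \<in> RS N. \<exists>g\<in>RS I. g \<noteq> 0 \<and> g \<otimes> f \<in> J}"

text \<open>Monomials suffice as multipliers. For torsion this is essential, since the argument
  rests on monomials normalising every subtorus.\<close>

lemma left_sub_from_mon:
  assumes "0 \<in> K" "\<And>f g. f \<in> K \<Longrightarrow> g \<in> K \<Longrightarrow> f + g \<in> K"
    "\<And>a c f. a \<in> exps S \<Longrightarrow> f \<in> K \<Longrightarrow> sc c (mon a \<otimes> f) \<in> K"
  shows "left_sub S K"
proof -
  have sum: "sum F A \<in> K" if "\<And>i. i \<in> A \<Longrightarrow> F i \<in> K" for F and A :: "(nat \<Rightarrow> int) set"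
    using that by (induction A rule: infinite_finite_induct) (auto simp: assms)
  have "g \<otimes> f \<in> K" if "g \<in> RS S" "f \<in> K" for f g
  proof -
    have "g \<otimes> f = (\<Sum>a\<in>keys g. sc (lookup g a) (mon a \<otimes> f))"
      by (subst mon_sum[of g]) (simp only: tm_sum tm_sc)
    also have "\<dots> \<in> K" using that by (intro sum assms(3)) (auto simp: RS_def)
    finally show ?thesis .
  qed
  then show ?thesis using assms by (simp add: left_sub_def)
qed

text \<open>Sums use common left multiples from the Ore property; multiples by \<open>mon a\<close>
  use that conjugation by \<open>mon a\<close> preserves the subtorus of \<open>I\<close>.\<close>

lemma left_sub_tors:
  assumes N: "finite N" and I: "I \<subseteq> N" and J: "left_sub N J"
  shows "left_sub N (tors N I J)"
proof (rule left_sub_from_mon)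
  have fI: "finite I" using N I finite_subset by auto
  have JI: "left_sub I J" using left_sub_mono[OF J I] .
  have "mon 0 \<in> RS I" by (simp add: mon_RS)
  then show "0 \<in> tors N I J" using left_subD(1)[OF J] unfolding tors_def by (auto intro!: bexI[of _ "mon 0"])
  show "f + f' \<in> tors N I J" if ff: "f \<in> tors N I J" "f' \<in> tors N I J" for f f'
  proof -
    obtain g g' where g: "g \<in> RS I" "g \<noteq> 0" "g \<otimes> f \<in> J" "g' \<in> RS I" "g' \<noteq> 0" "g' \<otimes> f' \<in> J"
      using ff by (auto simp: tors_def)
    obtain a b where ab: "a \<in> RS I" "b \<in> RS I" "a \<noteq> 0" "a \<otimes> g = b \<otimes> g'" using ore[OF fI g(1) g(4,5)] by blast
    have "(a \<otimes> g) \<otimes> (f + f') = a \<otimes> (g \<otimes> f) + b \<otimes> (g' \<otimes> f')"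
      by (simp add: tm_add_right tm_assoc[symmetric] ab(4))
    also have "\<dots> \<in> J" by (intro left_subD(2)[OF J] left_subD(3)[OF JI ab(1) g(3)] left_subD(3)[OF JI ab(2) g(6)])
    finally have "(a \<otimes> g) \<otimes> (f + f') \<in> J" .
    moreover have "a \<otimes> g \<noteq> 0" using tm_domain[OF fI ab(1) g(1)] ab g by auto
    ultimately show ?thesis using ff ab g by (auto simp: tors_def intro!: bexI[of _ "a \<otimes> g"])
  qed
  show "sc c (mon a \<otimes> f) \<in> tors N I J" if a: "a \<in> exps N" and f: "f \<in> tors N I J" for a c f
  proof -
    obtain g where g: "g \<in> RS I" "g \<noteq> 0" "g \<otimes> f \<in> J" using f by (auto simp: tors_def)
    have "tconj a g \<otimes> sc c (mon a \<otimes> f) = sc c (mon a \<otimes> (g \<otimes> f))"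
      by (simp only: tm_sc tm_assoc[symmetric] mon_tconj[of a g])
    also have "\<dots> \<in> J" by (intro left_subD(4)[OF J] left_subD(3)[OF J mon_RS[OF a] g(3)])
    finally show ?thesis using g a f by (auto simp: tors_def mon_RS intro!: bexI[of _ "tconj a g"])
  qed
qed

text \<open>Torsion elements form a submodule, so in a simple module one nonzero torsion class would
  make the generator torsion, against freeness.\<close>

lemma torsion_free:
  assumes N: "finite N" and I: "I \<subseteq> N" and J: "maximal_left N J" and fr: "free J I"
    and f: "f \<in> RS N" "f \<notin> J" and g: "g \<in> RS I" "g \<noteq> 0"
  shows "g \<otimes> f \<notin> J"
proof
  assume gf: "g \<otimes> f \<in> J"
  have J': "left_sub N J" using J by (simp add: maximal_left_def)
  have T: "left_sub N (tors N I J)" by (rule left_sub_tors[OF N I J'])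
  have "f \<in> tors N I J" using f g gf by (auto simp: tors_def)
  moreover obtain h where h: "h \<in> RS N" "mon 0 - h \<otimes> f \<in> J" using J f by (auto simp: maximal_left_def)
  moreover have "J \<subseteq> tors N I J"
  proof
    fix x assume x: "x \<in> J"
    have "mon 0 \<in> RS I" by (simp add: mon_RS)
    then show "x \<in> tors N I J" using x J unfolding tors_def maximal_left_def by (auto intro!: bexI[of _ "mon 0"])
  qed
  ultimately have "(mon 0 - h \<otimes> f) + h \<otimes> f \<in> tors N I J"
    by (intro left_subD(2)[OF T] left_subD(3)[OF T]) auto
  then obtain g' where "g' \<in> RS I" "g' \<noteq> 0" "g' \<otimes> mon 0 \<in> J" by (auto simp: tors_def)
  then show False using fr by (simp add: free_def)
qed

lemma torsion:
  assumes N: "finite N" and I: "I \<subseteq> N" and J: "left_sub N J" and fr: "\<not> free J I" and f: "f \<in> RS N"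
  shows "\<exists>g\<in>RS I. g \<noteq> 0 \<and> g \<otimes> f \<in> J"
proof -
  have T: "left_sub N (tors N I J)" by (rule left_sub_tors[OF N I J])
  have "mon 0 \<in> tors N I J" using fr by (auto simp: tors_def free_def mon_RS)
  then have "f \<otimes> mon 0 \<in> tors N I J" by (rule left_subD(3)[OF T f])
  then show ?thesis by (simp add: tors_def)
qed

text \<open>A simple module is either torsion-free or torsion over a given subtorus, so the choice
  of a nonzero class does not matter.\<close>

lemma free_ann_iff:
  assumes N: "finite N" and I: "I \<subseteq> N" and J: "maximal_left N J" and z: "z \<in> RS N" "z \<notin> J"
  shows "free (ann J z) I \<longleftrightarrow> free J I"
proof
  assume "free J I"
  then show "free (ann J z) I"
    using torsion_free[OF N I J _ z] unfolding free_def ann_def by blast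
next
  assume fa: "free (ann J z) I"
  show "free J I"
  proof (rule ccontr)
    assume "\<not> free J I"
    moreover have "left_sub N J" using J by (simp add: maximal_left_def)
    ultimately obtain g where "g \<in> RS I" "g \<noteq> 0" "g \<otimes> z \<in> J" using torsion[OF N I _ _ z(1)] by blast
    then show False using fa by (simp add: free_def ann_def)
  qed
qed

end

section \<open>Simple modules that are induced\<close>

context twisted
begin

definition yexp :: "nat \<Rightarrow> int \<Rightarrow> nat \<Rightarrow> int" where
  "yexp y i = (\<lambda>j. if j = y then i else 0)"

lemma yexp_add: "yexp y (i + j) = yexp y i + yexp y j" and yexp_zero [simp]: "yexp y 0 = 0"
  and yexp_exps: "y \<in> N \<Longrightarrow> yexp y i \<in> exps N"
  by (auto simp: yexp_def exps_def fun_eq_iff)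

lemma yexp_diff: "yexp y (i - j) = yexp y i - yexp y j"
  by (auto simp: yexp_def fun_eq_iff)

lemma mon_tm_mem: "left_sub N J \<Longrightarrow> a \<in> exps N \<Longrightarrow> mon a \<otimes> f \<in> J \<longleftrightarrow> f \<in> J"
proof
  assume J: "left_sub N J" and a: "a \<in> exps N" and m: "mon a \<otimes> f \<in> J"
  have "sc (inverse (\<kappa> (- a) a)) (mon (- a) \<otimes> (mon a \<otimes> f)) \<in> J"
    by (intro left_subD(4)[OF J] left_subD(3)[OF J mon_RS[OF exps_uminus[OF a]] m])
  then show "f \<in> J" by (simp add: mon_inverse sc_simps)
qed (rule left_subD(3), auto intro: mon_RS)

lemma mon_shift: "mon a \<otimes> (f \<otimes> x) = tconj a f \<otimes> (mon a \<otimes> x)"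
  by (simp only: tm_assoc[symmetric] mon_tconj[of a f])

lemma sc_mem: "left_sub N J \<Longrightarrow> c \<noteq> 0 \<Longrightarrow> sc c f \<in> J \<longleftrightarrow> f \<in> J"
  using left_subD(4)[of N J "sc c f" "inverse c"] left_subD(4)[of N J f c] by (auto simp: sc_simps)

lemma chi_inverse: "chi a b * chi (- a) b = 1"
proof -
  have "chi a b * chi (- a) b = chi 0 b" by (simp add: chi_add[symmetric])
  then show ?thesis by (simp add: chi_def)
qed

lemma tconj_tconj: "tconj a (tconj (- a) f) = f"
  by (rule poly_mapping_eqI) (simp add: mult.assoc[symmetric] chi_inverse)

text \<open>Conjugating the coefficients by \<open>mon (- d)\<close> turns a relation between the
  translates into one between the \<open>m l\<close>, with coefficients still in
  \<open>RS I\<close>.\<close>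

lemma indep_mon:
  assumes J: "left_sub N J" and d: "d \<in> exps N" and m: "indep I J r m"
  shows "indep I J r (\<lambda>l. mon d \<otimes> m l)"
  unfolding indep_def
proof (intro allI impI)
  fix g l assume g: "\<forall>l<r. g l \<in> RS I" "(\<Sum>l<r. g l \<otimes> (mon d \<otimes> m l)) \<in> J" "l < r"
  have "mon d \<otimes> tconj (- d) (g l) = g l \<otimes> mon d" for l by (simp add: mon_tconj tconj_tconj)
  then have "mon d \<otimes> (\<Sum>l<r. tconj (- d) (g l) \<otimes> m l) = (\<Sum>l<r. g l \<otimes> (mon d \<otimes> m l))"
    by (simp add: tm_sum tm_assoc[symmetric])
  then have "mon d \<otimes> (\<Sum>l<r. tconj (- d) (g l) \<otimes> m l) \<in> J" using g(2) by (simp only:)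
  then have s: "(\<Sum>l<r. tconj (- d) (g l) \<otimes> m l) \<in> J" using mon_tm_mem[OF J d] by blast
  have "tconj (- d) (g l) = 0"
    by (rule indepD[where g = "\<lambda>l. tconj (- d) (g l)", OF m _ s g(3)]) (use g(1) in simp)
  then show "g l = 0" by simp
qed

lemma decompose:
  assumes f: "f \<in> RS N"
  shows "\<exists>D g. finite D \<and> (\<forall>i. g i \<in> RS (N - {y})) \<and> f = (\<Sum>i\<in>D. mon (yexp y i) \<otimes> g i)"
proof -
  define D where "D = (\<lambda>a. a y) ` keys f"
  define g where "g = (\<lambda>i. \<Sum>a\<in>{a\<in>keys f. a y = i}. sc (lookup f a / \<kappa> (yexp y i) (a - yexp y i)) (mon (a - yexp y i)))"
  have gR: "\<forall>i. g i \<in> RS (N - {y})"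
    unfolding g_def using f by (intro allI RS_sum RS_closed mon_RS) (auto simp: RS_def exps_def yexp_def)
  have "mon (yexp y i) \<otimes> g i = (\<Sum>a\<in>{a\<in>keys f. a y = i}. sc (lookup f a) (mon a))" for i
    by (simp add: g_def tm_sum tm_sc mon_mon sc_simps)
  then have "(\<Sum>i\<in>D. mon (yexp y i) \<otimes> g i) = (\<Sum>a\<in>keys f. sc (lookup f a) (mon a))"
    unfolding D_def by (simp add: sum.image_gen[symmetric])
  then have "f = (\<Sum>i\<in>D. mon (yexp y i) \<otimes> g i)" using mon_sum[of f] by simp
  moreover have "finite D" by (simp add: D_def)
  ultimately show ?thesis using gR by blast
qed

text \<open>\<open>z\<close> is chosen so that the module generated by \<open>z\<close> over \<open>RS (N - {y})\<close> has least rank over \<open>RS (I - {y})\<close>.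
  A relation between its translates would make all \<open>Y\<^sup>i z\<close> torsion modulo finitely many of them.\<close>

lemma induced_simple:
  assumes N: "finite N" and J: "maximal_left N J" and y: "y \<in> I" and I: "I \<subseteq> N" "free J I"
    and less: "\<And>I'. I' \<subseteq> N - {y} \<Longrightarrow> free J I' \<Longrightarrow> card I' < card I"
  shows "\<exists>z\<in>RS N. z \<notin> J \<and> maximal_left (N - {y}) (ann J z \<inter> RS (N - {y}))"
proof -
  define N0 where "N0 = N - {y}"
  define I0 where "I0 = I - {y}"
  have fI: "finite I" "finite I0" "finite N0" using N I finite_subset by (auto simp: I0_def N0_def)
  have I0: "I0 \<subseteq> N0" "I0 \<subseteq> I" "I0 \<subseteq> N" "N0 \<subseteq> N" "y \<in> N" using I y by (auto simp: I0_def N0_def)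
  have cI: "card I = Suc (card I0)" using card_Suc_Diff1[OF fI(1) y] by (simp add: I0_def)
  have J': "left_sub N J" using J by (simp add: maximal_left_def)
  have JN0: "left_sub N0 J" using left_sub_mono[OF J'] I0 by auto
  have RSs: "RS I0 \<subseteq> (RS N0 :: 'k ta set)" "RS N0 \<subseteq> (RS N :: 'k ta set)" "RS I0 \<subseteq> (RS N :: 'k ta set)" "RS I0 \<subseteq> (RS I :: 'k ta set)"
    using RS_mono I0 by blast+
  \<comment> \<open>This is the hypothesis under which \<open>finite_rank\<close> applies over the
    smaller torus, whatever nonzero classes are taken as generators.\<close>
  have bound0: "card I' \<le> card I0" if "z \<in> RS N" "z \<notin> J" "I' \<subseteq> N0" "free (ann J z) I'" for z I'
  proof -
    have "I' \<subseteq> N" using that(3) I0 by auto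
    then have "free J I'" using free_ann_iff[OF N _ J that(1,2)] that(4) by blast
    from less[OF that(3)[unfolded N0_def] this] show ?thesis using cI by simp
  qed
  define fam where "fam = (\<lambda>z r m. (\<forall>l<r. \<exists>f\<in>RS N0. m l = f \<otimes> z) \<and> indep I0 J r m)"
  have fam_bound: "\<exists>B. \<forall>r m. fam z r m \<longrightarrow> r \<le> B" if z: "z \<in> RS N" "z \<notin> J" for z
  proof -
    have "\<exists>B. \<forall>r m. (\<forall>l<r. \<exists>f. (\<forall>i<1. f i \<in> RS N0) \<and> m l - (\<Sum>i<1. f i \<otimes> (\<lambda>_::nat. z) i) \<in> J) \<longrightarrow>
        indep I0 J r m \<longrightarrow> r \<le> B"
      by (rule finite_rank[OF fI(3) I0(1) JN0]) (use bound0[OF z] in blast)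
    then obtain B where B: "\<And>r m. (\<forall>l<r. \<exists>f. (\<forall>i<1. f i \<in> RS N0) \<and> m l - (\<Sum>i<1. f i \<otimes> (\<lambda>_::nat. z) i) \<in> J) \<Longrightarrow>
        indep I0 J r m \<Longrightarrow> r \<le> B" by blast
    have "r \<le> B" if fm: "fam z r m" for r m
    proof (rule B[of r m])
      show "\<forall>l<r. \<exists>f. (\<forall>i<1. f i \<in> RS N0) \<and> m l - (\<Sum>i<1. f i \<otimes> (\<lambda>_::nat. z) i) \<in> J"
      proof (intro allI impI)
        fix l assume "l < r"
        then obtain f where "f \<in> RS N0" "m l = f \<otimes> z" using fm by (auto simp: fam_def)
        then show "\<exists>f. (\<forall>i<1. f i \<in> RS N0) \<and> m l - (\<Sum>i<1. f i \<otimes> (\<lambda>_::nat. z) i) \<in> J"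
          by (intro exI[of _ "\<lambda>_. f"]) (simp add: left_subD(1)[OF J'])
      qed
      show "indep I0 J r m" using fm by (simp add: fam_def)
    qed
    then show ?thesis by blast
  qed
  define rk where "rk = (\<lambda>z. GREATEST r. \<exists>m. fam z r m)"
  have rk: "\<exists>m. fam z (rk z) m" "\<And>r m. fam z r m \<Longrightarrow> r \<le> rk z" if z: "z \<in> RS N" "z \<notin> J" for z
  proof -
    obtain B where B: "\<And>r m. fam z r m \<Longrightarrow> r \<le> B" using fam_bound[OF z] by blast
    have 0: "\<exists>m. fam z 0 m" by (simp add: fam_def indep_def)
    show "\<exists>m. fam z (rk z) m" unfolding rk_def by (rule GreatestI_nat[where P = "\<lambda>r. \<exists>m. fam z r m" and b = B, OF 0]) (use B in blast)
    show "\<And>r m. fam z r m \<Longrightarrow> r \<le> rk z" unfolding rk_def by (rule Greatest_le_nat[where P = "\<lambda>r. \<exists>m. fam z r m" and b = B]) (use B in blast)+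
  qed
  have "mon 0 \<in> RS N \<and> mon 0 \<notin> J" using J by (auto simp: maximal_left_def mon_RS)
  then obtain z where z: "z \<in> RS N" "z \<notin> J" and zmin: "\<And>z'. z' \<in> RS N \<Longrightarrow> z' \<notin> J \<Longrightarrow> rk z \<le> rk z'"
    using ex_has_least_nat[of "\<lambda>z. z \<in> RS N \<and> z \<notin> J" "mon 0" rk] by blast
  define zs where "zs = (\<lambda>i::nat. mon (yexp y (int i)) \<otimes> z)"
  have yN: "yexp y i \<in> exps N" for i using yexp_exps I0 by blast
  have zs: "zs i \<in> RS N" "zs i \<notin> J" for i
    using z mon_tm_mem[OF J' yN] by (auto simp: zs_def intro!: RS_tm mon_RS yN)
  have zsS: "mon (yexp y 1) \<otimes> zs j = sc (\<kappa> (yexp y 1) (yexp y (int j))) (zs (Suc j))" for j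
    by (simp add: zs_def tm_assoc[symmetric] mon_mon tm_sc yexp_add[symmetric] add.commute)
  \<comment> \<open>Stage \<open>k\<close> of a filtration by the number of translates used. Each
    stage has finite rank, which will clash with freeness of \<open>I\<close> once all translates
    are torsion modulo one stage.\<close>
  define inL where "inL = (\<lambda>k x. \<exists>f. (\<forall>i<k. f i \<in> RS N0) \<and> x - (\<Sum>i<k. f i \<otimes> zs i) \<in> J)"
  have inL_add: "inL k (x + x')" if xx: "inL k x" "inL k x'" for k x x'
  proof -
    obtain f f' where f: "\<forall>i<k. f i \<in> RS N0" "x - (\<Sum>i<k. f i \<otimes> zs i) \<in> J" "\<forall>i<k. f' i \<in> RS N0" "x' - (\<Sum>i<k. f' i \<otimes> zs i) \<in> J"
      using xx by (auto simp: inL_def)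
    have "(x + x') - (\<Sum>i<k. (f i + f' i) \<otimes> zs i) = (x - (\<Sum>i<k. f i \<otimes> zs i)) + (x' - (\<Sum>i<k. f' i \<otimes> zs i))"
      by (simp add: tm_add_left sum.distrib)
    also have "\<dots> \<in> J" using f by (intro left_subD(2)[OF J'])
    finally show ?thesis using f by (auto simp: inL_def intro!: exI[of _ "\<lambda>i. f i + f' i"])
  qed
  have inL_mult: "inL k (g \<otimes> x)" if xx: "inL k x" and g: "g \<in> RS N0" for k x g
  proof -
    obtain f where f: "\<forall>i<k. f i \<in> RS N0" "x - (\<Sum>i<k. f i \<otimes> zs i) \<in> J"
      using xx by (auto simp: inL_def)
    have "g \<otimes> x - (\<Sum>i<k. (g \<otimes> f i) \<otimes> zs i) = g \<otimes> (x - (\<Sum>i<k. f i \<otimes> zs i))"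
      by (simp add: tm_diff tm_sum tm_assoc)
    also have "\<dots> \<in> J" using f g by (intro left_subD(3)[OF JN0])
    finally show ?thesis using f g by (auto simp: inL_def intro!: exI[of _ "\<lambda>i. g \<otimes> f i"])
  qed
  have inL_J: "inL k x" if "x \<in> J" for k x
    using that by (auto simp: inL_def intro!: exI[of _ "\<lambda>_. 0"])
  have inL_zs: "inL k (f \<otimes> zs j)" if jk: "j < k" and f: "f \<in> RS N0" for k j f
  proof -
    have "(\<Sum>i<k. (if i = j then f else 0) \<otimes> zs i) = (\<Sum>i<k. if i = j then f \<otimes> zs i else 0)"
      by (intro sum.cong) auto
    also have "\<dots> = f \<otimes> zs j" using jk by simp
    finally show ?thesis using f unfolding inL_def
      by (intro exI[of _ "\<lambda>i. if i = j then f else 0"]) (simp add: left_subD(1)[OF J'])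
  qed
  have inL_sum: "inL k (sum F A)" if "\<And>i. i \<in> A \<Longrightarrow> inL k (F i)" for k F and A :: "'i set"
    using that by (induction A rule: infinite_finite_induct) (auto intro: inL_add inL_J left_subD(1)[OF J'])
  have inL_sc: "inL k (sc c x)" if "inL k x" for k c x
    unfolding sc_eq_tm by (rule inL_mult[OF that]) (simp add: RS_single)
  have Yzs: "mon (yexp y (int j)) \<otimes> (f \<otimes> z) = tconj (yexp y (int j)) f \<otimes> zs j" for j f
    by (simp add: zs_def mon_shift)
  \<comment> \<open>If this failed, minimality of the rank at \<open>z\<close> would make the module
    of the next translate \<open>zs k\<close> torsion modulo stage \<open>k\<close>, and then all
    later ones.\<close>
  have no_rel: "\<not> inL k (mon (yexp y (int k)) \<otimes> (f \<otimes> z))" if f: "f \<in> RS N0" "f \<otimes> z \<notin> J" for k f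
  proof
    assume w: "inL k (mon (yexp y (int k)) \<otimes> (f \<otimes> z))"
    define w where "w = mon (yexp y (int k)) \<otimes> (f \<otimes> z)"
    have k0: "k > 0"
    proof (rule ccontr)
      assume "\<not> k > 0"
      then have "w \<in> J" using w by (simp add: inL_def w_def)
      then show False using f \<open>\<not> k > 0\<close> by (simp add: w_def)
    qed
    have wR: "w \<in> RS N" "w \<notin> J" using f z RSs mon_tm_mem[OF J' yN] by (auto simp: w_def intro!: RS_tm mon_RS yN)
    obtain m0 where m0: "fam w (rk w) m0" using rk(1)[OF wR] by blast
    define \<rho> where "\<rho> = rk z"
    have "\<rho> \<le> rk w" using zmin[OF wR] by (simp add: \<rho>_def)
    then have m0: "\<forall>l<\<rho>. \<exists>f\<in>RS N0. m0 l = f \<otimes> w" "indep I0 J \<rho> m0" using m0 by (auto simp: fam_def intro: indep_le)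
    \<comment> \<open>By minimality the module of \<open>w\<close> contains \<open>\<rho>\<close>
      independent elements, and all of them lie in stage \<open>k\<close>. Together with
      \<open>x\<close> they would be \<open>Suc \<rho>\<close> independent elements in a translate
      of the module of \<open>z\<close>, more than its rank allows; the resulting relation has a
      nonzero coefficient at \<open>x\<close>.\<close>
    have absorb: "\<exists>g\<in>RS I0. g \<noteq> 0 \<and> inL k (g \<otimes> (u \<otimes> zs k))" if u: "u \<in> RS N0" for u
    proof -
      define x where "x = u \<otimes> zs k"
      define m where "m = (\<lambda>l. if l < \<rho> then m0 l else x)"
      have "\<not> indep I0 J (Suc \<rho>) m"
      proof
        assume "indep I0 J (Suc \<rho>) m"
        then have "indep I0 J (Suc \<rho>) (\<lambda>l. mon (- yexp y (int k)) \<otimes> m l)"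
          by (intro indep_mon[OF J'] exps_uminus yN)
        moreover have "\<exists>f\<in>RS N0. mon (- yexp y (int k)) \<otimes> m l = f \<otimes> z" if "l < Suc \<rho>" for l
        proof -
          have "\<exists>v\<in>RS N0. m l = v \<otimes> zs k"
          proof (cases "l < \<rho>")
            case True
            then obtain f' where "f' \<in> RS N0" "m0 l = f' \<otimes> w" using m0(1) by blast
            then have "m l = (f' \<otimes> tconj (yexp y (int k)) f) \<otimes> zs k" using True by (simp add: m_def w_def Yzs tm_assoc)
            moreover have "f' \<otimes> tconj (yexp y (int k)) f \<in> RS N0" using \<open>f' \<in> RS N0\<close> f(1) by (intro RS_tm) simp_all
            ultimately show ?thesis by (rule bexI)
          next
            case False
            then show ?thesis using u by (auto simp: m_def x_def)
          qed
          then obtain v where v: "v \<in> RS N0" "m l = v \<otimes> zs k" by blast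
          have "mon (- yexp y (int k)) \<otimes> m l = tconj (- yexp y (int k)) v \<otimes> (mon (- yexp y (int k)) \<otimes> zs k)"
            by (simp only: v mon_shift)
          also have "mon (- yexp y (int k)) \<otimes> zs k = sc (\<kappa> (- yexp y (int k)) (yexp y (int k))) z"
            by (simp add: zs_def mon_inverse)
          finally have "mon (- yexp y (int k)) \<otimes> m l = sc (\<kappa> (- yexp y (int k)) (yexp y (int k))) (tconj (- yexp y (int k)) v) \<otimes> z"
            by (simp only: tm_sc)
          then show ?thesis using v(1) by (intro bexI[of _ "sc (\<kappa> (- yexp y (int k)) (yexp y (int k))) (tconj (- yexp y (int k)) v)"]) auto
        qed
        ultimately have "fam z (Suc \<rho>) (\<lambda>l. mon (- yexp y (int k)) \<otimes> m l)" by (simp add: fam_def)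
        from rk(2)[OF z this] show False by (simp add: \<rho>_def)
      qed
      then obtain g where g: "\<forall>l<Suc \<rho>. g l \<in> RS I0" "(\<Sum>l<Suc \<rho>. g l \<otimes> m l) \<in> J" "\<exists>l<Suc \<rho>. g l \<noteq> 0"
        unfolding indep_def by blast
      have s: "(\<Sum>l<Suc \<rho>. g l \<otimes> m l) = (\<Sum>l<\<rho>. g l \<otimes> m0 l) + g \<rho> \<otimes> x" by (simp add: m_def)
      have "g \<rho> \<noteq> 0"
      proof
        assume "g \<rho> = 0"
        then have "(\<Sum>l<\<rho>. g l \<otimes> m0 l) \<in> J" using g(2) by (simp only: s tm_zero add_0_right)
        then have "\<forall>l<\<rho>. g l = 0" using indepD[OF m0(2), of g] g(1) by (meson less_Suc_eq)
        then show False using g(3) \<open>g \<rho> = 0\<close> by (auto simp: less_Suc_eq)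
      qed
      moreover have "inL k (g \<rho> \<otimes> x)"
      proof -
        have "g \<rho> \<otimes> x = (\<Sum>l<Suc \<rho>. g l \<otimes> m l) + sc (- 1) (\<Sum>l<\<rho>. g l \<otimes> m0 l)" by (simp only: s) (simp add: sc_simps)
        also have "inL k \<dots>"
        proof (intro inL_add inL_sc inL_J[OF g(2)])
        show "inL k (\<Sum>l<\<rho>. g l \<otimes> m0 l)"
        proof (rule inL_sum)
          fix l assume l: "l \<in> {..<\<rho>}"
          then obtain f' where "f' \<in> RS N0" "m0 l = f' \<otimes> w" using m0(1) by blast
          then show "inL k (g l \<otimes> m0 l)" using w g(1) l RSs(1) by (auto simp: w_def[symmetric] intro!: inL_mult)
        qed
        qed
        finally show ?thesis .
      qed
      moreover have "g \<rho> \<in> RS I0" using g(1) by simp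
      ultimately show ?thesis by (auto simp: x_def)
    qed
    \<comment> \<open>Multiplying a relation for \<open>zs i\<close> by \<open>y\<close> shifts all
      translates by one; only the term in \<open>zs k\<close> leaves stage \<open>k\<close>, and
      \<open>absorb\<close> brings it back.\<close>
    have all: "\<exists>g\<in>RS I0. g \<noteq> 0 \<and> inL k (g \<otimes> zs i)" for i
    proof (induction i)
      case 0
      have "mon 0 \<in> RS N0" "mon 0 \<in> RS I0" by (simp_all add: mon_RS)
      then show ?case using inL_zs[OF k0, of "mon 0"] by (intro bexI[of _ "mon 0"]) auto
    next
      case (Suc i)
      then obtain g where g: "g \<in> RS I0" "g \<noteq> 0" "inL k (g \<otimes> zs i)" by blast
      obtain h where h: "\<forall>j<k. h j \<in> RS N0" "g \<otimes> zs i - (\<Sum>j<k. h j \<otimes> zs j) \<in> J" using g(3) by (auto simp: inL_def)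
      let ?Y = "mon (yexp y 1)" and ?cj = "tconj (yexp y 1)"
      define h' where "h' = (\<lambda>j. sc (\<kappa> (yexp y 1) (yexp y (int j))) (?cj (h j)))"
      have h': "h' j \<in> RS N0" if "j < k" for j using h(1) that by (simp add: h'_def)
      have "?Y \<otimes> (g \<otimes> zs i) = sc (\<kappa> (yexp y 1) (yexp y (int i))) (?cj g \<otimes> zs (Suc i))"
        by (simp add: mon_shift zsS tm_sc)
      moreover have "?Y \<otimes> (\<Sum>j<k. h j \<otimes> zs j) = (\<Sum>j<k. h' j \<otimes> zs (Suc j))"
        by (simp add: tm_sum mon_shift zsS tm_sc h'_def)
      ultimately have e: "sc (\<kappa> (yexp y 1) (yexp y (int i))) (?cj g \<otimes> zs (Suc i))
          = ?Y \<otimes> (g \<otimes> zs i - (\<Sum>j<k. h j \<otimes> zs j)) + (\<Sum>j<k. h' j \<otimes> zs (Suc j))"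
        by (simp add: tm_diff)
      obtain k' where k': "k = Suc k'" using k0 by (cases k) auto
      obtain g' where g': "g' \<in> RS I0" "g' \<noteq> 0" "inL k (g' \<otimes> (h' k' \<otimes> zs k))" using absorb[OF h'[of k']] k' by auto
      have "inL k (g' \<otimes> (sc (\<kappa> (yexp y 1) (yexp y (int i))) (?cj g \<otimes> zs (Suc i))))"
      proof -
        have "g' \<otimes> (sc (\<kappa> (yexp y 1) (yexp y (int i))) (?cj g \<otimes> zs (Suc i)))
          = g' \<otimes> (?Y \<otimes> (g \<otimes> zs i - (\<Sum>j<k. h j \<otimes> zs j))) + (g' \<otimes> (\<Sum>j<k'. h' j \<otimes> zs (Suc j)) + g' \<otimes> (h' k' \<otimes> zs k))"
          unfolding e by (simp add: k' tm_add_right)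
        moreover have "inL k (g' \<otimes> (\<Sum>j<k'. h' j \<otimes> zs (Suc j)))"
          by (intro inL_mult inL_sum inL_zs h') (use k' g' RSs in auto)
        moreover have "?Y \<otimes> (g \<otimes> zs i - (\<Sum>j<k. h j \<otimes> zs j)) \<in> J"
          using h(2) mon_tm_mem[OF J' yN] by blast
        then have "inL k (g' \<otimes> (?Y \<otimes> (g \<otimes> zs i - (\<Sum>j<k. h j \<otimes> zs j))))"
          using g' RSs by (intro inL_mult inL_J) auto
        ultimately show ?thesis using g'(3) by (auto intro!: inL_add)
      qed
      then have "inL k (sc (inverse (\<kappa> (yexp y 1) (yexp y (int i)))) (g' \<otimes> (sc (\<kappa> (yexp y 1) (yexp y (int i))) (?cj g \<otimes> zs (Suc i)))))"
        by (rule inL_sc)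
      then have "inL k ((g' \<otimes> ?cj g) \<otimes> zs (Suc i))" by (simp add: tm_sc sc_simps tm_assoc)
      moreover have "g' \<otimes> ?cj g \<noteq> 0" using tm_domain[OF fI(2) g'(1), of "?cj g"] g g' by auto
      ultimately show ?case using g g' by (intro bexI[of _ "g' \<otimes> ?cj g"]) auto
    qed
    obtain G where G: "\<And>i. G i \<in> RS I0" "\<And>i. G i \<noteq> 0" "\<And>i. inL k (G i \<otimes> zs i)" using all by metis
    \<comment> \<open>Stage \<open>k\<close> has finite rank, so enough of the elements
      \<open>G i \<otimes> zs i\<close> are dependent modulo \<open>J\<close>. The dependence
      amounts to an element \<open>F\<close> of \<open>RS I\<close> that kills the class of
      \<open>z\<close>.\<close>
    have "\<exists>B. \<forall>r m. (\<forall>l<r. \<exists>f. (\<forall>i<k. f i \<in> RS N0) \<and> m l - (\<Sum>i<k. f i \<otimes> zs i) \<in> J) \<longrightarrow>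
        indep I0 J r m \<longrightarrow> r \<le> B"
      by (rule finite_rank[OF fI(3) I0(1) JN0]) (use bound0[OF zs] in blast)
    then obtain B where B: "\<And>r m. (\<forall>l<r. inL k (m l)) \<Longrightarrow> indep I0 J r m \<Longrightarrow> r \<le> B" unfolding inL_def by blast
    have "\<not> indep I0 J (Suc B) (\<lambda>i. G i \<otimes> zs i)" using B[of "Suc B"] G(3) by (metis not_less_eq_eq order_refl)
    then obtain c where c: "\<forall>l<Suc B. c l \<in> RS I0" "(\<Sum>l<Suc B. c l \<otimes> (G l \<otimes> zs l)) \<in> J" "\<exists>l<Suc B. c l \<noteq> 0"
      unfolding indep_def by blast
    define F where "F = (\<Sum>l<Suc B. (c l \<otimes> G l) \<otimes> mon (yexp y (int l)))"
    have FR: "F \<in> RS I"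
      unfolding F_def using c(1) G(1) RSs(4) yexp_exps[OF y] by (intro RS_sum RS_tm mon_RS) auto
    have "(\<Sum>l<Suc B. c l \<otimes> (G l \<otimes> zs l)) = F \<otimes> z" by (simp only: F_def tm_sum tm_assoc zs_def)
    then have "F \<otimes> z \<in> J" using c(2) by simp
    then have F0: "F = 0" using torsion_free[OF N I(1) J I(2) z FR] by blast
    obtain l where l: "l < Suc B" "c l \<noteq> 0" using c(3) by blast
    \<comment> \<open>The summands of \<open>F\<close> carry pairwise different powers of
      \<open>y\<close>, so they cannot cancel and \<open>F\<close> is nonzero.\<close>
    have yc: "a y = int j" if "a \<in> keys ((c j \<otimes> G j) \<otimes> mon (yexp y (int j)))" "j < Suc B" for a j
    proof -
      have "c j \<otimes> G j \<in> RS I0" using c(1) G(1) that(2) by blast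
      then have "\<And>b. b \<in> keys (c j \<otimes> G j) \<Longrightarrow> b y = 0" by (auto simp: RS_def exps_def I0_def)
      then show ?thesis using that(1) keys_tm[of "c j \<otimes> G j" "mon (yexp y (int j))"] by (force simp: yexp_def)
    qed
    have "c l \<otimes> G l \<noteq> 0" using tm_domain[OF fI(2) _ G(1)] c(1) l G(2) by blast
    then have "(c l \<otimes> G l) \<otimes> mon (yexp y (int l)) \<noteq> 0"
    proof -
      have "c l \<otimes> G l \<in> RS N" using c(1) l G(1) RSs by blast
      then show ?thesis using \<open>c l \<otimes> G l \<noteq> 0\<close> tm_domain[OF N, of "c l \<otimes> G l" "mon (yexp y (int l))"] mon_RS[OF yN] by auto
    qed
    then obtain a where a: "a \<in> keys ((c l \<otimes> G l) \<otimes> mon (yexp y (int l)))"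
      using keys_eq_empty by blast
    have "lookup F a = (\<Sum>j<Suc B. if j = l then lookup ((c l \<otimes> G l) \<otimes> mon (yexp y (int l))) a else 0)"
      unfolding F_def lookup_sum
    proof (intro sum.cong refl)
      fix j assume j: "j \<in> {..<Suc B}"
      show "lookup ((c j \<otimes> G j) \<otimes> mon (yexp y (int j))) a = (if j = l then lookup ((c l \<otimes> G l) \<otimes> mon (yexp y (int l))) a else 0)"
      proof (cases "j = l")
        case False
        then have "a \<notin> keys ((c j \<otimes> G j) \<otimes> mon (yexp y (int j)))" using yc[of a j] yc[OF a l(1)] j by auto
        then show ?thesis using False by (simp add: in_keys_iff)
      qed simp
    qed
    also have "\<dots> \<noteq> 0" using l a by (simp add: in_keys_iff)
    finally show False using F0 by simp
  qed
  \<comment> \<open>Dividing by the lowest power of \<open>y\<close> makes all indices nonnegative;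
    the top term would then lie in the stage generated by the lower translates, against
    \<open>no_rel\<close>.\<close>
  have direct: "\<forall>i\<in>D. f i \<otimes> z \<in> J"
    if D: "finite D" and f: "\<And>i. i \<in> D \<Longrightarrow> f i \<in> RS N0" and s: "(\<Sum>i\<in>D. mon (yexp y i) \<otimes> (f i \<otimes> z)) \<in> J"
    for D :: "int set" and f
  proof (rule ccontr)
    assume no: "\<not> ?thesis"
    define D' where "D' = {i\<in>D. f i \<otimes> z \<notin> J}"
    have D': "finite D'" "D' \<noteq> {}" using D no by (auto simp: D'_def)
    define i1 where "i1 = Max D'"
    define i0 where "i0 = Min D'"
    have i: "i1 \<in> D'" "i0 \<in> D'" "\<And>i. i \<in> D' \<Longrightarrow> i0 \<le> i \<and> i \<le> i1" using D' by (auto simp: i1_def i0_def)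
    have e: "(\<Sum>i\<in>D. mon (yexp y i) \<otimes> (f i \<otimes> z)) = (\<Sum>i\<in>D'. mon (yexp y i) \<otimes> (f i \<otimes> z)) + (\<Sum>i\<in>D - D'. mon (yexp y i) \<otimes> (f i \<otimes> z))"
      by (subst add.commute, rule sum.subset_diff) (use D in \<open>auto simp: D'_def\<close>)
    have b: "(\<Sum>i\<in>D - D'. mon (yexp y i) \<otimes> (f i \<otimes> z)) \<in> J"
      by (intro left_sub_sum[OF J']) (use mon_tm_mem[OF J' yN] in \<open>auto simp: D'_def\<close>)
    have sJ: "(\<Sum>i\<in>D'. mon (yexp y i) \<otimes> (f i \<otimes> z)) \<in> J"
      using left_subD(6)[OF J' s b] by (simp only: e add_diff_cancel_right')
    define k where "k = nat (i1 - i0)"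
    define c where "c = (\<lambda>i. \<kappa> (- yexp y i0) (yexp y i))"
    have mm: "mon (- yexp y i0) \<otimes> (mon (yexp y i) \<otimes> x) = sc (c i) (mon (yexp y (int (nat (i - i0)))) \<otimes> x)" if "i \<in> D'" for i x
      using i(3)[OF that] by (simp add: tm_assoc[symmetric] mon_mon tm_sc c_def yexp_diff)
    have "mon (- yexp y i0) \<otimes> (\<Sum>i\<in>D'. mon (yexp y i) \<otimes> (f i \<otimes> z)) \<in> J"
      by (intro left_subD(3)[OF J' mon_RS[OF exps_uminus[OF yN]] sJ])
    also have "mon (- yexp y i0) \<otimes> (\<Sum>i\<in>D'. mon (yexp y i) \<otimes> (f i \<otimes> z)) = (\<Sum>i\<in>D'. sc (c i) (mon (yexp y (int (nat (i - i0)))) \<otimes> (f i \<otimes> z)))"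
      unfolding tm_sum by (intro sum.cong refl mm)
    also have "\<dots> = sc (c i1) (mon (yexp y (int k)) \<otimes> (f i1 \<otimes> z)) + (\<Sum>i\<in>D'-{i1}. sc (c i) (mon (yexp y (int (nat (i - i0)))) \<otimes> (f i \<otimes> z)))"
      using D' i by (simp add: sum.remove[of D' i1] k_def)
    finally have tot: "sc (c i1) (mon (yexp y (int k)) \<otimes> (f i1 \<otimes> z)) + (\<Sum>i\<in>D'-{i1}. sc (c i) (mon (yexp y (int (nat (i - i0)))) \<otimes> (f i \<otimes> z))) \<in> J" (is "?A + ?B \<in> J") .
    have "inL k ?B"
    proof (intro inL_sum inL_sc)
      fix i assume i': "i \<in> D' - {i1}"
      then have "i < i1" using i(3)[of i] by auto
      then have "nat (i - i0) < k" using i(3)[of i] i' by (simp add: k_def)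
      moreover have "f i \<in> RS N0" using f i' by (auto simp: D'_def)
      ultimately show "inL k (mon (yexp y (int (nat (i - i0)))) \<otimes> (f i \<otimes> z))" unfolding Yzs by (intro inL_zs) auto
    qed
    then have "inL k ((?A + ?B) + sc (- 1) ?B)" by (rule inL_add[OF inL_J[OF tot] inL_sc])
    then have "inL k ?A" by (simp add: sc_simps)
    then have "inL k (sc (inverse (c i1)) ?A)" by (rule inL_sc)
    then have "inL k (mon (yexp y (int k)) \<otimes> (f i1 \<otimes> z))" by (simp add: sc_simps c_def)
    moreover have "f i1 \<in> RS N0" "f i1 \<otimes> z \<notin> J" using f i by (auto simp: D'_def)
    ultimately show False using no_rel by blast
  qed
  have "maximal_left N0 (ann J z \<inter> RS N0)"
    unfolding maximal_left_def
  proof (intro conjI ballI impI)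
    show "left_sub N0 (ann J z \<inter> RS N0)" using left_sub_ann[OF JN0, of z] by (auto simp: left_sub_def)
    show "ann J z \<inter> RS N0 \<subseteq> RS N0" by blast
    show "mon 0 \<notin> ann J z \<inter> RS N0" using z by (simp add: ann_def)
    fix f assume f: "f \<in> RS N0" "f \<notin> ann J z \<inter> RS N0"
    then have fz: "f \<otimes> z \<notin> J" "f \<otimes> z \<in> RS N" using z RSs by (auto simp: ann_def)
    then obtain h where h: "h \<in> RS N" "mon 0 - h \<otimes> (f \<otimes> z) \<in> J" using J by (auto simp: maximal_left_def)
    \<comment> \<open>This writes \<open>z\<close> as a multiple of \<open>f \<otimes> z\<close> by
      an element of the large torus. By \<open>direct\<close>, its component of degree 0 in
      \<open>y\<close> does the same, and that multiplier lies in \<open>RS N0\<close>.\<close>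
    have "z \<otimes> (mon 0 - h \<otimes> (f \<otimes> z)) \<in> J" using h z by (intro left_subD(3)[OF J'])
    then have zz: "z - (z \<otimes> h) \<otimes> (f \<otimes> z) \<in> J" by (simp add: tm_diff tm_assoc)
    obtain D g where g: "finite D" "\<And>i. g i \<in> RS N0" "z \<otimes> h = (\<Sum>i\<in>D. mon (yexp y i) \<otimes> g i)"
      using decompose[of "z \<otimes> h" N y] z h unfolding N0_def by blast
    define g' where "g' = (\<lambda>i. if i \<in> D then g i else 0)"
    define u where "u = (\<lambda>i. (if i = 0 then mon 0 else 0) - g' i \<otimes> f)"
    have zh: "z \<otimes> h = (\<Sum>i\<in>insert 0 D. mon (yexp y i) \<otimes> g' i)"
      unfolding g(3) by (rule sum.mono_neutral_cong_left) (use g(1) in \<open>auto simp: g'_def\<close>)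
    have "(\<Sum>i\<in>insert 0 D. mon (yexp y i) \<otimes> (u i \<otimes> z))
        = (\<Sum>i\<in>insert 0 D. if i = 0 then z else 0) - (\<Sum>i\<in>insert 0 D. mon (yexp y i) \<otimes> (g' i \<otimes> (f \<otimes> z)))"
      unfolding sum_subtractf[symmetric] by (intro sum.cong refl) (simp add: u_def tm_diff tm_assoc)
    also have "(\<Sum>i\<in>insert 0 D. if i = 0 then z else 0) = z" using g(1) by simp
    also have "(\<Sum>i\<in>insert 0 D. mon (yexp y i) \<otimes> (g' i \<otimes> (f \<otimes> z))) = (z \<otimes> h) \<otimes> (f \<otimes> z)"
      unfolding zh tm_sum tm_assoc ..
    finally have "(\<Sum>i\<in>insert 0 D. mon (yexp y i) \<otimes> (u i \<otimes> z)) \<in> J" using zz by simp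
    moreover have "u i \<in> RS N0" for i using g(2) f(1) by (auto simp: u_def g'_def intro!: RS_closed RS_tm mon_RS)
    ultimately have "\<forall>i\<in>insert 0 D. u i \<otimes> z \<in> J" using g(1) by (intro direct) auto
    then have "(mon 0 - g' 0 \<otimes> f) \<otimes> z \<in> J" by (simp add: u_def)
    moreover have "g' 0 \<in> RS N0" using g(2) by (auto simp: g'_def)
    ultimately show "\<exists>g\<in>RS N0. mon 0 - g \<otimes> f \<in> ann J z \<inter> RS N0"
      using f(1) by (intro bexI[of _ "g' 0"]) (auto simp: ann_def intro!: RS_closed RS_tm mon_RS)
  qed
  then show ?thesis using z unfolding N0_def by blast
qed

end

section \<open>A valuation on a module of finite rank\<close>

context twisted
begin

lemma sc_inverse: "c \<noteq> 0 \<Longrightarrow> sc (inverse c) (sc c f) = f"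
  by (simp add: sc_simps)

text \<open>A basis over the fractions of \<open>RS I\<close>, expressed with cleared denominators.
  The first vector is the generator, so that the generator gets valuation exactly 0.\<close>

definition basis :: "nat set \<Rightarrow> nat set \<Rightarrow> 'k ta set \<Rightarrow> nat \<Rightarrow> (nat \<Rightarrow> 'k ta) \<Rightarrow> bool" where
  "basis N I J \<rho> E \<longleftrightarrow> 0 < \<rho> \<and> E 0 = mon 0 \<and> (\<forall>l<\<rho>. E l \<in> RS N) \<and> indep I J \<rho> E \<and>
    (\<forall>x\<in>RS N. \<exists>g\<in>RS I. g \<noteq> 0 \<and> (\<exists>gs. (\<forall>l<\<rho>. gs l \<in> RS I) \<and> g \<otimes> x - (\<Sum>l<\<rho>. gs l \<otimes> E l) \<in> J))"

lemma exists_basis: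
  assumes N: "finite N" and I: "I \<subseteq> N" "free J I" and J: "left_sub N J"
    and e: "\<And>I'. I' \<subseteq> N \<Longrightarrow> free J I' \<Longrightarrow> card I' \<le> card I"
  shows "\<exists>\<rho> E. basis N I J \<rho> E"
proof -
  have ann1: "ann J (mon 0) = J" by (simp add: ann_def)
  have "\<exists>B. \<forall>r m. (\<forall>l<r. \<exists>f. (\<forall>i<(1::nat). f i \<in> RS N) \<and> m l - (\<Sum>i<(1::nat). f i \<otimes> mon 0) \<in> J) \<longrightarrow>
      indep I J r m \<longrightarrow> r \<le> B"
    by (rule finite_rank[OF N I(1) J]) (use e in \<open>simp add: ann1\<close>)
  then obtain B where B: "\<And>r m. (\<forall>l<r. \<exists>f. (\<forall>i<(1::nat). f i \<in> RS N) \<and> m l - (\<Sum>i<(1::nat). f i \<otimes> mon 0) \<in> J) \<Longrightarrow>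
      indep I J r m \<Longrightarrow> r \<le> B" by blast
  have B': "r \<le> B" if "\<forall>l<r. m l \<in> RS N" "indep I J r m" for r m
  proof (rule B[OF _ that(2)], intro allI impI)
    fix l assume "l < r"
    then show "\<exists>f. (\<forall>i<(1::nat). f i \<in> RS N) \<and> m l - (\<Sum>i<(1::nat). f i \<otimes> mon 0) \<in> J"
      by (intro exI[of _ "\<lambda>_. m l"]) (simp add: that(1) left_subD(1)[OF J])
  qed
  define P where "P = (\<lambda>r. \<exists>m. (\<forall>l<r. m l \<in> RS N) \<and> m 0 = mon 0 \<and> indep I J r m)"
  have P1: "P 1"
    unfolding P_def
  proof (intro exI[of _ "\<lambda>_. mon 0"] conjI allI impI refl)
    show "mon 0 \<in> RS N" by (simp add: mon_RS)
    show "indep I J 1 (\<lambda>_. mon 0)" using I(2) by (simp add: indep_def free_def)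
  qed
  have PB: "r \<le> B" if "P r" for r using that B' unfolding P_def by blast
  define \<rho> where "\<rho> = (GREATEST r. P r)"
  have "P \<rho>" unfolding \<rho>_def by (rule GreatestI_nat[where P = P and b = B, OF P1 PB])
  moreover have ge: "r \<le> \<rho>" if "P r" for r unfolding \<rho>_def by (rule Greatest_le_nat[where P = P and b = B, OF that PB])
  ultimately obtain E where E: "\<forall>l<\<rho>. E l \<in> RS N" "E 0 = mon 0" "indep I J \<rho> E" unfolding P_def by blast
  have r0: "0 < \<rho>" using ge[OF P1] by simp
  have "\<exists>g\<in>RS I. g \<noteq> 0 \<and> (\<exists>gs. (\<forall>l<\<rho>. gs l \<in> RS I) \<and> g \<otimes> x - (\<Sum>l<\<rho>. gs l \<otimes> E l) \<in> J)" if x: "x \<in> RS N" for x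
  proof -
    define m where "m = (\<lambda>l. if l < \<rho> then E l else x)"
    have "\<not> indep I J (Suc \<rho>) m"
    proof
      assume "indep I J (Suc \<rho>) m"
      then have "P (Suc \<rho>)" unfolding P_def using E r0 x by (intro exI[of _ m]) (simp add: m_def)
      then show False using ge by fastforce
    qed
    then obtain g where g: "\<forall>l<Suc \<rho>. g l \<in> RS I" "(\<Sum>l<Suc \<rho>. g l \<otimes> m l) \<in> J" "\<exists>l<Suc \<rho>. g l \<noteq> 0"
      unfolding indep_def by blast
    have s: "(\<Sum>l<Suc \<rho>. g l \<otimes> m l) = (\<Sum>l<\<rho>. g l \<otimes> E l) + g \<rho> \<otimes> x" by (simp add: m_def)
    have gn: "g \<rho> \<noteq> 0"
    proof
      assume "g \<rho> = 0"
      then have "(\<Sum>l<\<rho>. g l \<otimes> E l) \<in> J" using g(2) by (simp only: s tm_zero add_0_right)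
      then have "\<forall>l<\<rho>. g l = 0" using indepD[OF E(3), of g] g(1) by (meson less_Suc_eq)
      then show False using g(3) \<open>g \<rho> = 0\<close> by (auto simp: less_Suc_eq)
    qed
    have "g \<rho> \<otimes> x - (\<Sum>l<\<rho>. (- g l) \<otimes> E l) = (\<Sum>l<Suc \<rho>. g l \<otimes> m l)"
      by (simp only: s tm_uminus sum_negf) simp
    then have "g \<rho> \<otimes> x - (\<Sum>l<\<rho>. (- g l) \<otimes> E l) \<in> J" using g(2) by (simp only:)
    moreover have "\<forall>l<\<rho>. - g l \<in> RS I" using g(1) by auto
    moreover have "g \<rho> \<in> RS I" using g(1) by simp
    ultimately show ?thesis using gn by (intro bexI[of _ "g \<rho>"] conjI exI[of _ "\<lambda>l. - g l"])
  qed
  then have "basis N I J \<rho> E" using E r0 unfolding basis_def by blast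
  then show ?thesis by blast
qed

text \<open>\<open>vl f t\<close> says that the coordinates of \<open>f\<close> with respect to \<open>E\<close>, taken in the division ring of
  fractions of \<open>RS I\<close>, have valuation at least \<open>t\<close>.\<close>

definition vl :: "nat set \<Rightarrow> 'k ta set \<Rightarrow> nat \<Rightarrow> (nat \<Rightarrow> 'k ta) \<Rightarrow> 'k ta \<Rightarrow> real \<Rightarrow> bool" where
  "vl I J \<rho> E f t \<longleftrightarrow> (\<exists>g\<in>RS I. g \<noteq> 0 \<and> (\<exists>gs. (\<forall>l<\<rho>. gs l \<in> RS I \<and> vge I (gs l) (vmin I g + t)) \<and>
     g \<otimes> f - (\<Sum>l<\<rho>. gs l \<otimes> E l) \<in> J))"

lemma vge_mono: "vge S f s \<Longrightarrow> t \<le> s \<Longrightarrow> vge S f t"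
  by (force simp: vge_def)

lemma vge_zero [simp]: "vge S 0 s"
  by (simp add: vge_def)

lemma vl_mono: "vl I J \<rho> E f s \<Longrightarrow> t \<le> s \<Longrightarrow> vl I J \<rho> E f t"
  unfolding vl_def by (meson vge_mono add_left_mono)

lemma vmin_one [simp]: "vmin I (mon 0) = 0"
  by (simp add: vmin_def)

lemma vl_J: assumes "f \<in> J" shows "vl I J \<rho> E f t"
  unfolding vl_def
proof (intro bexI[of _ "mon 0"] conjI exI[of _ "\<lambda>_. 0"])
  show "mon 0 \<otimes> f - (\<Sum>l<\<rho>. 0 \<otimes> E l) \<in> J" using assms by simp
qed (simp_all add: mon_RS)

text \<open>Bring both fractions to the common denominator
  \<open>a \<otimes> g = b \<otimes> g'\<close>; as \<open>vmin\<close> is additive on products,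
  numerators and denominators are shifted by the same amount.\<close>

lemma vl_add:
  assumes I: "finite I" and J: "left_sub I J" and f: "vl I J \<rho> E f t" and f': "vl I J \<rho> E f' t"
  shows "vl I J \<rho> E (f + f') t"
proof -
  obtain g gs where g: "g \<in> RS I" "g \<noteq> 0" "\<And>l. l < \<rho> \<Longrightarrow> gs l \<in> RS I" "\<And>l. l < \<rho> \<Longrightarrow> vge I (gs l) (vmin I g + t)"
    "g \<otimes> f - (\<Sum>l<\<rho>. gs l \<otimes> E l) \<in> J" using f unfolding vl_def by blast
  obtain g' gs' where g': "g' \<in> RS I" "g' \<noteq> 0" "\<And>l. l < \<rho> \<Longrightarrow> gs' l \<in> RS I" "\<And>l. l < \<rho> \<Longrightarrow> vge I (gs' l) (vmin I g' + t)"
    "g' \<otimes> f' - (\<Sum>l<\<rho>. gs' l \<otimes> E l) \<in> J" using f' unfolding vl_def by blast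
  obtain a b where ab: "a \<in> RS I" "b \<in> RS I" "a \<noteq> 0" "a \<otimes> g = b \<otimes> g'" using ore[OF I g(1) g'(1,2)] by blast
  have ag: "a \<otimes> g \<noteq> 0" "vmin I (a \<otimes> g) = vmin I a + vmin I g" by (rule tm_lead[OF I ab(1,3) g(1,2)])+
  have b: "b \<noteq> 0" using ag(1) ab(4) by auto
  have bg: "vmin I (a \<otimes> g) = vmin I b + vmin I g'" unfolding ab(4) by (rule tm_lead(2)[OF I ab(2) b g'(1,2)])
  show ?thesis
    unfolding vl_def
  proof (intro bexI[of _ "a \<otimes> g"] conjI exI[of _ "\<lambda>l. a \<otimes> gs l + b \<otimes> gs' l"] allI impI ag RS_tm RS_closed(2) ab(1,2) g(1))
    fix l assume l: "l < \<rho>"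
    show "gs l \<in> RS I" "gs' l \<in> RS I" using g g' l by auto
    show "vge I (a \<otimes> gs l + b \<otimes> gs' l) (vmin I (a \<otimes> g) + t)"
    proof (rule vge_add)
      have "vge I (a \<otimes> gs l) (vmin I a + (vmin I g + t))" by (rule vge_tm[OF vmin_vge g(4)[OF l]])
      then show "vge I (a \<otimes> gs l) (vmin I (a \<otimes> g) + t)" by (simp add: ag add.assoc)
      have "vge I (b \<otimes> gs' l) (vmin I b + (vmin I g' + t))" by (rule vge_tm[OF vmin_vge g'(4)[OF l]])
      then show "vge I (b \<otimes> gs' l) (vmin I (a \<otimes> g) + t)" by (simp add: bg add.assoc)
    qed
  next
    have "a \<otimes> g \<otimes> (f + f') - (\<Sum>l<\<rho>. (a \<otimes> gs l + b \<otimes> gs' l) \<otimes> E l) =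
      a \<otimes> (g \<otimes> f - (\<Sum>l<\<rho>. gs l \<otimes> E l)) + b \<otimes> (g' \<otimes> f' - (\<Sum>l<\<rho>. gs' l \<otimes> E l))"
      by (simp add: tm_add_right tm_add_left tm_diff tm_sum sum.distrib tm_assoc[symmetric] ab(4))
    also have "\<dots> \<in> J" by (rule left_subD(2)[OF J left_subD(3)[OF J ab(1) g(5)] left_subD(3)[OF J ab(2) g'(5)]])
    finally show "a \<otimes> g \<otimes> (f + f') - (\<Sum>l<\<rho>. (a \<otimes> gs l + b \<otimes> gs' l) \<otimes> E l) \<in> J" .
  qed
qed

lemma vl_cong:
  assumes I: "finite I" and J: "left_sub I J" and f: "vl I J \<rho> E f t" and d: "f' - f \<in> J"
  shows "vl I J \<rho> E f' t"
  using vl_add[OF I J f vl_J[OF d]] by simp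

lemma vl_sum:
  assumes I: "finite I" and J: "left_sub I J" and f: "\<And>i. i \<in> A \<Longrightarrow> vl I J \<rho> E (F i) t"
  shows "vl I J \<rho> E (sum F A) t"
  using f by (induction A rule: infinite_finite_induct) (auto intro: vl_add[OF I J] vl_J left_subD(1)[OF J])

lemma vge_vmin: "f \<noteq> 0 \<Longrightarrow> vge S f s \<Longrightarrow> s \<le> vmin S f"
  using vmin_attained[of f S] by (auto simp: vge_def)

text \<open>The factor \<open>c\<close> is moved past the denominator:
  \<open>a \<otimes> c = b \<otimes> g\<close> turns \<open>c\<close> times the inverse of
  \<open>g\<close> into the inverse of \<open>a\<close> times \<open>b\<close>.\<close>

lemma vl_mult:
  assumes I: "finite I" and J: "left_sub I J" and f: "vl I J \<rho> E f t" and c: "c \<in> RS I" "vge I c s"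
  shows "vl I J \<rho> E (c \<otimes> f) (t + s)"
proof (cases "c = 0")
  case True
  then show ?thesis by (simp add: vl_J left_subD(1)[OF J])
next
  case False
  obtain g gs where g: "g \<in> RS I" "g \<noteq> 0" "\<And>l. l < \<rho> \<Longrightarrow> gs l \<in> RS I" "\<And>l. l < \<rho> \<Longrightarrow> vge I (gs l) (vmin I g + t)"
    "g \<otimes> f - (\<Sum>l<\<rho>. gs l \<otimes> E l) \<in> J" using f unfolding vl_def by blast
  obtain a b where ab: "a \<in> RS I" "b \<in> RS I" "a \<noteq> 0" "a \<otimes> c = b \<otimes> g" using ore[OF I c(1) g(1,2)] by blast
  have ac: "a \<otimes> c \<noteq> 0" "vmin I (a \<otimes> c) = vmin I a + vmin I c" by (rule tm_lead[OF I ab(1,3) c(1) False])+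
  have b: "b \<noteq> 0" using ac(1) ab(4) by auto
  have bg: "vmin I (a \<otimes> c) = vmin I b + vmin I g" unfolding ab(4) by (rule tm_lead(2)[OF I ab(2) b g(1,2)])
  show ?thesis
    unfolding vl_def
  proof (intro bexI[of _ a] conjI exI[of _ "\<lambda>l. b \<otimes> gs l"] allI impI RS_tm ab(1,2,3))
    fix l assume l: "l < \<rho>"
    show "gs l \<in> RS I" using g l by auto
    have "vge I (b \<otimes> gs l) (vmin I b + (vmin I g + t))" by (rule vge_tm[OF vmin_vge g(4)[OF l]])
    moreover have "s \<le> vmin I c" by (rule vge_vmin[OF False c(2)])
    ultimately show "vge I (b \<otimes> gs l) (vmin I a + (t + s))" using ac(2) bg by (elim vge_mono) simp
  next
    have "a \<otimes> (c \<otimes> f) - (\<Sum>l<\<rho>. b \<otimes> gs l \<otimes> E l) = b \<otimes> (g \<otimes> f - (\<Sum>l<\<rho>. gs l \<otimes> E l))"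
      by (simp add: tm_diff tm_sum tm_assoc[symmetric] ab(4))
    also have "\<dots> \<in> J" by (rule left_subD(3)[OF J ab(2) g(5)])
    finally show "a \<otimes> (c \<otimes> f) - (\<Sum>l<\<rho>. b \<otimes> gs l \<otimes> E l) \<in> J" .
  qed
qed

lemma vl_sc:
  assumes I: "finite I" and J: "left_sub I J" and f: "vl I J \<rho> E f t"
  shows "vl I J \<rho> E (sc c f) t"
proof -
  have "vge I (single 0 c) 0" by (simp add: vge_def)
  from vl_mult[OF I J f RS_single[OF exps_zero] this] show ?thesis by (simp add: sc_eq_tm)
qed

lemma vl_divide:
  assumes I: "finite I" and f: "vl I J \<rho> E (h \<otimes> f) t" and h: "h \<in> RS I" "h \<noteq> 0"
  shows "vl I J \<rho> E f (t - vmin I h)"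
proof -
  obtain g gs where g: "g \<in> RS I" "g \<noteq> 0" "\<And>l. l < \<rho> \<Longrightarrow> gs l \<in> RS I" "\<And>l. l < \<rho> \<Longrightarrow> vge I (gs l) (vmin I g + t)"
    "g \<otimes> (h \<otimes> f) - (\<Sum>l<\<rho>. gs l \<otimes> E l) \<in> J" using f unfolding vl_def by blast
  have gh: "g \<otimes> h \<noteq> 0" "vmin I (g \<otimes> h) = vmin I g + vmin I h" by (rule tm_lead[OF I g(1,2) h])+
  show ?thesis
    unfolding vl_def
  proof (intro bexI[of _ "g \<otimes> h"] conjI exI[of _ gs] allI impI RS_tm gh(1) g(1) h(1) g(3))
    fix l assume l: "l < \<rho>"
    show "vge I (gs l) (vmin I (g \<otimes> h) + (t - vmin I h))" using g(4)[OF l] gh(2) by simp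
  next
    show "g \<otimes> h \<otimes> f - (\<Sum>l<\<rho>. gs l \<otimes> E l) \<in> J" using g(5) by (simp add: tm_assoc)
  qed
qed

lemma vl_exists:
  assumes B: "basis N I J \<rho> E" and x: "x \<in> RS N"
  shows "\<exists>t. vl I J \<rho> E x t"
proof -
  obtain g gs where g: "g \<in> RS I" "g \<noteq> 0" "\<forall>l<\<rho>. gs l \<in> RS I" "g \<otimes> x - (\<Sum>l<\<rho>. gs l \<otimes> E l) \<in> J"
    using B x unfolding basis_def by blast
  define A where "A = (\<Union>l\<in>{..<\<rho>}. height I ` keys (gs l))"
  have "finite A" unfolding A_def by simp
  then obtain s where s: "\<And>a. a \<in> A \<Longrightarrow> s \<le> a" using bdd_below_finite[of A] unfolding bdd_below_def by blast
  have "vge I (gs l) (vmin I g + (s - vmin I g))" if "l < \<rho>" for l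
    using s that by (auto simp: vge_def A_def)
  then show ?thesis unfolding vl_def using g by blast
qed

text \<open>Conjugation by \<open>mon d\<close> keeps the heights in numerators and denominators, so
  the loss comes only from the images of the finitely many basis vectors, and \<open>K\<close> is
  uniform.\<close>

lemma vl_mon:
  assumes N: "finite N" and I: "I \<subseteq> N" and J: "left_sub N J" and B: "basis N I J \<rho> E" and d: "d \<in> exps N"
  shows "\<exists>K. \<forall>f t. vl I J \<rho> E f t \<longrightarrow> vl I J \<rho> E (mon d \<otimes> f) (t - K)"
proof -
  have fI: "finite I" using N I finite_subset by auto
  have JI: "left_sub I J" by (rule left_sub_mono[OF J I])
  have "\<forall>l. \<exists>t. l < \<rho> \<longrightarrow> vl I J \<rho> E (mon d \<otimes> E l) t"
  proof
    fix l
    show "\<exists>t. l < \<rho> \<longrightarrow> vl I J \<rho> E (mon d \<otimes> E l) t"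
    proof (cases "l < \<rho>")
      case True
      then have "mon d \<otimes> E l \<in> RS N" using B d by (intro RS_tm mon_RS) (simp_all add: basis_def)
      from vl_exists[OF B this] show ?thesis by blast
    qed simp
  qed
  from choice[OF this] obtain t0 where t0: "\<forall>l. l < \<rho> \<longrightarrow> vl I J \<rho> E (mon d \<otimes> E l) (t0 l)" ..
  define K where "K = (\<Sum>l<\<rho>. \<bar>t0 l\<bar>)"
  have K: "vl I J \<rho> E (mon d \<otimes> E l) (- K)" if "l < \<rho>" for l
  proof -
    have "\<bar>t0 l\<bar> \<le> K" unfolding K_def using that by (intro member_le_sum) auto
    then have "- K \<le> t0 l" by linarith
    moreover have "vl I J \<rho> E (mon d \<otimes> E l) (t0 l)" using t0 that by simp
    ultimately show ?thesis by (rule vl_mono[rotated])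
  qed
  have "vl I J \<rho> E (mon d \<otimes> f) (t - K)" if f: "vl I J \<rho> E f t" for f t
  proof -
    obtain g gs where g: "g \<in> RS I" "g \<noteq> 0" "\<And>l. l < \<rho> \<Longrightarrow> gs l \<in> RS I" "\<And>l. l < \<rho> \<Longrightarrow> vge I (gs l) (vmin I g + t)"
      "g \<otimes> f - (\<Sum>l<\<rho>. gs l \<otimes> E l) \<in> J" using f unfolding vl_def by blast
    have a: "vl I J \<rho> E (\<Sum>l<\<rho>. tconj d (gs l) \<otimes> (mon d \<otimes> E l)) (- K + (vmin I g + t))"
      by (intro vl_sum[OF fI JI] vl_mult[OF fI JI K]) (use g in auto)
    have b: "tconj d g \<otimes> (mon d \<otimes> f) - (\<Sum>l<\<rho>. tconj d (gs l) \<otimes> (mon d \<otimes> E l)) = mon d \<otimes> (g \<otimes> f - (\<Sum>l<\<rho>. gs l \<otimes> E l))"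
      by (simp add: tm_diff tm_sum mon_shift)
    have "mon d \<otimes> (g \<otimes> f - (\<Sum>l<\<rho>. gs l \<otimes> E l)) \<in> J" by (rule left_subD(3)[OF J mon_RS[OF d] g(5)])
    then have "vl I J \<rho> E (tconj d g \<otimes> (mon d \<otimes> f)) (- K + (vmin I g + t))"
      by (intro vl_cong[OF fI JI a]) (simp only: b)
    from vl_divide[OF fI this] g show ?thesis by simp
  qed
  then show ?thesis by blast
qed

text \<open>The generator is the first basis vector; independence forces its first coordinate to be
  1, whose valuation is 0.\<close>

lemma not_vl_one:
  assumes B: "basis N I J \<rho> E" and t: "t > 0"
  shows "\<not> vl I J \<rho> E (mon 0) t"
proof
  assume "vl I J \<rho> E (mon 0) t"
  then obtain g gs where g: "g \<in> RS I" "g \<noteq> 0" "\<And>l. l < \<rho> \<Longrightarrow> gs l \<in> RS I" "\<And>l. l < \<rho> \<Longrightarrow> vge I (gs l) (vmin I g + t)"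
    "g \<otimes> mon 0 - (\<Sum>l<\<rho>. gs l \<otimes> E l) \<in> J" unfolding vl_def by blast
  have r: "0 < \<rho>" "E 0 = mon 0" "indep I J \<rho> E" using B by (auto simp: basis_def)
  define c where "c = (\<lambda>l. (if l = 0 then g else 0) - gs l)"
  have "(\<Sum>l<\<rho>. c l \<otimes> E l) = (\<Sum>l<\<rho>. if l = 0 then g \<otimes> mon 0 else 0) - (\<Sum>l<\<rho>. gs l \<otimes> E l)"
    unfolding sum_subtractf[symmetric] by (intro sum.cong refl) (simp add: c_def tm_diff r(2))
  also have "(\<Sum>l<\<rho>. if l = 0 then g \<otimes> mon 0 else 0) = g \<otimes> mon 0" using r(1) by simp
  finally have s: "(\<Sum>l<\<rho>. c l \<otimes> E l) \<in> J" using g(5) by (simp only:)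
  have "c l \<in> RS I" if "l < \<rho>" for l using g(1) g(3)[OF that] by (simp add: c_def)
  from indepD[OF r(3) this s r(1)] have "gs 0 = g" by (simp add: c_def)
  then have "vge I g (vmin I g + t)" using g(4)[OF r(1)] by simp
  from vge_vmin[OF g(2) this] t show False by simp
qed

lemma vl_one: assumes B: "basis N I J \<rho> E" and J: "left_sub N J" shows "vl I J \<rho> E (mon 0) 0"
  unfolding vl_def
proof (intro bexI[of _ "mon 0"] conjI exI[of _ "\<lambda>l. if l = 0 then mon 0 else 0"])
  have r: "0 < \<rho>" "E 0 = mon 0" using B by (auto simp: basis_def)
  have "(\<Sum>l<\<rho>. (if l = 0 then mon 0 else 0) \<otimes> E l) = (\<Sum>l<\<rho>. if l = 0 then mon 0 else 0)"
    by (intro sum.cong refl) (simp add: r(2))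
  also have "\<dots> = mon 0" using r(1) by simp
  finally show "mon 0 \<otimes> mon 0 - (\<Sum>l<\<rho>. (if l = 0 then mon 0 else 0) \<otimes> E l) \<in> J" by (simp add: left_subD(1)[OF J])
  show "\<forall>l<\<rho>. (if l = 0 then mon 0 else 0) \<in> RS I \<and> vge I (if l = 0 then mon 0 else 0) (vmin I (mon 0) + 0)"
    by (simp add: mon_RS vge_def)
qed (simp_all add: mon_RS)

lemma vl_yexp:
  assumes N: "finite N" and I: "I \<subseteq> N" and J: "left_sub N J" and B: "basis N I J \<rho> E" and y: "y \<in> N"
  shows "\<exists>K\<ge>0. \<forall>f t i. vl I J \<rho> E f t \<longrightarrow> vl I J \<rho> E (mon (yexp y i) \<otimes> f) (t - K * \<bar>real_of_int i\<bar>)"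
proof -
  have fI: "finite I" using N I finite_subset by auto
  have JI: "left_sub I J" by (rule left_sub_mono[OF J I])
  have pos: "vl I J \<rho> E (mon (yexp y (s * int n)) \<otimes> f) (t - K * real n)"
    if K: "\<forall>f t. vl I J \<rho> E f t \<longrightarrow> vl I J \<rho> E (mon (yexp y s) \<otimes> f) (t - K)" and f: "vl I J \<rho> E f t" for K s f t n
  proof (induction n)
    case (Suc n)
    have "vl I J \<rho> E (mon (yexp y s) \<otimes> (mon (yexp y (s * int n)) \<otimes> f)) (t - K * real n - K)" using K Suc by blast
    then have "vl I J \<rho> E (sc (inverse (\<kappa> (yexp y s) (yexp y (s * int n)))) (mon (yexp y s) \<otimes> (mon (yexp y (s * int n)) \<otimes> f))) (t - K * real n - K)"
      by (rule vl_sc[OF fI JI])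
    moreover have "sc (inverse (\<kappa> (yexp y s) (yexp y (s * int n)))) (mon (yexp y s) \<otimes> (mon (yexp y (s * int n)) \<otimes> f)) = mon (yexp y (s * int (Suc n))) \<otimes> f"
      by (simp add: tm_assoc[symmetric] mon_mon tm_sc sc_simps yexp_add[symmetric] distrib_left)
    ultimately show ?case by (simp add: algebra_simps)
  next
    case 0
    show ?case using f by (simp only: of_nat_0 mult_zero_right yexp_zero mon_zero diff_zero)
  qed
  obtain K1 where K1: "\<forall>f t. vl I J \<rho> E f t \<longrightarrow> vl I J \<rho> E (mon (yexp y 1) \<otimes> f) (t - K1)" using vl_mon[OF N I J B yexp_exps[OF y]] by blast
  obtain K2 where K2: "\<forall>f t. vl I J \<rho> E f t \<longrightarrow> vl I J \<rho> E (mon (yexp y (- 1)) \<otimes> f) (t - K2)" using vl_mon[OF N I J B yexp_exps[OF y]] by blast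
  define K where "K = \<bar>K1\<bar> + \<bar>K2\<bar>"
  have "vl I J \<rho> E (mon (yexp y i) \<otimes> f) (t - K * \<bar>real_of_int i\<bar>)" if f: "vl I J \<rho> E f t" for f t i
  proof (cases "i \<ge> 0")
    case True
    have "vl I J \<rho> E (mon (yexp y (1 * int (nat i))) \<otimes> f) (t - K1 * real (nat i))" by (rule pos[OF K1 f])
    moreover have "K1 * real (nat i) \<le> K * \<bar>real_of_int i\<bar>" using True by (intro mult_mono) (auto simp: K_def)
    ultimately show ?thesis using True by (auto elim: vl_mono)
  next
    case False
    have "vl I J \<rho> E (mon (yexp y (- 1 * int (nat (- i)))) \<otimes> f) (t - K2 * real (nat (- i)))" by (rule pos[OF K2 f])
    moreover have "K2 * real (nat (- i)) \<le> K * \<bar>real_of_int i\<bar>" using False by (intro mult_mono) (auto simp: K_def)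
    ultimately show ?thesis using False by (auto elim: vl_mono)
  qed
  moreover have "K \<ge> 0" by (simp add: K_def)
  ultimately show ?thesis by blast
qed

text \<open>Compared with \<open>height I a\<close> the loss is only linear in the two exponents
  outside \<open>I\<close>; a quadratic term will outweigh it.\<close>

lemma vl_monomial:
  assumes N: "finite N" and I: "I \<subseteq> N" and J: "left_sub N J" and B: "basis N I J \<rho> E"
    and j: "j \<in> N" "j \<notin> I" and y: "y \<in> N" "y \<notin> I" "j \<noteq> y"
  shows "\<exists>K\<ge>0. \<forall>a\<in>exps (insert j (insert y I)). vl I J \<rho> E (mon a) (height I a - K * (\<bar>real_of_int (a j)\<bar> + \<bar>real_of_int (a y)\<bar>))"
proof -
  have fI: "finite I" using N I finite_subset by auto
  have JI: "left_sub I J" by (rule left_sub_mono[OF J I])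
  obtain K1 where K1: "K1 \<ge> 0" "\<And>f t i. vl I J \<rho> E f t \<Longrightarrow> vl I J \<rho> E (mon (yexp j i) \<otimes> f) (t - K1 * \<bar>real_of_int i\<bar>)"
    using vl_yexp[OF N I J B j(1)] by blast
  obtain K2 where K2: "K2 \<ge> 0" "\<And>f t i. vl I J \<rho> E f t \<Longrightarrow> vl I J \<rho> E (mon (yexp y i) \<otimes> f) (t - K2 * \<bar>real_of_int i\<bar>)"
    using vl_yexp[OF N I J B y(1)] by blast
  define K where "K = K1 + K2"
  have "vl I J \<rho> E (mon a) (height I a - K * (\<bar>real_of_int (a j)\<bar> + \<bar>real_of_int (a y)\<bar>))"
    if a: "a \<in> exps (insert j (insert y I))" for a
  proof -
    define a1 where "a1 = yexp j (a j)"
    define a2 where "a2 = yexp y (a y)"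
    define b where "b = a - (a1 + a2)"
    have b: "b \<in> exps I" using a j y by (auto simp: exps_def b_def a1_def a2_def yexp_def)
    have "height I b = height I a"
      unfolding height_def using j y by (intro sum.cong refl) (auto simp: b_def a1_def a2_def yexp_def)
    then have "vge I (mon b) (height I a)" by (simp add: vge_def)
    moreover have "vl I J \<rho> E (mon a1 \<otimes> (mon a2 \<otimes> mon 0)) (0 - K2 * \<bar>real_of_int (a y)\<bar> - K1 * \<bar>real_of_int (a j)\<bar>)"
      unfolding a1_def a2_def by (intro K1 K2 vl_one[OF B J])
    ultimately have v: "vl I J \<rho> E (mon b \<otimes> (mon a1 \<otimes> (mon a2 \<otimes> mon 0))) (0 - K2 * \<bar>real_of_int (a y)\<bar> - K1 * \<bar>real_of_int (a j)\<bar> + height I a)"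
      by (intro vl_mult[OF fI JI _ mon_RS[OF b]])
    have nz: "\<kappa> a1 a2 * \<kappa> b (a1 + a2) \<noteq> 0" by simp
    have eq: "mon b \<otimes> (mon a1 \<otimes> (mon a2 \<otimes> mon 0)) = sc (\<kappa> a1 a2 * \<kappa> b (a1 + a2)) (mon a)"
      by (simp add: mon_mon tm_sc sc_simps b_def)
    have "vl I J \<rho> E (sc (inverse (\<kappa> a1 a2 * \<kappa> b (a1 + a2))) (sc (\<kappa> a1 a2 * \<kappa> b (a1 + a2)) (mon a))) (0 - K2 * \<bar>real_of_int (a y)\<bar> - K1 * \<bar>real_of_int (a j)\<bar> + height I a)"
      by (rule vl_sc[OF fI JI v[unfolded eq]])
    then have "vl I J \<rho> E (mon a) (0 - K2 * \<bar>real_of_int (a y)\<bar> - K1 * \<bar>real_of_int (a j)\<bar> + height I a)"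
      by (simp only: sc_inverse[OF nz])
    moreover have "K2 * \<bar>real_of_int (a y)\<bar> + K1 * \<bar>real_of_int (a j)\<bar> \<le> K * \<bar>real_of_int (a y)\<bar> + K * \<bar>real_of_int (a j)\<bar>"
      using K1(1) K2(1) by (intro add_mono mult_right_mono) (auto simp: K_def)
    ultimately show ?thesis by (elim vl_mono) (simp add: algebra_simps)
  qed
  moreover have "K \<ge> 0" using K1(1) K2(1) by (simp add: K_def)
  ultimately show ?thesis by blast
qed

end

section \<open>Existence of slopes\<close>

context twisted
begin

definition slope_wt :: "nat set \<Rightarrow> nat \<Rightarrow> nat \<Rightarrow> real \<times> real \<Rightarrow> (nat \<Rightarrow> int) \<Rightarrow> real" where
  "slope_wt I j y \<theta> a = height I a + fst \<theta> * real_of_int (a j) + snd \<theta> * real_of_int (a y)"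

lemma slope_wt_add: "slope_wt I j y \<theta> (a + b) = slope_wt I j y \<theta> a + slope_wt I j y \<theta> b"
  and slope_wt_diff: "slope_wt I j y \<theta> (a - b) = slope_wt I j y \<theta> a - slope_wt I j y \<theta> b"
  and slope_wt_uminus: "slope_wt I j y \<theta> (- b) = - slope_wt I j y \<theta> b"
  and slope_wt_zero: "slope_wt I j y \<theta> 0 = 0"
  by (simp_all add: slope_wt_def height_add height_diff height_uminus algebra_simps)

text \<open>Such a relation rewrites \<open>mon 0\<close> into monomials of weight at least
  \<open>\<gamma>\<close>. The bound \<open>C\<close> on the two exponents outside \<open>I\<close>
  is recorded because a quadratic correction will later be applied to them.\<close>

definition ugap :: "nat set \<Rightarrow> nat \<Rightarrow> nat \<Rightarrow> 'k ta set \<Rightarrow> real \<Rightarrow> real \<Rightarrow> real \<times> real \<Rightarrow> bool" where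
  "ugap I j y J \<gamma> C \<theta> \<longleftrightarrow> (\<exists>f\<in>J. f \<in> RS (insert j (insert y I)) \<and> lookup f 0 = 1 \<and>
     (\<forall>a\<in>keys f - {0}. \<gamma> \<le> slope_wt I j y \<theta> a \<and> (real_of_int (a j))\<^sup>2 + (real_of_int (a y))\<^sup>2 \<le> C))"

text \<open>Some element of \<open>J\<close> has initial form 1, so the initial module for the
  slopes \<open>\<theta>\<close> vanishes.\<close>

definition bad :: "nat set \<Rightarrow> nat \<Rightarrow> nat \<Rightarrow> 'k ta set \<Rightarrow> real \<times> real \<Rightarrow> bool" where
  "bad I j y J \<theta> \<longleftrightarrow> (\<exists>f\<in>J. f \<in> RS (insert j (insert y I)) \<and> lookup f 0 = 1 \<and>
     (\<forall>a\<in>keys f - {0}. 0 < slope_wt I j y \<theta> a))"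

lemma ugap_mono:
  assumes "ugap I j y J \<gamma> C \<theta>" "\<gamma>' \<le> \<gamma>" "C \<le> C'" shows "ugap I j y J \<gamma>' C' \<theta>"
proof -
  obtain f where f: "f \<in> J" "f \<in> RS (insert j (insert y I))" "lookup f 0 = 1"
    "\<And>a. a \<in> keys f - {0} \<Longrightarrow> \<gamma> \<le> slope_wt I j y \<theta> a \<and> (real_of_int (a j))\<^sup>2 + (real_of_int (a y))\<^sup>2 \<le> C"
    using assms(1) unfolding ugap_def by blast
  have "\<gamma>' \<le> slope_wt I j y \<theta> a \<and> (real_of_int (a j))\<^sup>2 + (real_of_int (a y))\<^sup>2 \<le> C'" if "a \<in> keys f - {0}" for a
    using f(4)[OF that] assms(2,3) by auto
  then show ?thesis using f(1-3) unfolding ugap_def by blast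
qed

lemma finite_gap:
  assumes "finite A" "\<And>a. a \<in> A \<Longrightarrow> 0 < (h a :: real)" shows "\<exists>\<gamma>>0. \<forall>a\<in>A. \<gamma> \<le> h a"
  using assms
proof (induction A)
  case empty
  show ?case by (intro exI[of _ 1]) simp
next
  case (insert x A)
  then obtain \<gamma> where g: "\<gamma> > 0" "\<forall>a\<in>A. \<gamma> \<le> h a" by auto
  then show ?case using insert.prems[of x] by (intro exI[of _ "min \<gamma> (h x)"]) (auto simp: min_le_iff_disj)
qed

lemma finite_bd:
  assumes "finite A" shows "\<exists>C\<ge>0. \<forall>a\<in>A. (h a :: real) \<le> C"
proof (intro exI conjI ballI)
  show "0 \<le> (\<Sum>a\<in>A. \<bar>h a\<bar>)" by (simp add: sum_nonneg)
  fix a assume "a \<in> A"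
  then have "\<bar>h a\<bar> \<le> (\<Sum>a\<in>A. \<bar>h a\<bar>)" using assms by (intro member_le_sum) auto
  then show "h a \<le> (\<Sum>a\<in>A. \<bar>h a\<bar>)" by linarith
qed

text \<open>Far away in the direction \<open>s\<close> of the coordinate \<open>d\<close>, a single relation over \<open>insert d I\<close> suffices.\<close>

lemma ugap_far:
  fixes s :: int
  assumes I: "finite I" and J: "left_sub (insert j (insert y I)) J" and jy: "j \<notin> I" "y \<notin> I" "j \<noteq> y"
    and d: "d = j \<or> d = y" and s: "\<bar>s\<bar> = 1" and nf: "\<not> free J (insert d I)"
  shows "\<exists>\<Lambda> \<gamma> C. \<gamma> > 0 \<and> (\<forall>\<theta>. real_of_int s * (if d = j then fst \<theta> else snd \<theta>) \<ge> \<Lambda> \<longrightarrow> ugap I j y J \<gamma> C \<theta>)"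
proof -
  let ?A2 = "insert j (insert y I)"
  obtain f where f: "f \<in> RS (insert d I)" "f \<in> J" "f \<noteq> 0" using nf by (auto simp: free_def)
  \<comment> \<open>Normalise at an extreme exponent: least in direction \<open>s\<close>, and among
    those of least height. After division by it, every other exponent either has zero
    \<open>d\<close>-coordinate and positive height, or moves by at least 1 in direction
    \<open>s\<close>.\<close>
  define \<mu> where "\<mu> = Min ((\<lambda>a. s * a d) ` keys f)"
  define K0 where "K0 = {a \<in> keys f. s * a d = \<mu>}"
  have "keys f \<noteq> {}" using f(3) by simp
  then have "\<mu> \<in> (\<lambda>a. s * a d) ` keys f" unfolding \<mu>_def by (intro Min_in) auto
  then have K0: "K0 \<noteq> {}" "finite K0" by (auto simp: K0_def)
  have mu: "\<mu> \<le> s * a d" if "a \<in> keys f" for a unfolding \<mu>_def using that by (intro Min_le) auto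
  have "Min (height I ` K0) \<in> height I ` K0" using K0 by (intro Min_in) auto
  then obtain a0 where a0: "a0 \<in> K0" "height I a0 = Min (height I ` K0)" by auto
  have a0min: "height I a0 \<le> height I a" if "a \<in> K0" for a unfolding a0(2) using that K0 by (intro Min_le) auto
  have a0k: "a0 \<in> keys f" "s * a0 d = \<mu>" using a0 by (auto simp: K0_def)
  have a0e: "a0 \<in> exps (insert d I)" using f(1) a0k by (auto simp: RS_def)
  have dI: "d \<notin> I" using d jy by auto
  have sub: "exps (insert d I) \<subseteq> exps ?A2" using d by (intro exps_mono) auto
  define c where "c = \<kappa> (- a0) a0 * lookup f a0"
  have c: "c \<noteq> 0" using a0k by (simp add: c_def in_keys_iff)
  define f' where "f' = sc (inverse c) (mon (- a0) \<otimes> f)"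
  have f'J: "f' \<in> J" unfolding f'_def
    by (intro left_subD(4)[OF J] left_subD(3)[OF J mon_RS f(2)] exps_uminus) (use a0e sub in auto)
  have k': "keys f' = (\<lambda>b. - a0 + b) ` keys f" unfolding f'_def using c by (simp add: keys_sc_eq keys_mon_tm)
  have ke: "a \<in> exps (insert d I)" if "a \<in> keys f'" for a
    using that f(1) a0e unfolding k' RS_def by (auto intro!: exps_add exps_uminus exps_diff)
  have f'R: "f' \<in> RS ?A2" using ke sub by (auto simp: RS_def)
  have l1: "lookup f' 0 = 1" using c unfolding f'_def by (auto simp: lookup_mon_tm c_def field_simps)
  have key: "(s * a d = 0 \<and> 0 < height I a) \<or> 1 \<le> s * a d" if a: "a \<in> keys f' - {0}" for a
  proof -
    obtain b where b: "b \<in> keys f" "a = - a0 + b" using a unfolding k' by auto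
    have sd: "s * a d = s * b d - \<mu>" unfolding b(2) by (simp add: a0k(2)[symmetric] algebra_simps)
    show ?thesis
    proof (cases "s * b d = \<mu>")
      case True
      then have "b \<in> K0" using b by (simp add: K0_def)
      from a0min[OF this] have "0 \<le> height I a" unfolding b(2) by (simp add: height_add height_uminus height_diff)
      moreover have "height I a \<noteq> 0"
      proof
        assume h: "height I a = 0"
        have "a d = 0" using True sd s by auto
        then have "a i = 0" for i
          using height_eq_0[OF I h, of i] ke[of a] a by (cases "i \<in> I"; cases "i = d") (auto simp: exps_def)
        then have "a = 0" by (intro ext) simp
        then show False using a by simp
      qed
      ultimately show ?thesis using True sd by simp
    next
      case False
      then show ?thesis using mu[OF b(1)] sd by simp
    qed
  qed
  have "finite {a\<in>keys f'. 0 < height I a}" by simp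
  from finite_gap[OF this, of "height I"] obtain \<gamma>0 where
    g0: "\<gamma>0 > 0" "\<forall>a\<in>{a\<in>keys f'. 0 < height I a}. \<gamma>0 \<le> height I a" by blast
  obtain H where H: "H \<ge> 0" "\<forall>a\<in>keys f'. - height I a \<le> H" using finite_bd[OF finite_keys, of f' "\<lambda>a. - height I a"] by blast
  obtain C where C: "\<forall>a\<in>keys f'. (real_of_int (a j))\<^sup>2 + (real_of_int (a y))\<^sup>2 \<le> C"
    using finite_bd[OF finite_keys, of f' "\<lambda>a. (real_of_int (a j))\<^sup>2 + (real_of_int (a y))\<^sup>2"] by blast
  \<comment> \<open>\<open>H\<close> bounds how negative the heights are; with slope at least
    \<open>H + 1\<close>, one step in direction \<open>s\<close> outweighs them by 1.\<close>
  have "ugap I j y J (min 1 \<gamma>0) C \<theta>" if th: "real_of_int s * (if d = j then fst \<theta> else snd \<theta>) \<ge> H + 1" for \<theta>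
    unfolding ugap_def
  proof (intro bexI[of _ f'] conjI ballI f'J f'R l1)
    fix a assume a: "a \<in> keys f' - {0}"
    then have ae: "a \<in> exps (insert d I)" using ke by blast
    define t where "t = (if d = j then fst \<theta> else snd \<theta>)"
    have "slope_wt I j y \<theta> a = height I a + t * real_of_int (a d)"
      using d ae jy by (auto simp: slope_wt_def t_def exps_def)
    also have "t * real_of_int (a d) = (real_of_int s * t) * real_of_int (s * a d)"
    proof -
      have "s * s = 1" using s by (cases "s \<ge> 0") auto
      then have "real_of_int s * real_of_int s = 1" by (metis of_int_1 of_int_mult)
      then show ?thesis by (simp add: algebra_simps)
    qed
    finally have w: "slope_wt I j y \<theta> a = height I a + (real_of_int s * t) * real_of_int (s * a d)" .
    show "min 1 \<gamma>0 \<le> slope_wt I j y \<theta> a"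
      using key[OF a]
    proof
      assume "s * a d = 0 \<and> 0 < height I a"
      then show ?thesis using g0 a unfolding w by auto
    next
      assume 1: "1 \<le> s * a d"
      have th': "H + 1 \<le> real_of_int s * t" using th by (simp only: t_def)
      have "1 \<le> real_of_int (s * a d)" using 1 by linarith
      then have "real_of_int s * t \<le> (real_of_int s * t) * real_of_int (s * a d)"
        using mult_left_mono[of 1 "real_of_int (s * a d)" "real_of_int s * t"] th' H(1) by linarith
      moreover have "- height I a \<le> H" using H(2) a by blast
      ultimately have "1 \<le> slope_wt I j y \<theta> a" using th' unfolding w by linarith
      then show ?thesis by simp
    qed
    show "(real_of_int (a j))\<^sup>2 + (real_of_int (a y))\<^sup>2 \<le> C" using C a by blast
  qed
  moreover have "min 1 \<gamma>0 > 0" using g0 by simp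
  ultimately show ?thesis by blast
qed

text \<open>Compactness. Slopes outside a rectangle are covered by \<open>ugap_far\<close> in the
  four coordinate directions; inside, each bad pair has a neighbourhood with half its gap, and
  finitely many of these cover the rectangle.\<close>

lemma ugap_uniform:
  assumes I: "finite I" and J: "left_sub (insert j (insert y I)) J" and jy: "j \<notin> I" "y \<notin> I" "j \<noteq> y"
    and nf: "\<not> free J (insert j I)" "\<not> free J (insert y I)" and bad: "\<And>\<theta>. bad I j y J \<theta>"
  shows "\<exists>\<gamma>>0. \<exists>C. \<forall>\<theta>. ugap I j y J \<gamma> C \<theta>"
proof -
  from ugap_far[OF I J jy _ _ nf(1), of "1"] obtain L1 g1 C1 where
    "g1 > 0 \<and> (\<forall>\<theta>. real_of_int (1) * (if j = j then fst \<theta> else snd \<theta>) \<ge> L1 \<longrightarrow> ugap I j y J g1 C1 \<theta>)"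
    by fastforce
  then have 1: "g1 > 0" "\<And>\<theta>. fst \<theta> \<ge> L1 \<Longrightarrow> ugap I j y J g1 C1 \<theta>" using jy(3) by (simp_all add: split_paired_all)
  from ugap_far[OF I J jy _ _ nf(1), of "-1"] obtain L2 g2 C2 where
    "g2 > 0 \<and> (\<forall>\<theta>. real_of_int (-1) * (if j = j then fst \<theta> else snd \<theta>) \<ge> L2 \<longrightarrow> ugap I j y J g2 C2 \<theta>)"
    by fastforce
  then have 2: "g2 > 0" "\<And>\<theta>. - fst \<theta> \<ge> L2 \<Longrightarrow> ugap I j y J g2 C2 \<theta>" using jy(3) by (simp_all add: split_paired_all)
  from ugap_far[OF I J jy _ _ nf(2), of "1"] obtain L3 g3 C3 where
    "g3 > 0 \<and> (\<forall>\<theta>. real_of_int (1) * (if y = j then fst \<theta> else snd \<theta>) \<ge> L3 \<longrightarrow> ugap I j y J g3 C3 \<theta>)"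
    by fastforce
  then have 3: "g3 > 0" "\<And>\<theta>. snd \<theta> \<ge> L3 \<Longrightarrow> ugap I j y J g3 C3 \<theta>" using jy(3) by (simp_all add: split_paired_all)
  from ugap_far[OF I J jy _ _ nf(2), of "-1"] obtain L4 g4 C4 where
    "g4 > 0 \<and> (\<forall>\<theta>. real_of_int (-1) * (if y = j then fst \<theta> else snd \<theta>) \<ge> L4 \<longrightarrow> ugap I j y J g4 C4 \<theta>)"
    by fastforce
  then have 4: "g4 > 0" "\<And>\<theta>. - snd \<theta> \<ge> L4 \<Longrightarrow> ugap I j y J g4 C4 \<theta>" using jy(3) by (simp_all add: split_paired_all)
  define K where "K = {- L2..L1} \<times> {- L4..L3}"
  have K: "compact K" unfolding K_def by (intro compact_Times compact_Icc)
  have "\<exists>V \<gamma> C. open V \<and> \<theta> \<in> V \<and> \<gamma> > 0 \<and> (\<forall>\<theta>'\<in>V. ugap I j y J \<gamma> C \<theta>')" for \<theta>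
  proof -
    obtain f where f: "f \<in> J" "f \<in> RS (insert j (insert y I))" "lookup f 0 = 1" "\<forall>a\<in>keys f - {0}. 0 < slope_wt I j y \<theta> a"
      using bad[of \<theta>] unfolding bad_def by blast
    obtain \<gamma> where g: "\<gamma> > 0" "\<forall>a\<in>keys f - {0}. \<gamma> \<le> slope_wt I j y \<theta> a" using finite_gap[of "keys f - {0}" "slope_wt I j y \<theta>"] f(4) by auto
    obtain C where C: "\<forall>a\<in>keys f. (real_of_int (a j))\<^sup>2 + (real_of_int (a y))\<^sup>2 \<le> C"
      using finite_bd[OF finite_keys, of f "\<lambda>a. (real_of_int (a j))\<^sup>2 + (real_of_int (a y))\<^sup>2"] by blast
    \<comment> \<open>Only finitely many exponents occur in \<open>f\<close>, so the same
      \<open>f\<close> keeps half of its gap on an open set of slopes.\<close>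
    define V where "V = (\<Inter>a\<in>keys f - {0}. {\<theta>'. \<gamma> / 2 < slope_wt I j y \<theta>' a})"
    have "open V" unfolding V_def slope_wt_def
      by (intro open_INT finite_Diff finite_keys ballI open_Collect_less continuous_intros)
    moreover have "\<theta> \<in> V" using g by (force simp: V_def)
    moreover have "ugap I j y J (\<gamma> / 2) C \<theta>'" if th: "\<theta>' \<in> V" for \<theta>'
      unfolding ugap_def
    proof (intro bexI[of _ f] conjI ballI f)
      fix a assume a: "a \<in> keys f - {0}"
      then show "\<gamma> / 2 \<le> slope_wt I j y \<theta>' a" using th unfolding V_def by (intro less_imp_le) blast
      show "(real_of_int (a j))\<^sup>2 + (real_of_int (a y))\<^sup>2 \<le> C" using C a by blast
    qed
    ultimately show ?thesis using g(1) by (intro exI[of _ V] exI[of _ "\<gamma> / 2"] exI[of _ C]) simp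
  qed
  then have "\<forall>\<theta>. \<exists>V \<gamma> C. open V \<and> \<theta> \<in> V \<and> \<gamma> > 0 \<and> (\<forall>\<theta>'\<in>V. ugap I j y J \<gamma> C \<theta>')" by blast
  from choice[OF this] obtain V where V0: "\<forall>\<theta>. \<exists>\<gamma> C. open (V \<theta>) \<and> \<theta> \<in> V \<theta> \<and> \<gamma> > 0 \<and> (\<forall>\<theta>'\<in>V \<theta>. ugap I j y J \<gamma> C \<theta>')" ..
  from choice[OF this] obtain G where "\<forall>\<theta>. \<exists>C. open (V \<theta>) \<and> \<theta> \<in> V \<theta> \<and> G \<theta> > 0 \<and> (\<forall>\<theta>'\<in>V \<theta>. ugap I j y J (G \<theta>) C \<theta>')" ..
  from choice[OF this] obtain CC where V: "\<forall>\<theta>. open (V \<theta>) \<and> \<theta> \<in> V \<theta> \<and> G \<theta> > 0 \<and> (\<forall>\<theta>'\<in>V \<theta>. ugap I j y J (G \<theta>) (CC \<theta>) \<theta>')" ..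
  have "\<And>\<theta>. \<theta> \<in> K \<Longrightarrow> open (V \<theta>)" "K \<subseteq> (\<Union>\<theta>\<in>K. V \<theta>)" using V by auto
  from compactE_image[OF K this] obtain D where D: "D \<subseteq> K" "finite D" "K \<subseteq> (\<Union>\<theta>\<in>D. V \<theta>)" by metis
  obtain g5 where 5: "g5 > 0" "\<forall>\<theta>\<in>D. g5 \<le> G \<theta>" using finite_gap[OF D(2), of G] V by auto
  obtain C5 where 6: "\<forall>\<theta>\<in>D. CC \<theta> \<le> C5" using finite_bd[OF D(2), of CC] by auto
  define \<gamma> where "\<gamma> = min g1 (min g2 (min g3 (min g4 g5)))"
  define C where "C = max C1 (max C2 (max C3 (max C4 C5)))"
  have "ugap I j y J \<gamma> C \<theta>" for \<theta>
  proof -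
    consider "fst \<theta> \<ge> L1" | "- fst \<theta> \<ge> L2" | "snd \<theta> \<ge> L3" | "- snd \<theta> \<ge> L4" | "\<theta> \<in> K"
      unfolding K_def mem_Times_iff by fastforce
    then show ?thesis
    proof cases
      case 1
      show ?thesis by (rule ugap_mono[OF \<open>\<And>\<theta>. fst \<theta> \<ge> L1 \<Longrightarrow> ugap I j y J g1 C1 \<theta>\<close>[OF 1]]) (auto simp: \<gamma>_def C_def)
    next
      case 2
      show ?thesis by (rule ugap_mono[OF \<open>\<And>\<theta>. - fst \<theta> \<ge> L2 \<Longrightarrow> ugap I j y J g2 C2 \<theta>\<close>[OF 2]]) (auto simp: \<gamma>_def C_def)
    next
      case 3
      show ?thesis by (rule ugap_mono[OF \<open>\<And>\<theta>. snd \<theta> \<ge> L3 \<Longrightarrow> ugap I j y J g3 C3 \<theta>\<close>[OF 3]]) (auto simp: \<gamma>_def C_def)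
    next
      case 4
      show ?thesis by (rule ugap_mono[OF \<open>\<And>\<theta>. - snd \<theta> \<ge> L4 \<Longrightarrow> ugap I j y J g4 C4 \<theta>\<close>[OF 4]]) (auto simp: \<gamma>_def C_def)
    next
      case 5
      then obtain \<theta>' where t: "\<theta>' \<in> D" "\<theta> \<in> V \<theta>'" using D(3) by blast
      have "g5 \<le> G \<theta>'" "CC \<theta>' \<le> C5" using \<open>\<forall>\<theta>\<in>D. g5 \<le> G \<theta>\<close> 6 t(1) by auto
      moreover have "ugap I j y J (G \<theta>') (CC \<theta>') \<theta>" using V t(2) by blast
      ultimately show ?thesis by (elim ugap_mono) (auto simp: \<gamma>_def C_def)
    qed
  qed
  moreover have "\<gamma> > 0" using 1 2 3 4 5 by (simp add: \<gamma>_def)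
  ultimately show ?thesis by blast
qed

text \<open>If all slopes were bad, every monomial could be rewritten into monomials on which the concave
  potential \<open>\<phi>\<close> is larger by a fixed amount, so \<open>mon 0\<close> would have arbitrarily large valuation.\<close>

lemma slope_exists:
  assumes N: "finite N" and I: "I \<subseteq> N" "free J I" and J: "left_sub N J"
    and e: "\<And>I'. I' \<subseteq> N \<Longrightarrow> free J I' \<Longrightarrow> card I' \<le> card I"
    and jy: "j \<in> N" "y \<in> N" "j \<notin> I" "y \<notin> I" "j \<noteq> y"
  shows "\<exists>\<theta>. \<not> bad I j y J \<theta>"
proof (rule ccontr)
  assume "\<not> ?thesis"
  then have bad: "bad I j y J \<theta>" for \<theta> by blast
  let ?A2 = "insert j (insert y I)"
  have fI: "finite I" using N I finite_subset by auto
  have JI: "left_sub I J" by (rule left_sub_mono[OF J I(1)])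
  have A2: "?A2 \<subseteq> N" using I jy by auto
  have JA: "left_sub ?A2 J" by (rule left_sub_mono[OF J A2])
  have nf: "\<not> free J (insert d I)" if "d \<in> N" "d \<notin> I" for d
    using e[of "insert d I"] that I fI by auto
  obtain \<gamma> C where gC: "\<gamma> > 0" "\<And>\<theta>. ugap I j y J \<gamma> C \<theta>"
    using ugap_uniform[OF fI JA jy(3,4,5) nf[OF jy(1,3)] nf[OF jy(2,4)] bad] by blast
  \<comment> \<open>Small enough that the quadratic term of one rewriting step costs at most half of
    the gap.\<close>
  define \<epsilon> where "\<epsilon> = \<gamma> / (2 * (\<bar>C\<bar> + 1))"
  have eps: "\<epsilon> > 0" "\<epsilon> * \<bar>C\<bar> \<le> \<gamma> / 2" using gC(1) by (auto simp: \<epsilon>_def field_simps)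
  define \<phi> where "\<phi> = (\<lambda>a. height I a - \<epsilon> * ((real_of_int (a j))\<^sup>2 + (real_of_int (a y))\<^sup>2))"
  define U where "U = (\<lambda>t. {a \<in> exps ?A2. t \<le> \<phi> a})"
  have step: "spans (U (t + \<gamma> / 2)) (U t) J" for t
    unfolding spans_def
  proof
    fix a assume a: "a \<in> U t"
    \<comment> \<open>The gradient at \<open>a\<close> of the quadratic part of
      \<open>\<phi>\<close>. With these slopes a step \<open>c\<close> changes \<open>\<phi>\<close>
      by \<open>slope_wt I j y \<theta> c\<close> minus the quadratic term of \<open>c\<close>,
      since the mixed terms are absorbed in the weight.\<close>
    define \<theta> where "\<theta> = (- 2 * \<epsilon> * real_of_int (a j), - 2 * \<epsilon> * real_of_int (a y))"
    obtain f0 where f0: "f0 \<in> J" "f0 \<in> RS ?A2" "lookup f0 0 = 1"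
      "\<And>c. c \<in> keys f0 - {0} \<Longrightarrow> \<gamma> \<le> slope_wt I j y \<theta> c \<and> (real_of_int (c j))\<^sup>2 + (real_of_int (c y))\<^sup>2 \<le> C"
      using gC(2)[of \<theta>] unfolding ugap_def by blast
    define f where "f = mon a - mon a \<otimes> f0"
    have aE: "a \<in> exps ?A2" "t \<le> \<phi> a" using a by (auto simp: U_def)
    have "mon a - f \<in> J" unfolding f_def using left_subD(3)[OF JA mon_RS[OF aE(1)] f0(1)] by simp
    moreover have "keys f \<subseteq> U (t + \<gamma> / 2)"
    proof
      fix b assume b: "b \<in> keys f"
      have la: "lookup f a = 0" by (simp add: f_def lookup_minus lookup_mon_tm f0(3)) (simp add: mon_def)
      then have ba: "b \<noteq> a" using b by (auto simp: in_keys_iff)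
      have "lookup (mon a) b = 0" using ba by (simp add: mon_def lookup_single when_def)
      then have "b \<in> keys (mon a \<otimes> f0)" using b by (auto simp: in_keys_iff f_def lookup_minus)
      then obtain c where c: "c \<in> keys f0" "b = a + c" unfolding keys_mon_tm by blast
      have c0: "c \<in> keys f0 - {0}" using c ba by auto
      have cE: "c \<in> exps ?A2" using f0(2) c(1) by (auto simp: RS_def)
      have "\<phi> b = \<phi> a + slope_wt I j y \<theta> c - \<epsilon> * ((real_of_int (c j))\<^sup>2 + (real_of_int (c y))\<^sup>2)"
        unfolding \<phi>_def c(2) slope_wt_def \<theta>_def by (simp add: height_add power2_eq_square algebra_simps)
      moreover have "\<epsilon> * ((real_of_int (c j))\<^sup>2 + (real_of_int (c y))\<^sup>2) \<le> \<epsilon> * \<bar>C\<bar>"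
        using f0(4)[OF c0] eps(1) by (intro mult_left_mono) auto
      moreover have "\<gamma> \<le> slope_wt I j y \<theta> c" using f0(4)[OF c0] by blast
      ultimately have "t + \<gamma> / 2 \<le> \<phi> b" using eps(2) aE(2) by linarith
      moreover have "b \<in> exps ?A2" unfolding c(2) by (rule exps_add[OF aE(1) cE])
      ultimately show "b \<in> U (t + \<gamma> / 2)" by (simp add: U_def)
    qed
    ultimately show "\<exists>f. keys f \<subseteq> U (t + \<gamma> / 2) \<and> mon a - f \<in> J" by blast
  qed
  have iter: "\<exists>f. keys f \<subseteq> U (real n * (\<gamma> / 2)) \<and> mon 0 - f \<in> J" for n
  proof (induction n)
    case 0
    have "0 \<in> U 0" by (simp add: U_def \<phi>_def)
    moreover have "mon 0 - mon 0 \<in> J" by (simp only: diff_self left_subD(1)[OF J])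
    ultimately show ?case by (intro exI[of _ "mon 0"] conjI) (simp_all only: keys_mon of_nat_0 mult_zero_left insert_subset empty_subsetI simp_thms)
  next
    case (Suc n)
    then obtain f where f: "keys f \<subseteq> U (real n * (\<gamma> / 2))" "mon 0 - f \<in> J" by blast
    obtain g where g: "keys g \<subseteq> U (real n * (\<gamma> / 2) + \<gamma> / 2)" "f - g \<in> J" using spansD[OF JA step f(1)] by blast
    have "mon 0 - g \<in> J" using left_subD(2)[OF J f(2) g(2)] by simp
    moreover have "real n * (\<gamma> / 2) + \<gamma> / 2 = real (Suc n) * (\<gamma> / 2)" by (simp add: algebra_simps)
    ultimately show ?case using g(1) by (intro exI[of _ g] conjI) (simp_all only:)
  qed
  obtain \<rho> E where B: "basis N I J \<rho> E" using exists_basis[OF N I J e] by blast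
  obtain K where K: "K \<ge> 0" "\<And>a. a \<in> exps ?A2 \<Longrightarrow> vl I J \<rho> E (mon a) (height I a - K * (\<bar>real_of_int (a j)\<bar> + \<bar>real_of_int (a y)\<bar>))"
    using vl_monomial[OF N I(1) J B jy(1,3,2,4,5)] by blast
  \<comment> \<open>The linear loss \<open>K * \<bar>x\<bar>\<close> exceeds
    \<open>\<epsilon> * x\<^sup>2\<close> by at most \<open>K\<^sup>2 / (4 * \<epsilon>)\<close>;
    this is counted for each of the two coordinates.\<close>
  define M where "M = K\<^sup>2 / (2 * \<epsilon>)"
  have quad: "\<epsilon> * x\<^sup>2 - K * \<bar>x\<bar> \<ge> - (K\<^sup>2 / (4 * \<epsilon>))" for x :: real
  proof -
    have "0 \<le> (2 * \<epsilon> * \<bar>x\<bar> - K)\<^sup>2" by simp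
    also have "\<dots> = 4 * \<epsilon> * (\<epsilon> * x\<^sup>2 - K * \<bar>x\<bar>) + K\<^sup>2" by (simp add: power2_eq_square algebra_simps)
    finally have "- (K\<^sup>2) \<le> 4 * \<epsilon> * (\<epsilon> * x\<^sup>2 - K * \<bar>x\<bar>)" by linarith
    then have "- (K\<^sup>2) / (4 * \<epsilon>) \<le> \<epsilon> * x\<^sup>2 - K * \<bar>x\<bar>" using eps(1) by (simp add: field_simps)
    then show ?thesis by simp
  qed
  \<comment> \<open>Enough rewriting steps to push \<open>\<phi>\<close> beyond \<open>M\<close>;
    then \<open>mon 0\<close> would have positive valuation.\<close>
  have "\<exists>n::nat. M < real n * (\<gamma> / 2)" using gC(1) reals_Archimedean3[of "\<gamma> / 2"] by auto
  then obtain n where n: "M < real n * (\<gamma> / 2)" by blast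
  define t where "t = real n * (\<gamma> / 2) - M"
  obtain f where f: "keys f \<subseteq> U (real n * (\<gamma> / 2))" "mon 0 - f \<in> J" using iter by blast
  have v: "vl I J \<rho> E (mon a) t" if "a \<in> keys f" for a
  proof -
    have a: "a \<in> exps ?A2" "real n * (\<gamma> / 2) \<le> \<phi> a" using f(1) that by (auto simp: U_def)
    have "t \<le> height I a - K * (\<bar>real_of_int (a j)\<bar> + \<bar>real_of_int (a y)\<bar>)"
      using a(2) quad[of "real_of_int (a j)"] quad[of "real_of_int (a y)"]
      by (simp add: \<phi>_def t_def M_def algebra_simps)
    from vl_mono[OF K(2)[OF a(1)] this] show ?thesis .
  qed
  have "vl I J \<rho> E (\<Sum>a\<in>keys f. sc (lookup f a) (mon a)) t" by (intro vl_sum[OF fI JI] vl_sc[OF fI JI] v)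
  then have "vl I J \<rho> E f t" using mon_sum[of f] by simp
  from vl_cong[OF fI JI this f(2)] not_vl_one[OF B] n show False by (simp add: t_def)
qed

end

section \<open>Degeneration to a finite-dimensional module\<close>

definition smul :: "int \<Rightarrow> (nat \<Rightarrow> int) \<Rightarrow> nat \<Rightarrow> int" where
  "smul n c = (\<lambda>t. n * c t)"

lemma smul_simps: "smul 0 c = 0" "smul 1 c = c" "smul (m + n) c = smul m c + smul n c"
  "smul (m - n) c = smul m c - smul n c" "smul (- n) c = - smul n c"
  by (auto simp: smul_def fun_eq_iff algebra_simps)

lemma smul_exps: "c \<in> exps S \<Longrightarrow> smul n c \<in> exps S"
  by (auto simp: smul_def exps_def)

context twisted
begin

text \<open>Bimultiplicativity gives the power \<open>m * n\<close> of \<open>\<kappa> c c\<close>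
  on both sides; negative multiples are reduced to nonnegative ones by taking inverses.\<close>

lemma kappa_smul: "\<kappa> (smul m c) (smul n c) = \<kappa> (smul n c) (smul m c)"
proof -
  have l: "\<kappa> (smul (int m) c) b = \<kappa> c b ^ m" for m b
  proof (induction m)
    case 0
    show ?case by (simp only: of_nat_0 smul_simps \<kappa>_zero power_0)
  next
    case (Suc m)
    have "smul (int (Suc m)) c = c + smul (int m) c" by (simp only: of_nat_Suc smul_simps)
    then show ?case by (simp only: \<kappa>_add_left Suc power_Suc)
  qed
  have l': "\<kappa> (- a) b = inverse (\<kappa> a b)" for a b
    using \<kappa>_add_left[of "- a" a b] by (simp add: field_simps)
  have r': "\<kappa> b (- a) = inverse (\<kappa> b a)" for a b
    using \<kappa>_add_right[of b "- a" a] by (simp add: field_simps)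
  have r: "\<kappa> b (smul (int m) c) = \<kappa> b c ^ m" for m b
  proof (induction m)
    case 0
    show ?case by (simp only: of_nat_0 smul_simps \<kappa>_zero power_0)
  next
    case (Suc m)
    have "smul (int (Suc m)) c = c + smul (int m) c" by (simp only: of_nat_Suc smul_simps)
    then show ?case by (simp only: \<kappa>_add_right Suc power_Suc)
  qed
  have nn: "\<kappa> (smul (int m) c) (smul (int n) c) = \<kappa> (smul (int n) c) (smul (int m) c)" for m n
    by (simp add: l r power_mult[symmetric] mult.commute)
  show ?thesis
  proof (cases m; cases n)
    fix a b assume mn: "m = int a" "n = int b"
    show ?thesis unfolding mn by (rule nn)
  next
    fix a b assume mn: "m = int a" "n = - int (Suc b)"
    show ?thesis unfolding mn smul_simps(5) l' r' by (simp only: nn)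
  next
    fix a b assume mn: "m = - int (Suc a)" "n = int b"
    show ?thesis unfolding mn smul_simps(5) l' r' by (simp only: nn)
  next
    fix a b assume mn: "m = - int (Suc a)" "n = - int (Suc b)"
    show ?thesis unfolding mn smul_simps(5) l' r' by (simp only: nn)
  qed
qed

text \<open>The commutative algebra of Laurent polynomials in the single monomial with exponent
  \<open>c\<close>.\<close>

definition cyc :: "(nat \<Rightarrow> int) \<Rightarrow> 'k ta set" where
  "cyc c = {g. keys g \<subseteq> range (\<lambda>n. smul n c)}"

lemma cyc_commute: assumes f: "f \<in> cyc c" and g: "g \<in> cyc c" shows "f \<otimes> g = g \<otimes> f"
proof -
  have k: "\<kappa> a b = \<kappa> b a" if ab: "a \<in> keys f" "b \<in> keys g" for a b
  proof -
    obtain m n where "a = smul m c" "b = smul n c" using ab f g unfolding cyc_def by blast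
    then show ?thesis by (simp only: kappa_smul)
  qed
  have "f \<otimes> g = (\<Sum>a\<in>keys f. \<Sum>b\<in>keys g. single (b + a) (\<kappa> b a * lookup g b * lookup f a))"
    unfolding tm_def
  proof (intro sum.cong refl)
    fix a b assume "a \<in> keys f" "b \<in> keys g"
    from k[OF this] have e: "\<kappa> a b = \<kappa> b a" .
    show "single (a + b) (\<kappa> a b * lookup f a * lookup g b) = single (b + a) (\<kappa> b a * lookup g b * lookup f a)"
      unfolding e add.commute[of b a] by (simp only: mult.assoc mult.commute[of "lookup f a"])
  qed
  also have "\<dots> = g \<otimes> f" unfolding tm_def by (rule sum.swap)
  finally show ?thesis .
qed

text \<open>\<open>inJ\<close> is the degree \<open>0\<close> part of the ideal of initial forms. The elements of \<open>cyc c1\<close> that annihilate the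
  images of all powers of \<open>c2\<close> are stable under conjugation by \<open>c2\<close>, and one with the fewest terms has to be an
  eigenvector.\<close>

lemma slope_commute:
  assumes N: "finite N" and I: "I \<subseteq> N" and J: "left_sub N J" and jy: "j \<in> N" "y \<in> N" "j \<notin> I" "y \<notin> I" "j \<noteq> y"
    and nfj: "\<not> free J (insert j I)" and nfy: "\<not> free J (insert y I)" and good: "\<not> bad I j y J \<theta>"
  shows "\<exists>a\<in>exps (insert j I). \<exists>c\<in>exps (insert y I). a j \<noteq> 0 \<and> c y \<noteq> 0 \<and> chi c a = 1"
proof -
  define A2 where "A2 = insert j (insert y I)"
  have fI: "finite I" using N I finite_subset by auto
  have A2N: "A2 \<subseteq> N" and fA2: "finite A2" using I jy fI by (auto simp: A2_def)
  have JA: "left_sub A2 J" by (rule left_sub_mono[OF J A2N])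
  define w where "w = slope_wt I j y \<theta>"
  have w: "w (a + b) = w a + w b" "w (a - b) = w a - w b" "w (- a) = - w a" "w 0 = 0" for a b
    unfolding w_def by (rule slope_wt_add slope_wt_diff slope_wt_uminus slope_wt_zero)+
  define Kw where "Kw = {a \<in> exps A2. w a = 0}"
  have Kw: "0 \<in> Kw" "a \<in> Kw \<Longrightarrow> b \<in> Kw \<Longrightarrow> a + b \<in> Kw" "a \<in> Kw \<Longrightarrow> b \<in> Kw \<Longrightarrow> a - b \<in> Kw" "a \<in> Kw \<Longrightarrow> - a \<in> Kw"
    for a b unfolding Kw_def by (auto simp: w exps_add exps_diff exps_uminus)
  have Kwsmul: "smul n c \<in> Kw" if "c \<in> Kw" for n c
  proof -
    have "w (smul n c) = of_int n * w c"
      unfolding w_def slope_wt_def height_def smul_def by (simp add: sum_distrib_left algebra_simps)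
    then show ?thesis using that by (simp add: Kw_def smul_exps)
  qed
  define inJ where "inJ = (\<lambda>g. keys g \<subseteq> Kw \<and> (\<exists>f\<in>J. f \<in> RS A2 \<and> (\<forall>a\<in>keys (f - g). 0 < w a)))"
  have inJ_add: "inJ (g + g')" if gg: "inJ g" "inJ g'" for g g'
  proof -
    obtain f f' where f: "f \<in> J" "f \<in> RS A2" "\<And>a. a \<in> keys (f - g) \<Longrightarrow> 0 < w a" and f': "f' \<in> J" "f' \<in> RS A2" "\<And>a. a \<in> keys (f' - g') \<Longrightarrow> 0 < w a"
      using gg unfolding inJ_def by blast
    have "keys (g + g') \<subseteq> Kw" using keys_add[of g g'] gg unfolding inJ_def by blast
    moreover have e: "(f + f') - (g + g') = (f - g) + (f' - g')" by simp
    have "\<forall>a\<in>keys ((f + f') - (g + g')). 0 < w a" unfolding e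
    proof
      fix a assume "a \<in> keys ((f - g) + (f' - g'))"
      then have "a \<in> keys (f - g) \<union> keys (f' - g')" using keys_add[of "f - g" "f' - g'"] by blast
      then show "0 < w a" using f(3) f'(3) by blast
    qed
    ultimately show ?thesis unfolding inJ_def using left_subD(2)[OF JA f(1) f'(1)] f(2) f'(2) by blast
  qed
  have inJ_sc: "inJ (sc c g)" if g: "inJ g" for c g
  proof -
    obtain f where f: "f \<in> J" "f \<in> RS A2" "\<And>a. a \<in> keys (f - g) \<Longrightarrow> 0 < w a" using g unfolding inJ_def by blast
    have "keys (sc c g) \<subseteq> Kw" using keys_sc[of c g] g unfolding inJ_def by blast
    moreover have "\<forall>a\<in>keys (sc c f - sc c g). 0 < w a" using keys_sc[of c "f - g"] f(3) by (auto simp: sc_simps)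
    ultimately show ?thesis unfolding inJ_def using left_subD(4)[OF JA f(1)] f(2) by blast
  qed
  have inJ_mon: "inJ (mon c \<otimes> g)" if g: "inJ g" and c: "c \<in> Kw" for c g
  proof -
    obtain f where f: "f \<in> J" "f \<in> RS A2" "\<And>a. a \<in> keys (f - g) \<Longrightarrow> 0 < w a" using g unfolding inJ_def by blast
    have cR: "mon c \<in> RS A2" using c by (intro mon_RS) (simp add: Kw_def)
    have "keys (mon c \<otimes> g) \<subseteq> Kw" using g c Kw(2) unfolding inJ_def keys_mon_tm by blast
    moreover have "keys (mon c \<otimes> f - mon c \<otimes> g) = (\<lambda>b. c + b) ` keys (f - g)"
      unfolding tm_diff(2)[symmetric] by (rule keys_mon_tm)
    then have "\<forall>a\<in>keys (mon c \<otimes> f - mon c \<otimes> g). 0 < w a" using f(3) c by (auto simp: w Kw_def)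
    ultimately show ?thesis unfolding inJ_def using left_subD(3)[OF JA cR f(1)] cR f(2) by blast
  qed
  have inJ_0: "inJ 0" unfolding inJ_def using left_subD(1)[OF JA] by auto
  have inJ_sum: "inJ (sum F A)" if "\<And>i. i \<in> A \<Longrightarrow> inJ (F i)" for F and A :: "(nat \<Rightarrow> int) set"
    using that by (induction A rule: infinite_finite_induct) (auto intro: inJ_0 inJ_add)
  have inJ_tm: "inJ (h \<otimes> g)" if g: "inJ g" and h: "keys h \<subseteq> Kw" for h g
  proof -
    have "h \<otimes> g = (\<Sum>a\<in>keys h. sc (lookup h a) (mon a \<otimes> g))"
      by (subst mon_sum[of h]) (simp only: tm_sum tm_sc)
    moreover have "inJ \<dots>" using h by (intro inJ_sum inJ_sc inJ_mon[OF g]) blast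
    ultimately show ?thesis by (simp only:)
  qed
  have not1: "\<not> inJ (mon 0)"
  proof
    assume "inJ (mon 0)"
    then obtain f where f: "f \<in> J" "f \<in> RS A2" "\<And>a. a \<in> keys (f - mon 0) \<Longrightarrow> 0 < w a" unfolding inJ_def by blast
    have "0 \<notin> keys (f - mon 0)" using f(3)[of 0] w(4) by auto
    then have "lookup f 0 = 1" by (simp add: in_keys_iff lookup_minus mon_def)
    moreover have "0 < w a" if a: "a \<in> keys f - {0}" for a
    proof (rule f(3))
      show "a \<in> keys (f - mon 0)" using a by (simp add: in_keys_iff lookup_minus mon_def lookup_one when_def)
    qed
    ultimately have "bad I j y J \<theta>" unfolding bad_def using f(1,2) by (auto simp: A2_def w_def)
    then show False using good by simp
  qed
  have not_mon: "\<not> inJ (sc c (mon 0))" if "c \<noteq> 0" for c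
    using inJ_sc[of "sc c (mon 0)" "inverse c"] not1 sc_inverse[OF that, of "mon 0"] by auto
  \<comment> \<open>As \<open>height\<close> separates exponents, the weight-zero exponents over
    \<open>insert d I\<close> form a lattice of rank at most one. So the initial form of a relation
    is, up to a monomial, a polynomial in one monomial with exponent \<open>c\<close>, with nonzero
    constant term.\<close>
  have one_dir: "\<exists>c P. c \<in> Kw \<and> c \<in> exps (insert d I) \<and> c d > 0 \<and> inJ P \<and> P \<noteq> 0 \<and> 0 \<in> keys P \<and> (\<forall>a\<in>keys P. \<exists>n\<ge>0. a = smul n c)"
    if d: "d = j \<or> d = y" and nf: "\<not> free J (insert d I)" for d
  proof -
    have sub: "exps (insert d I) \<subseteq> exps A2" using d by (intro exps_mono) (auto simp: A2_def)
    have dI: "d \<notin> I" using d jy by auto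
    obtain f where f: "f \<in> RS (insert d I)" "f \<in> J" "f \<noteq> 0" using nf by (auto simp: free_def)
    define s0 where "s0 = Min (w ` keys f)"
    have "keys f \<noteq> {}" using f(3) by simp
    then have "s0 \<in> w ` keys f" unfolding s0_def by (intro Min_in) auto
    define K0 where "K0 = {a \<in> keys f. w a = s0}"
    have K0: "K0 \<noteq> {}" "finite K0" using \<open>s0 \<in> w ` keys f\<close> by (auto simp: K0_def)
    have s0: "s0 \<le> w a" if "a \<in> keys f" for a unfolding s0_def using that by (intro Min_le) auto
    have "Min ((\<lambda>a. a d) ` K0) \<in> (\<lambda>a. a d) ` K0" using K0 by (intro Min_in) auto
    then obtain a0 where a0: "a0 \<in> K0" "a0 d = Min ((\<lambda>a. a d) ` K0)" by auto
    have a0m: "a0 d \<le> a d" if "a \<in> K0" for a unfolding a0(2) using that K0 by (intro Min_le) auto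
    have a0E: "a0 \<in> exps (insert d I)" "a0 \<in> exps A2" using a0 f(1) sub by (auto simp: K0_def RS_def)
    define g where "g = (\<Sum>a\<in>K0. sc (lookup f a) (mon a))"
    have lg: "lookup g a = (if a \<in> K0 then lookup f a else 0)" for a
    proof -
      have "lookup g a = (\<Sum>b\<in>K0. if a = b then lookup f a else 0)"
        unfolding g_def lookup_sum by (intro sum.cong) (auto simp: mon_def lookup_single when_def)
      then show ?thesis using K0(2) by simp
    qed
    define P where "P = mon (- a0) \<otimes> g"
    have kP: "keys P = (\<lambda>b. - a0 + b) ` K0"
    proof -
      have "x \<in> keys g \<longleftrightarrow> x \<in> K0" for x unfolding in_keys_iff lg by (auto simp: K0_def in_keys_iff)
      then have "keys g = K0" by blast
      then show ?thesis unfolding P_def keys_mon_tm by simp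
    qed
    have PE: "a \<in> Kw \<and> a \<in> exps (insert d I) \<and> a d \<ge> 0" if aP: "a \<in> keys P" for a
    proof -
      obtain b where b: "b \<in> K0" "a = - a0 + b" using aP unfolding kP by blast
      have bE: "b \<in> exps (insert d I)" using b f(1) by (auto simp: K0_def RS_def)
      have "a \<in> exps (insert d I)" unfolding b(2) by (intro exps_add exps_uminus a0E bE)
      moreover have "w a = 0" using a0(1) b(1) unfolding b(2) by (simp add: w K0_def)
      moreover have "a d \<ge> 0" using a0m[OF b(1)] unfolding b(2) by simp
      ultimately show ?thesis using sub by (auto simp: Kw_def)
    qed
    have inP: "inJ P"
      unfolding inJ_def
    proof (intro conjI bexI[of _ "mon (- a0) \<otimes> f"] ballI)
      show "keys P \<subseteq> Kw" using PE by blast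
      have m: "mon (- a0) \<in> RS A2" by (intro mon_RS exps_uminus a0E)
      show "mon (- a0) \<otimes> f \<in> RS A2" using f(1) sub by (intro RS_tm m) (auto simp: RS_def)
      show "mon (- a0) \<otimes> f \<in> J" by (rule left_subD(3)[OF JA m f(2)])
      fix a assume "a \<in> keys (mon (- a0) \<otimes> f - P)"
      then have "a \<in> keys (mon (- a0) \<otimes> (f - g))" by (simp add: P_def tm_diff)
      then obtain b where b: "b \<in> keys (f - g)" "a = - a0 + b" unfolding keys_mon_tm by blast
      have "b \<in> keys f" "b \<notin> K0" using b(1) by (auto simp: in_keys_iff lookup_minus lg split: if_splits)
      then have "s0 < w b" using s0[of b] by (force simp: K0_def)
      moreover have "w a0 = s0" using a0 by (simp add: K0_def)
      ultimately show "0 < w a" unfolding b(2) by (simp add: w)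
    qed
    have Kinj: "a = 0" if a: "a \<in> Kw" "a \<in> exps (insert d I)" "a d = 0" for a
    proof -
      have "a \<in> exps I" using a by (auto simp: exps_def)
      then have "a j = 0" "a y = 0" using jy by (auto simp: exps_def)
      then have "height I a = 0" using a(1) by (simp add: Kw_def w_def slope_wt_def)
      then have "a i = 0" for i using height_eq_0[OF fI, of a i] \<open>a \<in> exps I\<close> by (cases "i \<in> I") (auto simp: exps_def)
      then show ?thesis by (intro ext) simp
    qed
    have zP: "0 \<in> keys P" unfolding kP using a0(1) by (intro image_eqI[of _ _ a0]) simp_all
    \<comment> \<open>Otherwise \<open>P\<close> would be a nonzero constant and the initial module
      would vanish.\<close>
    have "\<exists>a\<in>keys P. a d > 0"
    proof (rule ccontr)
      assume no: "\<not> ?thesis"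
      have "a = 0" if a: "a \<in> keys P" for a
      proof (rule Kinj)
        show "a \<in> Kw" "a \<in> exps (insert d I)" using PE[OF a] by auto
        have "\<not> a d > 0" using no a by blast
        then show "a d = 0" using PE[OF a] by linarith
      qed
      then have "keys P \<subseteq> {0}" by blast
      then have "P = sc (lookup P 0) (mon 0)" using mon_sum_super[of "{0}" P] by simp
      moreover have "lookup P 0 \<noteq> 0" using zP by (simp add: in_keys_iff)
      ultimately show False using not_mon inP by metis
    qed
    then obtain a1 where a1: "a1 \<in> Kw" "a1 \<in> exps (insert d I)" "a1 d > 0" using PE by blast
    \<comment> \<open>By division with remainder, a weight-zero exponent with least positive
      \<open>d\<close>-coordinate has all exponents of \<open>P\<close> among its multiples.\<close>
    define Q where "Q = (\<lambda>c. c \<in> Kw \<and> c \<in> exps (insert d I) \<and> c d > 0)"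
    obtain c where c: "Q c" and cmin: "\<And>c'. Q c' \<Longrightarrow> nat (c d) \<le> nat (c' d)"
      using ex_has_least_nat[of Q a1 "\<lambda>c. nat (c d)"] a1 unfolding Q_def by blast
    have c': "c \<in> Kw" "c \<in> exps (insert d I)" "c d > 0" using c by (auto simp: Q_def)
    have "\<exists>n\<ge>0. a = smul n c" if a: "a \<in> keys P" for a
    proof -
      define n where "n = a d div c d"
      define r where "r = a - smul n c"
      have "r d = a d mod c d" by (simp add: r_def smul_def n_def minus_div_mult_eq_mod)
      then have rd: "0 \<le> r d" "r d < c d" using c'(3) by simp_all
      have r: "r \<in> Kw" "r \<in> exps (insert d I)" using PE[OF a] c' by (auto simp: r_def intro!: Kw(3) Kwsmul exps_diff smul_exps)
      have "r d = 0"
      proof (rule ccontr)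
        assume "r d \<noteq> 0"
        then have "Q r" using rd r by (simp add: Q_def)
        from cmin[OF this] rd show False by linarith
      qed
      then have "r = 0" using Kinj r by blast
      then have "a = smul n c" by (simp add: r_def)
      moreover have "n \<ge> 0" using PE[OF a] c'(3) by (simp add: n_def pos_imp_zdiv_nonneg_iff)
      ultimately show ?thesis by blast
    qed
    moreover have "P \<noteq> 0" using zP by auto
    ultimately show ?thesis using c' inP zP by blast
  qed
  obtain c1 P1 where 1: "c1 \<in> Kw" "c1 \<in> exps (insert j I)" "c1 j > 0" "inJ P1" "P1 \<noteq> 0" "\<forall>a\<in>keys P1. \<exists>n\<ge>0. a = smul n c1"
    using one_dir[OF disjI1[OF refl] nfj] by blast
  obtain c2 P2 where 2: "c2 \<in> Kw" "c2 \<in> exps (insert y I)" "c2 y > 0" "inJ P2" "0 \<in> keys P2" "\<forall>a\<in>keys P2. \<exists>n\<ge>0. a = smul n c2"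
    using one_dir[OF disjI2[OF refl] nfy] by blast
  have cycK: "keys g \<subseteq> Kw" if "g \<in> cyc c1" for g using that Kwsmul[OF 1(1)] by (auto simp: cyc_def)
  have cycR: "g \<in> RS A2" if "g \<in> cyc c1" for g using cycK[OF that] by (auto simp: RS_def Kw_def)
  have P1c: "P1 \<in> cyc c1" using 1(6) by (auto simp: cyc_def)
  have cyc_tm: "f \<otimes> g \<in> cyc c1" if fg: "f \<in> cyc c1" "g \<in> cyc c1" for f g
    unfolding cyc_def
  proof (intro CollectI subsetI)
    fix a assume "a \<in> keys (f \<otimes> g)"
    then obtain b b' where b: "b \<in> keys f" "b' \<in> keys g" "a = b + b'" using keys_tm[of f g] by blast
    then obtain m n where "b = smul m c1" "b' = smul n c1" using fg unfolding cyc_def by blast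
    then have "a = smul (m + n) c1" using b(3) by (simp only: smul_simps)
    then show "a \<in> range (\<lambda>n. smul n c1)" by blast
  qed
  have cyc_conj: "tconj a g \<in> cyc c1" if "g \<in> cyc c1" for a g using that by (simp add: cyc_def)
  define \<A> where "\<A> = (\<lambda>k. {g \<in> cyc c1. \<forall>l<k. inJ (g \<otimes> mon (smul (int l) c2))})"
  have ex: "\<exists>g\<in>\<A> k. g \<noteq> 0" for k
  proof (induction k)
    case 0
    have "mon 0 \<in> cyc c1" by (simp add: cyc_def) (metis rangeI smul_simps(1))
    then show ?case by (intro bexI[of _ "mon 0"]) (auto simp: \<A>_def)
  next
    case (Suc k)
    then obtain g where g: "g \<in> cyc c1" "\<And>l. l < k \<Longrightarrow> inJ (g \<otimes> mon (smul (int l) c2))" "g \<noteq> 0" by (auto simp: \<A>_def)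
    \<comment> \<open>Conjugating \<open>P1\<close> past the new power of \<open>c2\<close> makes it
      annihilate the image of that power; commutativity of \<open>cyc c1\<close> allows
      \<open>P'\<close> and \<open>g\<close> to be swapped, so the earlier powers are still
      annihilated.\<close>
    define P' where "P' = tconj (smul (int k) c2) P1"
    have P': "P' \<in> cyc c1" unfolding P'_def by (rule cyc_conj[OF P1c])
    have "P' \<noteq> 0" using 1(5) by (simp add: P'_def)
    then have nz: "P' \<otimes> g \<noteq> 0" using tm_domain[OF fA2 cycR[OF P'] cycR[OF g(1)]] g(3) by blast
    have "inJ ((P' \<otimes> g) \<otimes> mon (smul (int l) c2))" if l: "l < Suc k" for l
    proof (cases "l < k")
      case True
      show ?thesis unfolding tm_assoc by (rule inJ_tm[OF g(2)[OF True] cycK[OF P']])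
    next
      case False
      then have lk: "l = k" using l by simp
      have "(P' \<otimes> g) \<otimes> mon (smul (int l) c2) = g \<otimes> (P' \<otimes> mon (smul (int k) c2))"
        unfolding lk cyc_commute[OF P' g(1)] by (rule tm_assoc)
      also have "P' \<otimes> mon (smul (int k) c2) = mon (smul (int k) c2) \<otimes> P1" unfolding P'_def by (rule mon_tconj[symmetric])
      finally show ?thesis using inJ_tm[OF inJ_mon[OF 1(4) Kwsmul[OF 2(1)]] cycK[OF g(1)]] by (simp only:)
    qed
    then have "P' \<otimes> g \<in> \<A> (Suc k)" using cyc_tm[OF P' g(1)] by (simp add: \<A>_def)
    then show ?case using nz by blast
  qed
  have "\<forall>a\<in>keys P2. \<exists>n. 0 \<le> n \<and> a = smul n c2" using 2(6) by blast
  from bchoice[OF this] obtain \<nu> where nu: "\<forall>a\<in>keys P2. 0 \<le> \<nu> a \<and> a = smul (\<nu> a) c2" ..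
  \<comment> \<open>Larger than every multiple of \<open>c2\<close> in \<open>P2\<close>, so that a
    shift of \<open>P2\<close> by \<open>- c2\<close> involves only \<open>- c2\<close> and powers
    counted by \<open>\<A> k\<close>.\<close>
  define k where "k = Suc (nat (\<Sum>a\<in>keys P2. \<nu> a))"
  have nuk: "\<nu> a < int k" if "a \<in> keys P2" for a
  proof -
    have "\<nu> a \<le> (\<Sum>a\<in>keys P2. \<nu> a)" using nu that by (intro member_le_sum) auto
    then show ?thesis by (simp add: k_def)
  qed
  \<comment> \<open>\<open>P2\<close> has a nonzero constant term, so its shift by
    \<open>- c2\<close> expresses the image of \<open>mon (- c2)\<close> through powers with index
    below \<open>k\<close>. Conjugation by \<open>c2\<close> lowers indices by one, and only index 0
    needs this.\<close>
  have low: "inJ (g \<otimes> mon (- c2))" if g: "g \<in> \<A> k" for g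
  proof -
    have gc: "g \<in> cyc c1" "\<And>l. l < k \<Longrightarrow> inJ (g \<otimes> mon (smul (int l) c2))" using g by (auto simp: \<A>_def)
    define T where "T = (\<lambda>a. sc (lookup P2 a * \<kappa> (- c2) a) (g \<otimes> mon (- c2 + a)))"
    have "g \<otimes> (mon (- c2) \<otimes> P2) = (\<Sum>a\<in>keys P2. T a)"
      by (subst mon_sum[of P2]) (simp add: tm_sum tm_sc mon_mon T_def sc_simps)
    also have "\<dots> = T 0 + (\<Sum>a\<in>keys P2 - {0}. T a)" by (rule sum.remove[OF finite_keys 2(5)])
    finally have e: "T 0 = g \<otimes> (mon (- c2) \<otimes> P2) + sc (- 1) (\<Sum>a\<in>keys P2 - {0}. T a)" by (simp add: sc_simps)
    have tT: "inJ (T a)" if a: "a \<in> keys P2 - {0}" for a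
    proof -
      have n: "0 \<le> \<nu> a" "a = smul (\<nu> a) c2" "\<nu> a < int k" using nu nuk a by auto
      have "\<nu> a \<noteq> 0"
      proof
        assume "\<nu> a = 0"
        then have "a = 0" using n(2) by (simp only: smul_simps)
        then show False using a by simp
      qed
      then have "- c2 + a = smul (int (nat (\<nu> a - 1))) c2"
        using n(1) by (subst n(2)) (simp add: smul_simps)
      moreover have "nat (\<nu> a - 1) < k" using n by linarith
      ultimately show ?thesis unfolding T_def using gc(2)[of "nat (\<nu> a - 1)"] by (simp only: inJ_sc)
    qed
    have "inJ (T 0)" unfolding e
      by (intro inJ_add inJ_tm[OF inJ_mon[OF 2(4) Kw(4)[OF 2(1)]] cycK[OF gc(1)]] inJ_sc inJ_sum tT)
    then have "inJ (sc (lookup P2 0) (g \<otimes> mon (- c2)))" by (simp add: T_def)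
    then have "inJ (sc (inverse (lookup P2 0)) (sc (lookup P2 0) (g \<otimes> mon (- c2))))" by (rule inJ_sc)
    moreover have nz: "lookup P2 0 \<noteq> 0" using 2(5) by (simp add: in_keys_iff)
    ultimately show ?thesis by (simp only: sc_inverse[OF nz])
  qed
  have conjA: "tconj c2 g \<in> \<A> k" if g: "g \<in> \<A> k" for g
  proof -
    have gc: "g \<in> cyc c1" "\<And>l. l < k \<Longrightarrow> inJ (g \<otimes> mon (smul (int l) c2))" using g by (auto simp: \<A>_def)
    have "inJ (tconj c2 g \<otimes> mon (smul (int l) c2))" if l: "l < k" for l
    proof -
      define b where "b = smul (int l - 1) c2"
      have gb: "inJ (g \<otimes> mon b)"
      proof (cases l)
        case 0
        then have "b = - c2" by (simp add: b_def smul_simps)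
        then show ?thesis using low[OF g] by simp
      next
        case (Suc l')
        then have "b = smul (int l') c2" by (simp add: b_def)
        then show ?thesis using gc(2)[of l'] Suc l by simp
      qed
      have cb: "c2 + b = smul (int l) c2" by (simp add: b_def smul_simps)
      have "mon c2 \<otimes> (g \<otimes> mon b) = sc (\<kappa> c2 b) (tconj c2 g \<otimes> mon (smul (int l) c2))"
        unfolding mon_shift mon_mon tm_sc cb ..
      then have "inJ (sc (\<kappa> c2 b) (tconj c2 g \<otimes> mon (smul (int l) c2)))" using inJ_mon[OF gb 2(1)] by (simp only:)
      then have "inJ (sc (inverse (\<kappa> c2 b)) (sc (\<kappa> c2 b) (tconj c2 g \<otimes> mon (smul (int l) c2))))" by (rule inJ_sc)
      then show ?thesis by (simp only: sc_inverse[OF \<kappa>_nz])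
    qed
    then show ?thesis using cyc_conj[OF gc(1)] by (simp add: \<A>_def)
  qed
  obtain g0 where "g0 \<in> \<A> k" "g0 \<noteq> 0" using ex by blast
  then obtain g where g: "g \<in> \<A> k" "g \<noteq> 0" and gmin: "\<And>h. h \<in> \<A> k \<Longrightarrow> h \<noteq> 0 \<Longrightarrow> card (keys g) \<le> card (keys h)"
    using ex_has_least_nat[of "\<lambda>g. g \<in> \<A> k \<and> g \<noteq> 0" g0 "\<lambda>g. card (keys g)"] by blast
  have gc: "g \<in> cyc c1" "\<And>l. l < k \<Longrightarrow> inJ (g \<otimes> mon (smul (int l) c2))" using g by (auto simp: \<A>_def)
  obtain a0 where a0: "a0 \<in> keys g" using g(2) keys_eq_empty by blast
  obtain n0 where n0: "a0 = smul n0 c1" using a0 gc(1) by (auto simp: cyc_def)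
  \<comment> \<open>Division by a monomial puts exponent 0 into the support, where conjugation by
    \<open>c2\<close> has eigenvalue 1.\<close>
  define g' where "g' = mon (- a0) \<otimes> g"
  have m0: "mon (- a0) \<in> cyc c1" unfolding n0 smul_simps(5)[symmetric] by (simp add: cyc_def)
  have g'c: "g' \<in> cyc c1" unfolding g'_def by (rule cyc_tm[OF m0 gc(1)])
  have "inJ (g' \<otimes> mon (smul (int l) c2))" if "l < k" for l
    unfolding g'_def tm_assoc by (rule inJ_tm[OF gc(2)[OF that] cycK[OF m0]])
  then have g'A: "g' \<in> \<A> k" using g'c by (simp add: \<A>_def)
  have kg': "keys g' = (\<lambda>b. - a0 + b) ` keys g" unfolding g'_def by (rule keys_mon_tm)
  have cardg': "card (keys g') \<le> card (keys g)" unfolding kg' by (rule card_image_le) simp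
  have z: "0 \<in> keys g'" unfolding kg' using a0 by (intro image_eqI[of _ _ a0]) simp_all
  have k0: "0 < k" by (simp add: k_def)
  have "\<exists>a\<in>keys g'. a \<noteq> 0"
  proof (rule ccontr)
    assume "\<not> ?thesis"
    then have "keys g' \<subseteq> {0}" by blast
    then have "g' = sc (lookup g' 0) (mon 0)" using mon_sum_super[of "{0}" g'] by simp
    moreover have "lookup g' 0 \<noteq> 0" using z by (simp add: in_keys_iff)
    moreover have "inJ (g' \<otimes> mon (smul (int 0) c2))" using g'A k0 unfolding \<A>_def by blast
    then have "inJ g'" by (simp add: smul_simps)
    ultimately show False using not_mon by metis
  qed
  then obtain a where a: "a \<in> keys g'" "a \<noteq> 0" by blast
  \<comment> \<open>The term at 0 cancels, so \<open>h\<close> has fewer terms than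
    \<open>g'\<close> and must vanish; every other term of \<open>g'\<close> then has eigenvalue 1
    as well.\<close>
  define h where "h = tconj c2 g' - g'"
  have "h \<in> \<A> k"
  proof -
    have "inJ (h \<otimes> mon (smul (int l) c2))" if l: "l < k" for l
    proof -
      have "h \<otimes> mon (smul (int l) c2) = tconj c2 g' \<otimes> mon (smul (int l) c2) + sc (- 1) (g' \<otimes> mon (smul (int l) c2))"
        by (simp add: h_def tm_diff sc_simps)
      moreover have "inJ (tconj c2 g' \<otimes> mon (smul (int l) c2))" "inJ (g' \<otimes> mon (smul (int l) c2))"
        using conjA[OF g'A] g'A l by (auto simp: \<A>_def)
      ultimately show ?thesis using inJ_add inJ_sc by simp
    qed
    moreover have "keys h \<subseteq> keys g'" by (auto simp: h_def in_keys_iff lookup_minus)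
    then have "h \<in> cyc c1" using g'c by (auto simp: cyc_def)
    ultimately show ?thesis by (simp add: \<A>_def)
  qed
  moreover have "keys h \<subset> keys g'"
  proof
    show "keys h \<subseteq> keys g'" by (auto simp: h_def in_keys_iff lookup_minus)
    have "0 \<notin> keys h" by (simp add: h_def in_keys_iff lookup_minus chi_def)
    then show "keys h \<noteq> keys g'" using z by blast
  qed
  then have "card (keys h) < card (keys g')" by (intro psubset_card_mono) auto
  ultimately have "h = 0" using gmin[of h] cardg' by linarith
  then have "lookup h a = 0" by simp
  then have "chi c2 a = 1" using a(1) by (simp add: h_def lookup_minus in_keys_iff)
  moreover obtain n where n: "a = smul n c1" using a(1) g'c by (auto simp: cyc_def)
  have "n \<noteq> 0"
  proof
    assume "n = 0"
    then have "a = 0" using n by (simp only: smul_simps)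
    then show False using a(2) by simp
  qed
  then have "a j \<noteq> 0" using 1(3) by (simp add: n smul_def)
  moreover have "a \<in> exps (insert j I)" unfolding n by (rule smul_exps[OF 1(2)])
  ultimately show ?thesis using 2(2,3) by (intro bexI[of _ a] bexI[of _ c2] conjI) auto
qed

end

section \<open>Gelfand--Kirillov dimension of cyclic modules\<close>

text \<open>Instantiated twice, by \<open>emb\<close> into the algebra and by the action on a
  generator into the module, so that ranks on both sides are controlled by sets of
  exponents.\<close>

locale evl =
  fixes S :: "nat set" and add :: "'v \<Rightarrow> 'v \<Rightarrow> 'v" and zero :: 'v and smul :: "'k::field \<Rightarrow> 'v \<Rightarrow> 'v"
    and ev :: "'k ta \<Rightarrow> 'v"
  assumes ev_zero: "ev 0 = zero"
    and ev_add: "f \<in> RS S \<Longrightarrow> g \<in> RS S \<Longrightarrow> ev (f + g) = add (ev f) (ev g)"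
    and ev_sc: "f \<in> RS S \<Longrightarrow> ev (sc c f) = smul c (ev f)"
begin

lemma ev_eq:
  assumes "f \<in> RS S" "g \<in> RS S" "ev (f - g) = zero" shows "ev f = ev g"
proof -
  have "ev f = ev ((f - g) + g)" by simp
  also have "\<dots> = add zero (ev g)" using assms by (simp only: ev_add RS_closed)
  also have "\<dots> = ev (0 + g)" using assms(2) by (simp only: ev_add RS_closed ev_zero)
  finally show ?thesis by simp
qed

lemma lin_comb_ev:
  "length cs = length fs \<Longrightarrow> set fs \<subseteq> RS S \<Longrightarrow>
    lin_comb add zero smul cs (map ev fs) = ev (\<Sum>i<length fs. sc (cs ! i) (fs ! i))"
proof (induction cs fs rule: list_induct2)
  case Nil
  then show ?case by (simp add: lin_comb_def ev_zero)
next
  case (Cons c cs f fs)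
  have fR: "f \<in> RS S" "set fs \<subseteq> RS S" using Cons.prems by auto
  have sR: "(\<Sum>i<length fs. sc (cs ! i) (fs ! i)) \<in> RS S"
    using fR(2) by (intro RS_sum RS_closed) (auto simp: subset_iff)
  have "lin_comb add zero smul (c # cs) (map ev (f # fs)) = add (smul c (ev f)) (lin_comb add zero smul cs (map ev fs))"
    by (simp add: lin_comb_def)
  also have "\<dots> = add (ev (sc c f)) (ev (\<Sum>i<length fs. sc (cs ! i) (fs ! i)))"
    using Cons.IH[OF fR(2)] fR(1) by (simp only: ev_sc)
  also have "\<dots> = ev (sc c f + (\<Sum>i<length fs. sc (cs ! i) (fs ! i)))"
    using fR sR by (simp only: ev_add RS_closed)
  also have "sc c f + (\<Sum>i<length fs. sc (cs ! i) (fs ! i)) = (\<Sum>i<length (f # fs). sc ((c # cs) ! i) ((f # fs) ! i))"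
    by (simp add: sum.lessThan_Suc_shift del: sum.lessThan_Suc)
  finally show ?case .
qed

lemma rank_le:
  assumes T: "finite T" "T \<subseteq> exps S"
    and X: "\<And>x. x \<in> X \<Longrightarrow> \<exists>f. keys f \<subseteq> T \<and> x = ev f"
  shows "Defs.rank add zero smul X \<le> enat (card T)"
  unfolding Defs.rank_def
proof (rule Sup_least)
  fix k assume "k \<in> {enat (length xs) |xs. distinct xs \<and> set xs \<subseteq> X \<and> lin_indep add zero smul xs}"
  then obtain xs where xs: "k = enat (length xs)" "set xs \<subseteq> X" "lin_indep add zero smul xs" by blast
  have "\<forall>x\<in>X. \<exists>f. keys f \<subseteq> T \<and> x = ev f" using X by blast
  from bchoice[OF this] obtain F where F: "\<forall>x\<in>X. keys (F x) \<subseteq> T \<and> x = ev (F x)" ..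
  define fs where "fs = map F xs"
  have len: "length fs = length xs" by (simp add: fs_def)
  have fsT: "keys f \<subseteq> T" if "f \<in> set fs" for f using that F xs(2) by (auto simp: fs_def)
  have fsR: "set fs \<subseteq> RS S" using fsT T(2) by (auto simp: RS_def)
  have evfs: "map ev fs = xs" unfolding fs_def map_map by (rule map_idI) (use F xs(2) in auto)
  have "length xs \<le> card T"
  proof (rule ccontr)
    assume "\<not> ?thesis"
    then have c: "card T < card {..<length xs}" by simp
    obtain g where g: "\<exists>i\<in>{..<length xs}. g i \<noteq> 0" "\<forall>t\<in>T. (\<Sum>i<length xs. g i * lookup (fs ! i) t) = 0"
      using kernel_nontrivial[OF finite_lessThan T(1) c, of "\<lambda>i t. lookup (fs ! i) t"] by blast
    define cs where "cs = map g [0..<length xs]"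
    have csl: "length cs = length fs" by (simp add: cs_def len)
    have "(\<Sum>i<length fs. sc (cs ! i) (fs ! i)) = 0"
    proof (rule poly_mapping_eqI)
      fix t
      have e: "lookup (\<Sum>i<length fs. sc (cs ! i) (fs ! i)) t = (\<Sum>i<length xs. g i * lookup (fs ! i) t)"
        unfolding lookup_sum len by (intro sum.cong refl) (simp add: cs_def)
      show "lookup (\<Sum>i<length fs. sc (cs ! i) (fs ! i)) t = lookup 0 t"
      proof (cases "t \<in> T")
        case True
        then show ?thesis unfolding e using g(2) by simp
      next
        case False
        have "lookup (fs ! i) t = 0" if "i < length xs" for i
          using fsT[of "fs ! i"] that len False by (auto simp: in_keys_iff)
        then show ?thesis unfolding e by simp
      qed
    qed
    then have "lin_comb add zero smul cs xs = zero"
      using lin_comb_ev[OF csl fsR] ev_zero by (simp only: evfs)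
    then have "\<forall>c\<in>set cs. c = 0" using xs(3) csl len unfolding lin_indep_def by metis
    then show False using g(1) by (auto simp: cs_def)
  qed
  then show "k \<le> enat (card T)" by (simp add: xs(1))
qed

text \<open>The scalar \<open>c\<close> is allowed because a product of monomials is a monomial only
  up to values of \<open>\<kappa>\<close>.\<close>

lemma rank_ge:
  assumes T: "finite T" "T \<subseteq> exps S"
    and ind: "\<And>g. keys g \<subseteq> T \<Longrightarrow> ev g = zero \<Longrightarrow> g = 0"
    and X: "\<And>a. a \<in> T \<Longrightarrow> \<exists>c. c \<noteq> 0 \<and> ev (single a c) \<in> X"
  shows "enat (card T) \<le> Defs.rank add zero smul X"
proof -
  obtain as where as: "set as = T" "distinct as" using finite_distinct_list[OF T(1)] by blast
  have "\<forall>a\<in>T. \<exists>c. c \<noteq> 0 \<and> ev (single a c) \<in> X" using X by blast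
  from bchoice[OF this] obtain C where C: "\<forall>a\<in>T. C a \<noteq> 0 \<and> ev (single a (C a)) \<in> X" ..
  define fs where "fs = map (\<lambda>a. single a (C a)) as"
  have fsR: "set fs \<subseteq> RS S" using T(2) as(1) by (auto simp: fs_def intro!: RS_single)
  have li: "lin_indep add zero smul (map ev fs)"
    unfolding lin_indep_def
  proof (intro allI impI ballI)
    fix cs c assume a: "length cs = length (map ev fs) \<and> lin_comb add zero smul cs (map ev fs) = zero" and c: "c \<in> set cs"
    then have csl: "length cs = length fs" by simp
    let ?g = "\<Sum>i<length fs. sc (cs ! i) (fs ! i)"
    have g1: "?g = (\<Sum>i<length as. single (as ! i) (cs ! i * C (as ! i)))"
      by (intro sum.cong) (auto simp: fs_def sc_simps)
    have lk: "lookup ?g (as ! i) = cs ! i * C (as ! i)" if i: "i < length as" for i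
    proof -
      have "lookup ?g (as ! i) = (\<Sum>i'<length as. if i' = i then cs ! i * C (as ! i) else 0)"
        unfolding g1 lookup_sum
        by (intro sum.cong refl) (use i as(2) in \<open>auto simp: lookup_single when_def nth_eq_iff_index_eq\<close>)
      then show ?thesis using i by simp
    qed
    have "keys ?g \<subseteq> (\<Union>i<length as. keys (single (as ! i) (cs ! i * C (as ! i))))" unfolding g1 by (rule keys_sum)
    also have "\<dots> \<subseteq> T" using as(1) by (auto split: if_splits)
    finally have "keys ?g \<subseteq> T" .
    moreover have "ev ?g = zero" using lin_comb_ev[OF csl fsR] a by simp
    ultimately have g0: "?g = 0" by (rule ind)
    obtain i where i: "i < length cs" "c = cs ! i" using c by (metis in_set_conv_nth)
    have il: "i < length as" using i csl by (simp add: fs_def)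
    have "cs ! i * C (as ! i) = 0" using lk[OF il] unfolding g0 by simp
    moreover have "C (as ! i) \<noteq> 0" using C as(1) il by auto
    ultimately show "c = 0" using i by simp
  qed
  have dist: "distinct (map ev fs)"
  proof -
    have "inj_on (\<lambda>a. ev (single a (C a))) T"
    proof (rule inj_onI, rule ccontr)
      fix a b assume ab: "a \<in> T" "b \<in> T" "ev (single a (C a)) = ev (single b (C b))" "a \<noteq> b"
      have R: "single a (C a) \<in> RS S" "single b (C b) \<in> RS S" using ab T(2) by (auto intro!: RS_single)
      let ?d = "single a (C a) + sc (- 1) (single b (C b))"
      have "ev ?d = add (ev (single b (C b))) (ev (sc (- 1) (single b (C b))))"
        using R by (simp only: ev_add RS_closed ab(3))
      also have "\<dots> = ev (single b (C b) + sc (- 1) (single b (C b)))" using R by (simp only: ev_add RS_closed)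
      also have "single b (C b) + sc (- 1) (single b (C b)) = 0" by (simp add: sc_simps(4,10))
      finally have "ev ?d = zero" by (simp only: ev_zero)
      moreover have "keys ?d \<subseteq> T"
        using keys_add[of "single a (C a)" "sc (- 1) (single b (C b))"] keys_sc[of "- 1" "single b (C b)"] ab by (auto split: if_splits)
      ultimately have "?d = 0" by (intro ind)
      then have "lookup ?d a = 0" by simp
      then show False using C ab by (simp add: lookup_add lookup_single when_def)
    qed
    then show ?thesis using as by (simp add: fs_def distinct_map comp_def)
  qed
  have "set (map ev fs) \<subseteq> X" using C as(1) by (auto simp: fs_def)
  then have "enat (length (map ev fs)) \<le> Defs.rank add zero smul X"
    unfolding Defs.rank_def using li dist by (intro Sup_upper) blast
  moreover have "length (map ev fs) = card T" using as by (simp add: fs_def distinct_card[symmetric])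
  ultimately show ?thesis by simp
qed

text \<open>Turns a finite rank into a finite set of exponents common to all of \<open>W\<close>:
  the exponents of preimages of a maximal independent list.\<close>

lemma finite_support:
  assumes W: "W \<subseteq> ev ` RS S" and fin: "Defs.rank add zero smul W < \<infinity>"
  shows "\<exists>T. finite T \<and> T \<subseteq> exps S \<and> (\<forall>v\<in>W. \<exists>f. keys f \<subseteq> T \<and> v = ev f)"
proof -
  define P where "P = (\<lambda>r. \<exists>xs. length xs = r \<and> distinct xs \<and> set xs \<subseteq> W \<and> lin_indep add zero smul xs)"
  obtain B where B: "Defs.rank add zero smul W = enat B" using fin by (cases "Defs.rank add zero smul W") auto
  have PB: "r \<le> B" if "P r" for r
  proof -
    obtain xs where xs: "length xs = r" "distinct xs" "set xs \<subseteq> W" "lin_indep add zero smul xs"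
      using \<open>P r\<close> by (auto simp: P_def)
    have "enat (length xs) \<le> Defs.rank add zero smul W" unfolding Defs.rank_def using xs(2-4) by (intro Sup_upper) blast
    then show ?thesis using B xs(1) by simp
  qed
  have P0: "P 0" unfolding P_def by (intro exI[of _ "[]"]) (simp add: lin_indep_def)
  define r where "r = (GREATEST r. P r)"
  have "P r" unfolding r_def by (rule GreatestI_nat[where P = P and b = B, OF P0 PB])
  have ge: "r' \<le> r" if "P r'" for r' unfolding r_def by (rule Greatest_le_nat[where P = P and b = B, OF that PB])
  obtain xs where xs: "length xs = r" "distinct xs" "set xs \<subseteq> W" "lin_indep add zero smul xs"
    using \<open>P r\<close> by (auto simp: P_def)
  have "\<forall>x\<in>W. \<exists>f. f \<in> RS S \<and> x = ev f" using W by blast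
  from bchoice[OF this] obtain F where F: "\<forall>x\<in>W. F x \<in> RS S \<and> x = ev (F x)" ..
  define fs where "fs = map F xs"
  have fsR: "set fs \<subseteq> RS S" using F xs(3) by (auto simp: fs_def)
  have evfs: "map ev fs = xs" unfolding fs_def map_map by (rule map_idI) (use F xs(3) in auto)
  have lfs: "length fs = r" using xs(1) by (simp add: fs_def)
  define T where "T = (\<Union>f\<in>set fs. keys f)"
  have "\<exists>f. keys f \<subseteq> T \<and> v = ev f" if v: "v \<in> W" for v
  proof (cases "v \<in> set xs")
    case True
    then have "F v \<in> set fs" by (simp add: fs_def)
    moreover have "v = ev (F v)" using F v by blast
    ultimately show ?thesis unfolding T_def by blast
  next
    case False
    have "\<not> lin_indep add zero smul (v # xs)"
    proof
      assume "lin_indep add zero smul (v # xs)"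
      then have "P (Suc r)" unfolding P_def using xs v False by (intro exI[of _ "v # xs"]) simp
      then show False using ge by fastforce
    qed
    then obtain cs where cs: "length cs = Suc r" "lin_comb add zero smul cs (v # xs) = zero" "\<exists>c\<in>set cs. c \<noteq> 0"
      unfolding lin_indep_def using xs(1) by auto
    obtain c0 cs' where cc: "cs = c0 # cs'" using cs(1) by (cases cs) auto
    have lcs': "length cs' = length fs" using cs(1) cc lfs by simp
    have vF: "F v \<in> RS S" "v = ev (F v)" using F v by auto
    let ?s = "\<Sum>i<length fs. sc (cs' ! i) (fs ! i)"
    have sR: "?s \<in> RS S" using fsR by (intro RS_sum RS_closed) (auto simp: subset_iff)
    have ks: "keys ?s \<subseteq> T"
    proof -
      have "keys ?s \<subseteq> (\<Union>i<length fs. keys (sc (cs' ! i) (fs ! i)))" by (rule keys_sum)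
      also have "\<dots> \<subseteq> T"
      proof (rule UN_least)
        fix i assume "i \<in> {..<length fs}"
        then have "keys (fs ! i) \<subseteq> T" unfolding T_def by (intro UN_upper) simp
        then show "keys (sc (cs' ! i) (fs ! i)) \<subseteq> T" using keys_sc by blast
      qed
      finally show ?thesis .
    qed
    have "lin_comb add zero smul cs (v # xs) = add (smul c0 v) (lin_comb add zero smul cs' xs)"
      by (simp add: lin_comb_def cc)
    also have "\<dots> = add (ev (sc c0 (F v))) (ev ?s)"
      using lin_comb_ev[OF lcs' fsR] vF by (simp only: evfs ev_sc)
    also have "\<dots> = ev (sc c0 (F v) + ?s)" using vF sR by (simp only: ev_add RS_closed)
    finally have z: "ev (sc c0 (F v) + ?s) = zero" using cs(2) by simp
    have c0: "c0 \<noteq> 0"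
    proof
      assume "c0 = 0"
      then have "ev ?s = zero" using z by (simp add: sc_simps)
      then have "lin_comb add zero smul cs' xs = zero" using lin_comb_ev[OF lcs' fsR] by (simp only: evfs)
      then have "\<forall>c\<in>set cs'. c = 0" using xs(1,4) lcs' lfs unfolding lin_indep_def by metis
      then show False using cs(3) cc \<open>c0 = 0\<close> by auto
    qed
    define h where "h = sc (- inverse c0) ?s"
    have hR: "h \<in> RS S" unfolding h_def by (rule RS_closed(5)[OF sR])
    have "smul (inverse c0) zero = zero" using ev_sc[OF RS_closed(1), of "inverse c0"] by (simp add: sc_simps ev_zero)
    moreover have "F v - h = sc (inverse c0) (sc c0 (F v) + ?s)" using c0 by (simp add: h_def sc_simps)
    ultimately have "ev (F v - h) = zero"
      using z ev_sc[of "sc c0 (F v) + ?s" "inverse c0"] vF(1) sR by (simp only: RS_closed)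
    then have "v = ev h" using ev_eq[OF vF(1) hR] vF(2) by simp
    moreover have "keys h \<subseteq> T" using keys_sc[of "- inverse c0" ?s] ks unfolding h_def by blast
    ultimately show ?thesis by blast
  qed
  moreover have "finite T" unfolding T_def by simp
  moreover have "T \<subseteq> exps S" unfolding T_def using fsR by (auto simp: RS_def)
  ultimately show ?thesis by blast
qed

end

section \<open>From polynomial bounds to exponents of growth\<close>

lemma limsup_growth_le:
  assumes "\<And>N. r N \<le> C * (N + 1) ^ e"
  shows "limsup (\<lambda>N. ereal (ln (real (r N)) / ln (real N))) \<le> ereal (real e)"
proof -
  \<comment> \<open>\<open>C + 1\<close> keeps the logarithm nonnegative if \<open>C = 0\<close>,
    and the case of vanishing \<open>r N\<close> is covered too.\<close>
  define b where "b = (\<lambda>N. (ln (real C + 1) + real e * ln (real N + 1)) / ln (real N))"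
  have lim: "b \<longlonglongrightarrow> real e" unfolding b_def by real_asymp
  have "\<forall>\<^sub>F N in sequentially. ereal (ln (real (r N)) / ln (real N)) \<le> ereal (b N)"
    using eventually_ge_at_top[of "2::nat"]
  proof eventually_elim
    case (elim N)
    have "ln (real (r N)) \<le> ln (real C + 1) + real e * ln (real N + 1)"
    proof (cases "r N = 0")
      case True
      then show ?thesis using elim by simp
    next
      case False
      have "real (r N) \<le> real (C * (N + 1) ^ e)" using assms[of N] by (simp only: of_nat_le_iff)
      also have "real (C * (N + 1) ^ e) = real C * (real N + 1) ^ e" by (simp add: add.commute)
      also have "\<dots> \<le> (real C + 1) * (real N + 1) ^ e" by (intro mult_right_mono) auto
      finally have "ln (real (r N)) \<le> ln ((real C + 1) * (real N + 1) ^ e)" using False by (subst ln_le_cancel_iff) auto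
      also have "\<dots> = ln (real C + 1) + real e * ln (real N + 1)" by (simp add: ln_mult ln_realpow)
      finally show ?thesis .
    qed
    then show ?case using elim unfolding b_def by (simp add: divide_right_mono)
  qed
  then have "limsup (\<lambda>N. ereal (ln (real (r N)) / ln (real N))) \<le> limsup (\<lambda>N. ereal (b N))" by (rule Limsup_mono)
  also have "\<dots> = ereal (real e)" by (rule lim_imp_Limsup) (use lim in auto)
  finally show ?thesis .
qed

lemma limsup_growth_ge:
  assumes "\<And>N. (N + 1) ^ e \<le> r N"
  shows "ereal (real e) \<le> limsup (\<lambda>N. ereal (ln (real (r N)) / ln (real N)))"
proof (rule le_Limsup)
  show "\<forall>\<^sub>F N in sequentially. ereal (real e) \<le> ereal (ln (real (r N)) / ln (real N))"
    using eventually_ge_at_top[of "2::nat"]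
  proof eventually_elim
    case (elim N)
    have "real N ^ e \<le> real ((N + 1) ^ e)" by (simp add: power_mono)
    also have "\<dots> \<le> real (r N)" using assms[of N] by (simp only: of_nat_le_iff)
    finally have "real N ^ e \<le> real (r N)" .
    moreover have p: "0 < real N ^ e" using elim by simp
    ultimately have r: "0 < real (r N)" "real N ^ e \<le> real (r N)" by linarith+
    have "ln (real N ^ e) \<le> ln (real (r N))" using ln_le_cancel_iff[OF p r(1)] r(2) by blast
    then show ?case using elim by (simp add: ln_realpow field_simps)
  qed
qed simp

text \<open>Serves both the torus and its extension: \<open>emb\<close> presents \<open>A\<close> as
  a twisted group algebra. Injectivity of \<open>emb\<close> is assumed separately, where quotients
  are built.\<close>

locale gk = twisted \<kappa> for \<kappa> :: "(nat \<Rightarrow> int) \<Rightarrow> (nat \<Rightarrow> int) \<Rightarrow> 'k::field" +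
  fixes A :: "('a, 'k) kalg" and S :: "nat set" and emb :: "'k ta \<Rightarrow> 'a"
  assumes S: "finite S"
    and emb_car: "emb ` RS S = acar A"
    and emb_add: "f \<in> RS S \<Longrightarrow> g \<in> RS S \<Longrightarrow> aadd A (emb f) (emb g) = emb (f + g)"
    and emb_zero: "azero A = emb 0"
    and emb_mul: "f \<in> RS S \<Longrightarrow> g \<in> RS S \<Longrightarrow> amul A (emb f) (emb g) = emb (f \<otimes> g)"
    and emb_one: "aone A = emb (mon 0)"
    and emb_sc: "f \<in> RS S \<Longrightarrow> asmul A c (emb f) = emb (sc c f)"
begin

lemma evl_emb: "evl S (aadd A) (azero A) (asmul A) emb"
  by unfold_locales (simp_all add: emb_add emb_zero emb_sc)

lemma emb_in: "f \<in> RS S \<Longrightarrow> emb f \<in> acar A"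
  using emb_car by blast

context
  fixes M :: "('a, 'm) kmod"
  assumes M: "is_kmodule A M"
begin

lemma kmod:
  shows "mzero M \<in> mcar M"
    and "x \<in> mcar M \<Longrightarrow> y \<in> mcar M \<Longrightarrow> madd M x y \<in> mcar M"
    and "a \<in> acar A \<Longrightarrow> x \<in> mcar M \<Longrightarrow> mact M a x \<in> mcar M"
    and "x \<in> mcar M \<Longrightarrow> y \<in> mcar M \<Longrightarrow> z \<in> mcar M \<Longrightarrow> madd M (madd M x y) z = madd M x (madd M y z)"
    and "x \<in> mcar M \<Longrightarrow> y \<in> mcar M \<Longrightarrow> madd M x y = madd M y x"
    and "x \<in> mcar M \<Longrightarrow> madd M (mzero M) x = x"
    and "x \<in> mcar M \<Longrightarrow> \<exists>y\<in>mcar M. madd M x y = mzero M"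
    and "a \<in> acar A \<Longrightarrow> b \<in> acar A \<Longrightarrow> x \<in> mcar M \<Longrightarrow> mact M (aadd A a b) x = madd M (mact M a x) (mact M b x)"
    and "a \<in> acar A \<Longrightarrow> b \<in> acar A \<Longrightarrow> x \<in> mcar M \<Longrightarrow> mact M (amul A a b) x = mact M a (mact M b x)"
    and "x \<in> mcar M \<Longrightarrow> mact M (aone A) x = x"
proof -
  note m = M[unfolded is_kmodule_def]
  show "mzero M \<in> mcar M" using m by (elim conjE) blast
  show "madd M x y \<in> mcar M" if "x \<in> mcar M" "y \<in> mcar M" using m that by (elim conjE) blast
  show "mact M a x \<in> mcar M" if "a \<in> acar A" "x \<in> mcar M" using m that by (elim conjE) blast
  show "madd M (madd M x y) z = madd M x (madd M y z)" if "x \<in> mcar M" "y \<in> mcar M" "z \<in> mcar M" using m that by (elim conjE) blast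
  show "madd M x y = madd M y x" if "x \<in> mcar M" "y \<in> mcar M" using m that by (elim conjE) blast
  show "madd M (mzero M) x = x" if "x \<in> mcar M" using m that by (elim conjE) blast
  show "\<exists>y\<in>mcar M. madd M x y = mzero M" if "x \<in> mcar M" using m that by (elim conjE) blast
  show "mact M (aadd A a b) x = madd M (mact M a x) (mact M b x)" if "a \<in> acar A" "b \<in> acar A" "x \<in> mcar M" using m that by (elim conjE) blast
  show "mact M (amul A a b) x = mact M a (mact M b x)" if "a \<in> acar A" "b \<in> acar A" "x \<in> mcar M" using m that by (elim conjE) blast
  have "\<forall>x\<in>mcar M. mact M (aone A) x = x" using m by (elim conjE)
  then show "mact M (aone A) x = x" if "x \<in> mcar M" using that by simp
qed

lemma act_in: "f \<in> RS S \<Longrightarrow> x \<in> mcar M \<Longrightarrow> mact M (emb f) x \<in> mcar M"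
  by (intro kmod emb_in)

lemma act_add: "f \<in> RS S \<Longrightarrow> g \<in> RS S \<Longrightarrow> x \<in> mcar M \<Longrightarrow> mact M (emb (f + g)) x = madd M (mact M (emb f) x) (mact M (emb g) x)"
proof -
  assume a: "f \<in> RS S" "g \<in> RS S" "x \<in> mcar M"
  have "mact M (aadd A (emb f) (emb g)) x = madd M (mact M (emb f) x) (mact M (emb g) x)"
    by (rule kmod(8)[OF emb_in[OF a(1)] emb_in[OF a(2)] a(3)])
  then show ?thesis using a by (simp add: emb_add)
qed

lemma act_mul: "f \<in> RS S \<Longrightarrow> g \<in> RS S \<Longrightarrow> x \<in> mcar M \<Longrightarrow> mact M (emb (f \<otimes> g)) x = mact M (emb f) (mact M (emb g) x)"
proof -
  assume a: "f \<in> RS S" "g \<in> RS S" "x \<in> mcar M"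
  have "mact M (amul A (emb f) (emb g)) x = mact M (emb f) (mact M (emb g) x)"
    by (rule kmod(9)[OF emb_in[OF a(1)] emb_in[OF a(2)] a(3)])
  then show ?thesis using a by (simp add: emb_mul)
qed

lemma act_one: "x \<in> mcar M \<Longrightarrow> mact M (emb (mon 0)) x = x"
  using kmod(10) by (simp add: emb_one)

lemma act_zero: assumes x: "x \<in> mcar M" shows "mact M (emb 0) x = mzero M"
proof -
  define u where "u = mact M (emb 0) x"
  have u: "u \<in> mcar M" unfolding u_def by (rule act_in[OF RS_closed(1) x])
  have uu: "u = madd M u u" using act_add[OF RS_closed(1) RS_closed(1) x] by (simp add: u_def)
  obtain y where y: "y \<in> mcar M" "madd M u y = mzero M" using kmod(7)[OF u] by blast
  have "mzero M = madd M (madd M u u) y" using uu y(2) by simp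
  also have "\<dots> = madd M u (mzero M)" using kmod(4)[OF u u y(1)] y(2) by simp
  also have "\<dots> = madd M (mzero M) u" by (rule kmod(5)[OF u kmod(1)])
  also have "\<dots> = u" by (rule kmod(6)[OF u])
  finally show ?thesis by (simp add: u_def)
qed

lemma msmul_eq:
  assumes "f \<in> RS S" "x \<in> mcar M"
  shows "msmul A M c (mact M (emb f) x) = mact M (emb (sc c f)) x"
proof -
  have m0: "mon 0 \<in> RS S" by (simp add: mon_RS)
  have "msmul A M c (mact M (emb f) x) = mact M (emb (sc c (mon 0))) (mact M (emb f) x)"
    by (simp only: msmul_def emb_one emb_sc[OF m0])
  also have "\<dots> = mact M (emb (sc c (mon 0) \<otimes> f)) x"
    using assms m0 by (simp only: act_mul RS_closed)
  finally show ?thesis by (simp add: tm_sc)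
qed

lemma evl_act: "x \<in> mcar M \<Longrightarrow> evl S (madd M) (mzero M) (msmul A M) (\<lambda>f. mact M (emb f) x)"
  by unfold_locales (simp_all only: act_zero act_add msmul_eq)

definition kern :: "'m \<Rightarrow> 'k ta set" where
  "kern x = {f \<in> RS S. mact M (emb f) x = mzero M}"

lemma left_sub_kern: assumes x: "x \<in> mcar M" shows "left_sub S (kern x)"
  unfolding left_sub_def
proof (intro conjI ballI)
  have z: "mzero M \<in> mcar M" "madd M (mzero M) (mzero M) = mzero M" by (rule kmod(1), rule kmod(6)[OF kmod(1)])
  show "0 \<in> kern x" by (simp add: kern_def act_zero[OF x])
  fix f assume f: "f \<in> kern x"
  show "f + g \<in> kern x" if g: "g \<in> kern x" for g
    using f g z(2) act_add[OF _ _ x] by (simp add: kern_def)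
  show "g \<otimes> f \<in> kern x" if g: "g \<in> RS S" for g
  proof -
    have "mact M (emb g) (mzero M) = mact M (emb g) (mact M (emb 0) (mzero M))" by (simp only: act_zero[OF z(1)])
    also have "\<dots> = mact M (emb (g \<otimes> 0)) (mzero M)" by (rule act_mul[OF g RS_closed(1) z(1), symmetric])
    also have "\<dots> = mzero M" by (simp add: act_zero[OF z(1)])
    finally show ?thesis using f g act_mul[OF g _ x] by (simp add: kern_def)
  qed
qed

text \<open>Upper bound: finite-dimensional \<open>V\<close> and \<open>F\<close> have exponents in
  a common box, so \<open>N\<close>-fold products stay in a box of linear size and
  \<open>growth\<close> applies. Lower bound: the monomials of a free set of size \<open>e\<close>
  are independent on the generator.\<close>

theorem GKdim_cyclic:
  assumes x: "x \<in> mcar M" and cyc: "\<And>m. m \<in> mcar M \<Longrightarrow> \<exists>f\<in>RS S. m = mact M (emb f) x"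
    and e: "\<And>I. I \<subseteq> S \<Longrightarrow> free (kern x) I \<Longrightarrow> card I \<le> e"
    and I: "I \<subseteq> S" "free (kern x) I" "card I = e"
  shows "GKdim A M = ereal (real e)"
proof -
  define ev where "ev = (\<lambda>f. mact M (emb f) x)"
  interpret E: evl S "aadd A" "azero A" "asmul A" emb by (rule evl_emb)
  interpret X: evl S "madd M" "mzero M" "msmul A M" ev unfolding ev_def by (rule evl_act[OF x])
  have K: "left_sub S (kern x)" by (rule left_sub_kern[OF x])
  define ok where "ok = {(V, F). is_subspace (acar A) (aadd A) (azero A) (asmul A) V \<and> aone A \<in> V \<and>
      Defs.rank (aadd A) (azero A) (asmul A) V < \<infinity> \<and>
      is_subspace (mcar M) (madd M) (mzero M) (msmul A M) F \<and>
      Defs.rank (madd M) (mzero M) (msmul A M) F < \<infinity>}"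
  obtain C where C: "\<And>m. \<exists>T. T \<subseteq> exps S \<and> finite T \<and> card T \<le> C * (m + 1) ^ e \<and> spans T (ebox S m) (kern x)"
    using growth[OF S K e] by blast
  have upper: "\<exists>D. \<forall>N. Defs.rank (madd M) (mzero M) (msmul A M) (prods M V F N) \<le> enat (D * (N + 1) ^ e)"
    if VF: "(V, F) \<in> ok" for V F
  proof -
    have V: "V \<subseteq> acar A" "Defs.rank (aadd A) (azero A) (asmul A) V < \<infinity>" and F: "F \<subseteq> mcar M" "Defs.rank (madd M) (mzero M) (msmul A M) F < \<infinity>"
      using VF by (auto simp: ok_def is_subspace_def)
    have "V \<subseteq> emb ` RS S" using V(1) emb_car by blast
    from E.finite_support[OF this V(2)] obtain TV where TV: "finite TV" "TV \<subseteq> exps S" "\<forall>v\<in>V. \<exists>f. keys f \<subseteq> TV \<and> v = emb f" by blast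
    have "F \<subseteq> ev ` RS S" using F(1) cyc unfolding ev_def by blast
    from X.finite_support[OF this F(2)] obtain TF where TF: "finite TF" "TF \<subseteq> exps S" "\<forall>v\<in>F. \<exists>f. keys f \<subseteq> TF \<and> v = ev f" by blast
    have "finite (TV \<union> TF)" "TV \<union> TF \<subseteq> exps S" using TV TF by auto
    from finite_subset_ebox[OF this S] obtain c where c: "TV \<union> TF \<subseteq> ebox S c" by blast
    have pr: "\<exists>h. keys h \<subseteq> ebox S (c * (length vs + 1)) \<and> foldr (mact M) vs f = ev h"
      if vsV: "set vs \<subseteq> V" and fF: "f \<in> F" for vs f
      using vsV
    proof (induction vs)
      case Nil
      obtain h where "keys h \<subseteq> TF" "f = ev h" using TF(3) fF by blast
      then show ?case using c by (intro exI[of _ h]) auto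
    next
      case (Cons v vs)
      then obtain h where h: "keys h \<subseteq> ebox S (c * (length vs + 1))" "foldr (mact M) vs f = ev h" by auto
      obtain g where g: "keys g \<subseteq> TV" "v = emb g" using TV(3) Cons.prems by auto
      have gR: "g \<in> RS S" using g(1) TV(2) by (auto simp: RS_def)
      have hR: "h \<in> RS S" using h(1) ebox_exps by (auto simp: RS_def)
      have "foldr (mact M) (v # vs) f = ev (g \<otimes> h)"
        using act_mul[OF gR hR x] by (simp add: h(2) g(2) ev_def)
      moreover have "keys (g \<otimes> h) \<subseteq> ebox S (c * (length (v # vs) + 1))"
      proof
        fix a assume "a \<in> keys (g \<otimes> h)"
        then obtain b b' where b: "b \<in> keys g" "b' \<in> keys h" "a = b + b'" using keys_tm[of g h] by blast
        have "b \<in> ebox S c" "b' \<in> ebox S (c * (length vs + 1))" using b g(1) h(1) c by auto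
        from ebox_add[OF this] show "a \<in> ebox S (c * (length (v # vs) + 1))" by (simp add: b(3) algebra_simps)
      qed
      ultimately show ?case by blast
    qed
    have "Defs.rank (madd M) (mzero M) (msmul A M) (prods M V F N) \<le> enat (C * (c + 1) ^ e * (N + 1) ^ e)" for N
    proof -
      let ?m = "c * (N + 1)"
      obtain T where T: "T \<subseteq> exps S" "finite T" "card T \<le> C * (?m + 1) ^ e" "spans T (ebox S ?m) (kern x)" using C by blast
      have "Defs.rank (madd M) (mzero M) (msmul A M) (prods M V F N) \<le> enat (card T)"
      proof (rule X.rank_le[OF T(2,1)])
        fix z assume "z \<in> prods M V F N"
        then obtain vs f where z: "z = foldr (mact M) vs f" "set vs \<subseteq> V" "length vs = N" "f \<in> F" unfolding prods_def by blast
        obtain h where h: "keys h \<subseteq> ebox S ?m" "z = ev h" using pr[OF z(2,4)] z(1,3) by auto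
        obtain g where g: "keys g \<subseteq> T" "h - g \<in> kern x" using spansD[OF K T(4) h(1)] by blast
        have "h \<in> RS S" "g \<in> RS S" using h(1) ebox_exps g(1) T(1) by (auto simp: RS_def)
        then have "ev h = ev g" using g(2) by (intro X.ev_eq) (auto simp: kern_def ev_def)
        then show "\<exists>f. keys f \<subseteq> T \<and> z = ev f" using g(1) h(2) by blast
      qed
      also have "card T \<le> C * (c + 1) ^ e * (N + 1) ^ e"
      proof -
        have "?m + 1 \<le> (c + 1) * (N + 1)" by simp
        then have "C * (?m + 1) ^ e \<le> C * ((c + 1) * (N + 1)) ^ e" by (intro mult_left_mono power_mono) auto
        then show ?thesis using T(3) by (simp only: power_mult_distrib mult.assoc)
      qed
      finally show ?thesis by simp
    qed
    then show ?thesis by blast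
  qed
  have le: "gk_growth A M V F \<le> ereal (real e)" if VF: "(V, F) \<in> ok" for V F
  proof -
    obtain D where D: "\<And>N. Defs.rank (madd M) (mzero M) (msmul A M) (prods M V F N) \<le> enat (D * (N + 1) ^ e)" using upper[OF VF] by blast
    have "the_enat (Defs.rank (madd M) (mzero M) (msmul A M) (prods M V F N)) \<le> D * (N + 1) ^ e" for N
      using D[of N] by (cases "Defs.rank (madd M) (mzero M) (msmul A M) (prods M V F N)") auto
    from limsup_growth_le[OF this] show ?thesis unfolding gk_growth_def .
  qed
  \<comment> \<open>With exponents 0 and 1 on \<open>I\<close>, products of \<open>N\<close> factors
    reach all of \<open>ecube I N\<close>, which has \<open>(N + 1) ^ e\<close> elements.\<close>
  define V0 where "V0 = emb ` {f. keys f \<subseteq> ecube I 1}"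
  define F0 where "F0 = ev ` {f. keys f \<subseteq> {0}}"
  have fI: "finite I" using I(1) S finite_subset by auto
  have cS: "ecube I m \<subseteq> exps S" for m using ecube_exps exps_mono[OF I(1)] by blast
  have R1: "f \<in> RS S" if "keys f \<subseteq> ecube I m" for f m using that cS by (auto simp: RS_def)
  have R0: "f \<in> RS S" if "keys f \<subseteq> {0}" for f using that by (auto simp: RS_def)
  have ok0: "(V0, F0) \<in> ok"
    unfolding ok_def
  proof (intro CollectI case_prodI conjI)
    show "is_subspace (acar A) (aadd A) (azero A) (asmul A) V0"
      unfolding is_subspace_def
    proof (intro conjI ballI allI)
      show "V0 \<subseteq> acar A" using R1 emb_in by (auto simp: V0_def)
      show "azero A \<in> V0" unfolding V0_def emb_zero by (rule imageI) simp
      fix u assume "u \<in> V0"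
      then obtain f where f: "u = emb f" "keys f \<subseteq> ecube I 1" by (auto simp: V0_def)
      show "aadd A u v \<in> V0" if "v \<in> V0" for v
      proof -
        obtain g where g: "v = emb g" "keys g \<subseteq> ecube I 1" using \<open>v \<in> V0\<close> by (auto simp: V0_def)
        have "keys (f + g) \<subseteq> ecube I 1" using keys_add[of f g] f g by blast
        then show ?thesis unfolding f g V0_def emb_add[OF R1[OF f(2)] R1[OF g(2)]] by blast
      qed
      show "asmul A c u \<in> V0" for c
        unfolding f V0_def emb_sc[OF R1[OF f(2)]] using keys_sc[of c f] f(2) by blast
    qed
    show "aone A \<in> V0" unfolding V0_def emb_one by (rule imageI) (simp add: mon_def)
    have "Defs.rank (aadd A) (azero A) (asmul A) V0 \<le> enat (card (ecube I 1))"
      by (rule E.rank_le[OF ecube(1)[OF fI] cS]) (auto simp: V0_def)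
    then show "Defs.rank (aadd A) (azero A) (asmul A) V0 < \<infinity>" using order_le_less_trans by fastforce
    show "is_subspace (mcar M) (madd M) (mzero M) (msmul A M) F0"
      unfolding is_subspace_def
    proof (intro conjI ballI allI)
      show "F0 \<subseteq> mcar M" using R0 act_in[OF _ x] by (auto simp: F0_def ev_def)
      show "mzero M \<in> F0" unfolding F0_def X.ev_zero[symmetric] by (rule imageI) simp
      fix u assume "u \<in> F0"
      then obtain f where f: "u = ev f" "keys f \<subseteq> {0}" by (auto simp: F0_def)
      show "madd M u v \<in> F0" if "v \<in> F0" for v
      proof -
        obtain g where g: "v = ev g" "keys g \<subseteq> {0}" using \<open>v \<in> F0\<close> by (auto simp: F0_def)
        have "keys (f + g) \<subseteq> {0}" using keys_add[of f g] f g by blast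
        then show ?thesis unfolding f g F0_def X.ev_add[OF R0[OF f(2)] R0[OF g(2)], symmetric] by blast
      qed
      show "msmul A M c u \<in> F0" for c
        unfolding f F0_def X.ev_sc[OF R0[OF f(2)], symmetric] using keys_sc[of c f] f(2) by blast
    qed
    have "Defs.rank (madd M) (mzero M) (msmul A M) F0 \<le> enat (card {0::nat\<Rightarrow>int})"
      by (rule X.rank_le) (auto simp: F0_def)
    then show "Defs.rank (madd M) (mzero M) (msmul A M) F0 < \<infinity>" using order_le_less_trans by fastforce
  qed
  have xF: "x \<in> F0" unfolding F0_def ev_def by (rule image_eqI[of _ _ "mon 0"]) (simp_all only: act_one[OF x] mem_Collect_eq keys_mon subset_refl)
  have build: "\<exists>vs c. length vs = N \<and> set vs \<subseteq> V0 \<and> c \<noteq> 0 \<and> foldr (mact M) vs x = ev (single a c)" if "a \<in> ecube I N" for N a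
    using that
  proof (induction N arbitrary: a)
    case 0
    then have "a i = 0" for i by (cases "i \<in> I") (auto simp: ecube_def exps_def)
    then have a0: "a = 0" by (intro ext) simp
    have "x = ev (single a 1)" using act_one[OF x] by (simp only: ev_def mon_def a0)
    then show ?case by (intro exI[of _ "[]"] exI[of _ 1]) simp
  next
    case (Suc N)
    \<comment> \<open>One unit is taken off every positive coordinate, which shortens the side of
      the cube by one.\<close>
    define b where "b = (\<lambda>i. if a i > 0 then 1 else (0::int))"
    have bc: "b \<in> ecube I 1" using Suc.prems by (auto simp: ecube_def exps_def b_def)
    have "a - b \<in> ecube I N" using Suc.prems by (auto simp: ecube_def exps_def b_def)
    from Suc.IH[OF this] obtain vs c where vs: "length vs = N" "set vs \<subseteq> V0" "c \<noteq> 0" "foldr (mact M) vs x = ev (single (a - b) c)" by blast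
    have bR: "mon b \<in> RS S" using bc cS by (intro mon_RS) blast
    have abR: "single (a - b) c \<in> RS S" using \<open>a - b \<in> ecube I N\<close> cS by (intro RS_single) blast
    have "foldr (mact M) (emb (mon b) # vs) x = ev (mon b \<otimes> single (a - b) c)"
      using act_mul[OF bR abR x] by (simp add: vs(4) ev_def)
    also have "mon b \<otimes> single (a - b) c = single a (\<kappa> b (a - b) * c)" unfolding mon_def tm_single by simp
    finally have "foldr (mact M) (emb (mon b) # vs) x = ev (single a (\<kappa> b (a - b) * c))" .
    moreover have "emb (mon b) \<in> V0" using bc unfolding V0_def by (intro imageI) simp
    ultimately show ?case using vs by (intro exI[of _ "emb (mon b) # vs"] exI[of _ "\<kappa> b (a - b) * c"]) simp
  qed
  have low: "enat ((N + 1) ^ e) \<le> Defs.rank (madd M) (mzero M) (msmul A M) (prods M V0 F0 N)" for N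
  proof -
    have "enat (card (ecube I N)) \<le> Defs.rank (madd M) (mzero M) (msmul A M) (prods M V0 F0 N)"
    proof (rule X.rank_ge[OF ecube(1)[OF fI] cS])
      fix g assume g: "keys g \<subseteq> ecube I N" "ev g = mzero M"
      have "g \<in> kern x" using g R1[OF g(1)] by (simp add: kern_def ev_def)
      moreover have "g \<in> RS I" using g(1) ecube_exps by (auto simp: RS_def)
      ultimately show "g = 0" using I(2) by (simp add: free_def)
    next
      fix a assume "a \<in> ecube I N"
      from build[OF this] obtain vs c where "length vs = N" "set vs \<subseteq> V0" "c \<noteq> 0" "foldr (mact M) vs x = ev (single a c)" by blast
      then show "\<exists>c. c \<noteq> 0 \<and> ev (single a c) \<in> prods M V0 F0 N" unfolding prods_def using xF by (metis (mono_tags, lifting) mem_Collect_eq)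
    qed
    then show ?thesis using ecube(2)[OF fI, of N] I(3) by simp
  qed
  have ge: "ereal (real e) \<le> gk_growth A M V0 F0"
  proof -
    obtain D where D: "\<And>N. Defs.rank (madd M) (mzero M) (msmul A M) (prods M V0 F0 N) \<le> enat (D * (N + 1) ^ e)" using upper[OF ok0] by blast
    \<comment> \<open>The upper bound excludes an infinite rank, on which \<open>the_enat\<close>
      would carry no information.\<close>
    have "(N + 1) ^ e \<le> the_enat (Defs.rank (madd M) (mzero M) (msmul A M) (prods M V0 F0 N))" for N
      using D[of N] low[of N] by (cases "Defs.rank (madd M) (mzero M) (msmul A M) (prods M V0 F0 N)") auto
    from limsup_growth_ge[OF this] show ?thesis unfolding gk_growth_def .
  qed
  have "GKdim A M = (SUP VF\<in>ok. gk_growth A M (fst VF) (snd VF))" unfolding GKdim_def ok_def ..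
  also have "\<dots> = ereal (real e)"
  proof (rule antisym)
    show "(SUP VF\<in>ok. gk_growth A M (fst VF) (snd VF)) \<le> ereal (real e)"
    proof (rule SUP_least)
      fix VF assume "VF \<in> ok"
      then show "gk_growth A M (fst VF) (snd VF) \<le> ereal (real e)" using le[of "fst VF" "snd VF"] by simp
    qed
    show "ereal (real e) \<le> (SUP VF\<in>ok. gk_growth A M (fst VF) (snd VF))"
      using ge by (intro SUP_upper2[OF ok0]) simp
  qed
  finally show ?thesis .
qed

end

end

section \<open>Simple quotients as modules\<close>

context gk
begin

context
  fixes K :: "'k ta set"
  assumes K: "maximal_left S K" and inj: "inj_on emb (RS S)"
begin

text \<open>Residue classes are sets of algebra elements, since \<open>GK_simple_values\<close> asks for modules on that carrier type.\<close>

definition cls :: "'k ta \<Rightarrow> 'a set" where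
  "cls f = emb ` {g \<in> RS S. f - g \<in> K}"

definition rep :: "'a set \<Rightarrow> 'k ta" where
  "rep X = (SOME f. f \<in> RS S \<and> cls f = X)"

definition unemb :: "'a \<Rightarrow> 'k ta" where
  "unemb a = (SOME f. f \<in> RS S \<and> emb f = a)"

text \<open>The operations go through chosen representatives; \<open>madd_cls\<close> and
  \<open>mact_cls\<close> show that the choice is immaterial.\<close>

definition quotm :: "('a, 'a set) kmod" where
  "quotm = \<lparr>mcar = cls ` RS S, madd = (\<lambda>X Y. cls (rep X + rep Y)), mzero = cls 0,
     mact = (\<lambda>a X. cls (unemb a \<otimes> rep X))\<rparr>"

lemma left_sub_K: "left_sub S K"
  using K by (simp add: maximal_left_def)

lemma cls_eq: assumes f: "f \<in> RS S" "g \<in> RS S" shows "cls f = cls g \<longleftrightarrow> f - g \<in> K"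
proof
  assume e: "cls f = cls g"
  have "emb f \<in> cls f" using f left_subD(1)[OF left_sub_K] by (auto simp: cls_def)
  then have "emb f \<in> cls g" using e by simp
  then obtain h where h: "emb f = emb h" "h \<in> RS S" "g - h \<in> K" by (auto simp: cls_def)
  then have "f = h" using inj_onD[OF inj h(1) f(1) h(2)] by simp
  then have "g - f \<in> K" using h(3) by simp
  from left_subD(5)[OF left_sub_K this] show "f - g \<in> K" by simp
next
  assume d: "f - g \<in> K"
  have "f - h \<in> K \<longleftrightarrow> g - h \<in> K" for h
  proof
    assume "f - h \<in> K"
    from left_subD(6)[OF left_sub_K this d] show "g - h \<in> K" by simp
  next
    assume "g - h \<in> K"
    from left_subD(2)[OF left_sub_K this d] show "f - h \<in> K" by simp
  qed
  then show "cls f = cls g" by (simp add: cls_def)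
qed

lemma rep: assumes "f \<in> RS S" shows "rep (cls f) \<in> RS S" "rep (cls f) - f \<in> K"
proof -
  have "\<exists>g. g \<in> RS S \<and> cls g = cls f" using assms by blast
  from someI_ex[OF this] have r: "rep (cls f) \<in> RS S" "cls (rep (cls f)) = cls f" unfolding rep_def by auto
  show "rep (cls f) \<in> RS S" by (rule r(1))
  show "rep (cls f) - f \<in> K" using r cls_eq[OF r(1) assms] by simp
qed

lemma unemb: assumes "f \<in> RS S" shows "unemb (emb f) = f"
proof -
  have "\<exists>g. g \<in> RS S \<and> emb g = emb f" using assms by blast
  from someI_ex[OF this] have "unemb (emb f) \<in> RS S" "emb (unemb (emb f)) = emb f" unfolding unemb_def by auto
  then show ?thesis using inj_onD[OF inj _ _ assms] by blast
qed

lemma madd_cls: assumes "f \<in> RS S" "g \<in> RS S" shows "madd quotm (cls f) (cls g) = cls (f + g)"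
proof -
  have e: "(rep (cls f) + rep (cls g)) - (f + g) = (rep (cls f) - f) + (rep (cls g) - g)" by simp
  have "(rep (cls f) + rep (cls g)) - (f + g) \<in> K"
    unfolding e by (rule left_subD(2)[OF left_sub_K rep(2)[OF assms(1)] rep(2)[OF assms(2)]])
  then have "cls (rep (cls f) + rep (cls g)) = cls (f + g)" using rep assms by (subst cls_eq) auto
  then show ?thesis by (simp add: quotm_def)
qed

lemma mact_cls: assumes "f \<in> RS S" "g \<in> RS S" shows "mact quotm (emb f) (cls g) = cls (f \<otimes> g)"
proof -
  have "f \<otimes> (rep (cls g) - g) \<in> K" using rep(2) assms left_subD(3)[OF left_sub_K] by blast
  then have "f \<otimes> rep (cls g) - f \<otimes> g \<in> K" by (simp add: tm_diff)
  then have "cls (f \<otimes> rep (cls g)) = cls (f \<otimes> g)" using rep assms by (subst cls_eq) auto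
  then show ?thesis using assms by (simp add: quotm_def unemb)
qed

lemma quotm_simps: "mcar quotm = cls ` RS S" "mzero quotm = cls 0"
  by (simp_all add: quotm_def)

lemma ball_im: "(\<forall>x\<in>F ` B. P x) \<longleftrightarrow> (\<forall>x\<in>B. P (F x))" and bex_im: "(\<exists>x\<in>F ` B. P x) \<longleftrightarrow> (\<exists>x\<in>B. P (F x))"
  by auto

lemma quotm_module: "is_kmodule A quotm"
  unfolding is_kmodule_def emb_car[symmetric] quotm_simps ball_im bex_im emb_one
proof (intro conjI ballI)
  show "cls 0 \<in> cls ` RS S" by simp
  have m0: "mon 0 \<in> RS S" by (simp add: mon_RS)
  fix f :: "'k ta" assume f: "f \<in> RS S"
  show "madd quotm (cls 0) (cls f) = cls f" using f by (simp only: madd_cls RS_closed add_0_left)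
  show "mact quotm (emb (mon 0)) (cls f) = cls f" using f m0 by (simp only: mact_cls mon_zero)
  have "madd quotm (cls f) (cls (- f)) = cls 0" using f by (simp only: madd_cls RS_closed add.right_inverse)
  then show "\<exists>y\<in>RS S. madd quotm (cls f) (cls y) = cls 0" using RS_closed(4)[OF f] by blast
  fix g :: "'k ta" assume g: "g \<in> RS S"
  show "madd quotm (cls f) (cls g) \<in> cls ` RS S" using f g by (simp add: madd_cls)
  show "mact quotm (emb f) (cls g) \<in> cls ` RS S" using f g by (simp add: mact_cls)
  show "madd quotm (cls f) (cls g) = madd quotm (cls g) (cls f)" using f g by (simp add: madd_cls add.commute)
  fix h :: "'k ta" assume h: "h \<in> RS S"
  show "madd quotm (madd quotm (cls f) (cls g)) (cls h) = madd quotm (cls f) (madd quotm (cls g) (cls h))"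
    using f g h by (simp add: madd_cls add.assoc)
  show "mact quotm (emb f) (madd quotm (cls g) (cls h)) = madd quotm (mact quotm (emb f) (cls g)) (mact quotm (emb f) (cls h))"
    using f g h by (simp add: madd_cls mact_cls tm_add_right)
  show "mact quotm (aadd A (emb f) (emb g)) (cls h) = madd quotm (mact quotm (emb f) (cls h)) (mact quotm (emb g) (cls h))"
    using f g h by (simp add: madd_cls mact_cls emb_add tm_add_left)
  show "mact quotm (amul A (emb f) (emb g)) (cls h) = mact quotm (emb f) (mact quotm (emb g) (cls h))"
    using f g h by (simp add: mact_cls emb_mul tm_assoc)
qed

lemma cls_zero_iff: "f \<in> RS S \<Longrightarrow> cls f = cls 0 \<longleftrightarrow> f \<in> K"
  using cls_eq[of f 0] by simp

lemma quotm_simple: "is_simple A quotm"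
  unfolding is_simple_def
proof (intro conjI allI impI quotm_module)
  have m0: "mon 0 \<in> RS S" by (simp add: mon_RS)
  have "mon 0 \<notin> K" using K by (simp add: maximal_left_def)
  then have "cls (mon 0) \<noteq> cls 0" using cls_zero_iff[OF m0] by simp
  then show "mcar quotm \<noteq> {mzero quotm}" unfolding quotm_simps using m0 by blast
  fix N assume N: "is_submodule A quotm N"
  show "N = {mzero quotm} \<or> N = mcar quotm"
  proof (cases "N = {mzero quotm}")
    case False
    have Ns: "N \<subseteq> cls ` RS S" "cls 0 \<in> N" using N by (auto simp: is_submodule_def quotm_simps)
    then obtain f where f: "f \<in> RS S" "cls f \<in> N" "cls f \<noteq> cls 0" using False unfolding quotm_simps by blast
    then have "f \<notin> K" using cls_zero_iff by blast
    then obtain g where g: "g \<in> RS S" "mon 0 - g \<otimes> f \<in> K" using K f(1) by (auto simp: maximal_left_def)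
    have act: "cls (h \<otimes> u) \<in> N" if "h \<in> RS S" "u \<in> RS S" "cls u \<in> N" for h u
    proof -
      have "mact quotm (emb h) (cls u) \<in> N" using N that emb_in unfolding is_submodule_def by blast
      then show ?thesis using that by (simp add: mact_cls)
    qed
    have gf: "g \<otimes> f \<in> RS S" using f g by simp
    have "cls (mon 0) = cls (g \<otimes> f)" using g(2) cls_eq[OF m0 gf] by simp
    then have "cls (mon 0) \<in> N" using act[OF g(1) f(1,2)] by simp
    then have "cls h \<in> N" if "h \<in> RS S" for h using act[OF that m0] by simp
    then show ?thesis using Ns(1) unfolding quotm_simps by blast
  qed simp
qed

lemma GKdim_quotm:
  assumes e: "\<And>I. I \<subseteq> S \<Longrightarrow> free K I \<Longrightarrow> card I \<le> e"
    and I: "I \<subseteq> S" "free K I" "card I = e"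
  shows "GKdim A quotm = ereal (real e)"
proof -
  have m0: "mon 0 \<in> RS S" by (simp add: mon_RS)
  have x: "cls (mon 0) \<in> mcar quotm" using m0 by (simp add: quotm_simps)
  have a: "mact quotm (emb f) (cls (mon 0)) = cls f" if "f \<in> RS S" for f
    using mact_cls[OF that m0] by (simp only: mon_zero)
  have kern: "kern quotm (cls (mon 0)) = K"
  proof -
    have "f \<in> kern quotm (cls (mon 0)) \<longleftrightarrow> f \<in> RS S \<and> f \<in> K" for f
      using a[of f] cls_zero_iff[of f] by (auto simp: kern_def[OF quotm_module] quotm_simps)
    moreover have "K \<subseteq> RS S" using K by (simp add: maximal_left_def)
    ultimately show ?thesis by blast
  qed
  show ?thesis
  proof (rule GKdim_cyclic[OF quotm_module x])
    fix m assume "m \<in> mcar quotm"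
    then show "\<exists>f\<in>RS S. m = mact quotm (emb f) (cls (mon 0))" using a by (auto simp: quotm_simps)
  qed (use e I in \<open>auto simp: kern\<close>)
qed

end

context
  fixes M :: "('a, 'm) kmod"
  assumes simple: "is_simple A M"
begin

lemma simple_module: "is_kmodule A M"
  using simple by (simp add: is_simple_def)

lemma simple_generated:
  assumes y: "y \<in> mcar M" "y \<noteq> mzero M" and m: "m \<in> mcar M"
  shows "\<exists>f\<in>RS S. m = mact M (emb f) y"
proof -
  note Mm = simple_module
  interpret X: evl S "madd M" "mzero M" "msmul A M" "\<lambda>f. mact M (emb f) y" by (rule evl_act[OF Mm y(1)])
  define N where "N = (\<lambda>f. mact M (emb f) y) ` RS S"
  have "is_submodule A M N"
    unfolding is_submodule_def
  proof (intro conjI ballI)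
    show "N \<subseteq> mcar M" using act_in[OF Mm _ y(1)] by (auto simp: N_def)
    show "mzero M \<in> N" unfolding N_def X.ev_zero[symmetric] by (rule imageI) simp
    fix u assume "u \<in> N"
    then obtain f where f: "f \<in> RS S" "u = mact M (emb f) y" by (auto simp: N_def)
    show "madd M u v \<in> N" if "v \<in> N" for v
    proof -
      obtain g where g: "g \<in> RS S" "v = mact M (emb g) y" using \<open>v \<in> N\<close> by (auto simp: N_def)
      show ?thesis unfolding f(2) g(2) N_def X.ev_add[OF f(1) g(1), symmetric] using f g by blast
    qed
    show "mact M a u \<in> N" if "a \<in> acar A" for a
    proof -
      obtain g where g: "g \<in> RS S" "a = emb g" using \<open>a \<in> acar A\<close> emb_car by blast
      show ?thesis unfolding f(2) g(2) N_def act_mul[OF Mm g(1) f(1) y(1), symmetric] using f g by blast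
    qed
  qed
  then have "N = {mzero M} \<or> N = mcar M" using simple by (simp add: is_simple_def)
  moreover have "y \<in> N" unfolding N_def using act_one[OF Mm y(1)] by (intro image_eqI[of _ _ "mon 0"]) (simp_all add: mon_RS)
  ultimately have "N = mcar M" using y(2) by blast
  then show ?thesis using m unfolding N_def by blast
qed

text \<open>In a simple module each nonzero multiple of \<open>x\<close> generates \<open>x\<close>
  again, which yields the inverse modulo the kernel.\<close>

lemma maximal_left_kern:
  assumes x: "x \<in> mcar M" "x \<noteq> mzero M"
  shows "maximal_left S (kern M x)"
  unfolding maximal_left_def
proof (intro conjI ballI impI)
  note Mm = simple_module
  interpret X: evl S "madd M" "mzero M" "msmul A M" "\<lambda>f. mact M (emb f) x" by (rule evl_act[OF Mm x(1)])
  have m0: "mon 0 \<in> RS S" by (simp add: mon_RS)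
  show "left_sub S (kern M x)" by (rule left_sub_kern[OF Mm x(1)])
  show "kern M x \<subseteq> RS S" by (auto simp: kern_def[OF Mm])
  show "mon 0 \<notin> kern M x" using act_one[OF Mm x(1)] x(2) by (simp add: kern_def[OF Mm])
  fix f assume f: "f \<in> RS S" "f \<notin> kern M x"
  then have "mact M (emb f) x \<in> mcar M" "mact M (emb f) x \<noteq> mzero M" using act_in[OF Mm _ x(1)] by (auto simp: kern_def[OF Mm])
  from simple_generated[OF this x(1)] obtain g where g: "g \<in> RS S" "x = mact M (emb g) (mact M (emb f) x)" by blast
  have gf: "g \<otimes> f \<in> RS S" using f g by simp
  have e: "mact M (emb (g \<otimes> f)) x = mact M (emb (mon 0)) x" using g act_mul[OF Mm g(1) f(1) x(1)] act_one[OF Mm x(1)] by simp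
  \<comment> \<open>The difference is written with \<open>sc (- 1)\<close>, since evaluation is
    known to respect sums and scalars.\<close>
  have "mact M (emb (mon 0 + sc (- 1) (g \<otimes> f))) x = madd M (mact M (emb (mon 0)) x) (mact M (emb (sc (- 1) (g \<otimes> f))) x)"
    by (rule X.ev_add[OF m0 RS_closed(5)[OF gf]])
  also have "\<dots> = mact M (emb (g \<otimes> f + sc (- 1) (g \<otimes> f))) x"
    unfolding e[symmetric] by (rule X.ev_add[OF gf RS_closed(5)[OF gf], symmetric])
  also have "g \<otimes> f + sc (- 1) (g \<otimes> f) = 0" by (simp add: sc_simps(4,10))
  also have "mact M (emb 0) x = mzero M" by (rule X.ev_zero)
  finally have "mact M (emb (mon 0 + sc (- 1) (g \<otimes> f))) x = mzero M" .
  moreover have "mon 0 + sc (- 1) (g \<otimes> f) = mon 0 - g \<otimes> f" unfolding sc_simps(4,10) by (rule diff_conv_add_uminus[symmetric])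
  ultimately have "mact M (emb (mon 0 - g \<otimes> f)) x = mzero M" by (simp only:)
  then have "mon 0 - g \<otimes> f \<in> kern M x" using m0 gf by (simp add: kern_def[OF Mm])
  then show "\<exists>g\<in>RS S. mon 0 - g \<otimes> f \<in> kern M x" using g(1) by blast
qed

end

end

section \<open>Quantum tori and their skew Laurent extensions\<close>

text \<open>The eigenvalue of \<open>scalar_aut p n\<close> on the monomial with exponent
  \<open>a\<close>.\<close>

definition pchar :: "(nat \<Rightarrow> 'k::field) \<Rightarrow> nat \<Rightarrow> (nat \<Rightarrow> int) \<Rightarrow> 'k" where
  "pchar p n a = (\<Prod>t<n. p t powi a t)"

lemma pchar_simps:
  assumes "\<And>t. t < n \<Longrightarrow> p t \<noteq> 0"
  shows "pchar p n (a + b) = pchar p n a * pchar p n b" "pchar p n 0 = 1" "pchar p n a \<noteq> 0" "pchar p n (smul z a) = pchar p n a powi z"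
proof -
  show "pchar p n (a + b) = pchar p n a * pchar p n b"
    unfolding pchar_def prod.distrib[symmetric] by (intro prod.cong refl) (simp add: assms power_int_add)
  show "pchar p n 0 = 1" by (simp add: pchar_def)
  show "pchar p n a \<noteq> 0" unfolding pchar_def using assms by (simp add: prod_zero_iff)
  have "(\<Prod>t<n. p t powi a t) powi z = (\<Prod>t<n. (p t powi a t) powi z)"
    by (induction n) (simp_all add: power_int_mult_distrib)
  then show "pchar p n (smul z a) = pchar p n a powi z"
    unfolding pchar_def smul_def by (simp add: power_int_mult[symmetric] mult.commute)
qed

lemma qt_coef_twisted:
  assumes "\<And>i j. Q i j \<noteq> (0::'k::field)" shows "twisted (qt_coef Q N)"
proof
  fix a b c :: "nat \<Rightarrow> int"
  show "qt_coef Q N a b \<noteq> 0" using assms by (simp add: qt_coef_def prod_zero_iff)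
  show "qt_coef Q N (a + b) c = qt_coef Q N a c * qt_coef Q N b c"
    unfolding qt_coef_def prod.distrib[symmetric] by (intro prod.cong refl) (simp add: assms power_int_add distrib_right)
  show "qt_coef Q N a (b + c) = qt_coef Q N a b * qt_coef Q N a c"
    unfolding qt_coef_def prod.distrib[symmetric] by (intro prod.cong refl) (simp add: assms power_int_add distrib_left)
qed

lemma prod_powi: "(\<Prod>t<(n::nat). f t) powi z = (\<Prod>t<n. (f t :: 'k::field) powi z)"
  by (induction n) (simp_all add: power_int_mult_distrib)

text \<open>Row \<open>n\<close> belongs to \<open>Y\<close> and encodes
  \<open>Y X_j = p_j X_j Y\<close>; the default 1 keeps the entries nonzero, as
  \<open>qt_coef_twisted\<close> demands.\<close>

definition Qext :: "(nat \<Rightarrow> nat \<Rightarrow> 'k::field) \<Rightarrow> (nat \<Rightarrow> 'k) \<Rightarrow> nat \<Rightarrow> nat \<Rightarrow> nat \<Rightarrow> 'k" where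
  "Qext q p n i j = (if i < n \<and> j < n then q i j else if i = n \<and> j < n then p j else 1)"

lemma qt_coef_Qext: "qt_coef (Qext q p n) (Suc n) a b = qt_coef q n a b * pchar p n b powi (a n)"
proof -
  have 1: "(\<Prod>i<n. \<Prod>j<i. Qext q p n i j powi (a i * b j)) = qt_coef q n a b"
    unfolding qt_coef_def by (intro prod.cong refl) (auto simp: Qext_def)
  have "(\<Prod>j<n. Qext q p n n j powi (a n * b j)) = (\<Prod>j<n. (p j powi b j) powi a n)"
    by (intro prod.cong refl) (simp add: Qext_def power_int_mult[symmetric] mult.commute)
  then have 2: "(\<Prod>j<n. Qext q p n n j powi (a n * b j)) = pchar p n b powi (a n)"
    by (simp only: pchar_def prod_powi)
  show ?thesis
    unfolding qt_coef_def[of "Qext q p n"] prod.lessThan_Suc 1 2 ..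
qed

lemma sum_fun: "(sum F A) c = (\<Sum>x\<in>A. F x c)"
  by (induction A rule: infinite_finite_induct) auto

lemma lookup_Abs: "finite {a. f a \<noteq> 0} \<Longrightarrow> lookup (Abs_poly_mapping f) = f"
  by (rule lookup_Abs_poly_mapping)

lemma acar_torus: "acar (quantum_torus q n) = {f. finite {a. f a \<noteq> 0} \<and> {a. f a \<noteq> 0} \<subseteq> exps {..<n}}"
  by (simp add: quantum_torus_def qt_mons_eq_exps)

lemma qt_mul_super:
  assumes "finite A" "{a. u a \<noteq> 0} \<subseteq> A" "finite B" "{b. v b \<noteq> 0} \<subseteq> B"
  shows "qt_mul q n u v c = (\<Sum>a\<in>A. \<Sum>b\<in>B. if a + b = c then u a * v b * qt_coef q n a b else 0)"
proof -
  have "qt_mul q n u v c = (\<Sum>a\<in>{a. u a \<noteq> 0}. \<Sum>b\<in>{b. v b \<noteq> 0}. if a + b = c then u a * v b * qt_coef q n a b else 0)"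
    unfolding qt_mul_def plus_fun_def ..
  also have "\<dots> = (\<Sum>a\<in>{a. u a \<noteq> 0}. \<Sum>b\<in>B. if a + b = c then u a * v b * qt_coef q n a b else 0)"
    by (intro sum.cong refl sum.mono_neutral_left) (use assms in auto)
  also have "\<dots> = (\<Sum>a\<in>A. \<Sum>b\<in>B. if a + b = c then u a * v b * qt_coef q n a b else 0)"
    by (intro sum.mono_neutral_left assms ballI sum.neutral) simp
  finally show ?thesis .
qed

section \<open>The torus and its skew Laurent extension as twisted group algebras\<close>

locale torus =
  fixes q :: "nat \<Rightarrow> nat \<Rightarrow> 'k::field" and p :: "nat \<Rightarrow> 'k" and n :: nat
  assumes q_nz: "\<And>i j. i < n \<Longrightarrow> j < n \<Longrightarrow> q i j \<noteq> 0" and p_nz: "\<And>i. i < n \<Longrightarrow> p i \<noteq> 0"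
begin

abbreviation "\<Lambda> \<equiv> quantum_torus q n"
abbreviation "\<sigma> \<equiv> scalar_aut p n"
abbreviation "\<kappa> \<equiv> qt_coef (Qext q p n) (Suc n)"

lemma twisted: "twisted \<kappa>"
  by (rule qt_coef_twisted) (simp add: Qext_def q_nz p_nz)

sublocale twisted \<kappa>
  by (rule twisted)

notation tm (infixl "\<otimes>" 70)

lemmas pchars = pchar_simps[of n p, OF p_nz]

lemma kappa: "\<kappa> a b = qt_coef q n a b * pchar p n b powi (a n)"
  by (rule qt_coef_Qext)

text \<open>The cocycle of the extension serves for \<open>\<Lambda>\<close> as well: its additional
  factor is a power with exponent \<open>a n\<close>, which is 0 when the left factor contains no
  \<open>Y\<close>.\<close>

lemma gk_torus: "gk \<kappa> \<Lambda> {..<n} lookup"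
proof (unfold_locales)
  show "finite {..<n}" by simp
  show "lookup ` RS {..<n} = acar \<Lambda>"
  proof (intro set_eqI iffI)
    fix f :: "(nat \<Rightarrow> int) \<Rightarrow> 'k" assume "f \<in> acar \<Lambda>"
    then have f: "finite {a. f a \<noteq> 0}" "{a. f a \<noteq> 0} \<subseteq> exps {..<n}" by (auto simp: acar_torus)
    have "keys (Abs_poly_mapping f) \<subseteq> exps {..<n}" using f(2) by (auto simp: in_keys_iff lookup_Abs[OF f(1)])
    then show "f \<in> lookup ` RS {..<n}" by (intro image_eqI[of _ _ "Abs_poly_mapping f"]) (simp_all add: RS_def lookup_Abs[OF f(1)])
  next
    fix f :: "(nat \<Rightarrow> int) \<Rightarrow> 'k" assume "f \<in> lookup ` RS {..<n}"
    then obtain g where g: "g \<in> RS {..<n}" "f = lookup g" by blast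
    have "{a. f a \<noteq> 0} = keys g" by (auto simp: g(2) in_keys_iff)
    then show "f \<in> acar \<Lambda>" using g(1) by (simp add: acar_torus RS_def)
  qed
  fix f g :: "'k ta" and c
  show "aadd \<Lambda> (lookup f) (lookup g) = lookup (f + g)"
    by (rule ext) (simp add: quantum_torus_def lookup_add)
  show "azero \<Lambda> = lookup 0" by (rule ext) (simp add: quantum_torus_def)
  show "aone \<Lambda> = lookup (mon 0)"
    by (rule ext) (simp add: quantum_torus_def mon_def lookup_one when_def zero_fun_def[symmetric])
  show "asmul \<Lambda> c (lookup f) = lookup (sc c f)" by (rule ext) (simp add: quantum_torus_def)
  assume fg: "f \<in> RS {..<n}" "g \<in> RS {..<n}"
  show "amul \<Lambda> (lookup f) (lookup g) = lookup (f \<otimes> g)"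
  proof
    fix c
    have s: "{a. lookup f a \<noteq> 0} \<subseteq> keys f" "{a. lookup g a \<noteq> 0} \<subseteq> keys g" by (auto simp: in_keys_iff)
    have "amul \<Lambda> (lookup f) (lookup g) c = (\<Sum>a\<in>keys f. \<Sum>b\<in>keys g. if a + b = c then lookup f a * lookup g b * qt_coef q n a b else 0)"
      using qt_mul_super[OF finite_keys s(1) finite_keys s(2)] by (simp add: quantum_torus_def)
    also have "\<dots> = lookup (f \<otimes> g) c"
      unfolding lookup_tm
    proof (intro sum.cong refl)
      fix a b assume "a \<in> keys f"
      then have "a n = 0" using fg by (auto simp: RS_def exps_def)
      then show "(if a + b = c then lookup f a * lookup g b * qt_coef q n a b else 0) = (if a + b = c then \<kappa> a b * lookup f a * lookup g b else 0)"
        unfolding kappa by simp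
    qed
    finally show "amul \<Lambda> (lookup f) (lookup g) c = lookup (f \<otimes> g) c" .
  qed
qed

text \<open>Coordinate \<open>n\<close> of an exponent is the exponent of \<open>Y\<close>.\<close>

definition embL :: "'k ta \<Rightarrow> int \<Rightarrow> (nat \<Rightarrow> int) \<Rightarrow> 'k" where
  "embL f = (\<lambda>m a. if a n = 0 then lookup f (a(n := m)) else 0)"

lemma acar_mult: "h \<in> acar \<Lambda> \<Longrightarrow> (\<lambda>a. c a * h a) \<in> acar \<Lambda>"
proof -
  assume h: "h \<in> acar \<Lambda>"
  have "{a. c a * h a \<noteq> 0} \<subseteq> {a. h a \<noteq> 0}" by auto
  then show ?thesis using h unfolding acar_torus by (auto intro: finite_subset)
qed

text \<open>\<open>\<sigma>\<close> is diagonal on monomials. For negative powers the inverse is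
  taken relative to the carrier, so each iterate has to be shown to stay in
  \<open>acar \<Lambda>\<close>.\<close>

lemma sigma_pow_eq:
  assumes h: "h \<in> acar \<Lambda>" shows "sigma_pow \<Lambda> \<sigma> i h = (\<lambda>a. pchar p n a powi i * h a)"
proof -
  have s: "\<sigma> f = (\<lambda>a. pchar p n a * f a)" for f by (simp add: scalar_aut_def pchar_def)
  have inj: "inj_on \<sigma> (acar \<Lambda>)"
  proof (rule inj_onI, rule ext)
    fix f g a assume "\<sigma> f = \<sigma> g"
    then have "pchar p n a * f a = pchar p n a * g a" unfolding s by meson
    then show "f a = g a" using pchars(3) by simp
  qed
  have inv: "inv_into (acar \<Lambda>) \<sigma> g = (\<lambda>a. inverse (pchar p n a) * g a)" if "g \<in> acar \<Lambda>" for g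
  proof (rule inv_into_f_eq[OF inj acar_mult[OF that]])
    show "\<sigma> (\<lambda>a. inverse (pchar p n a) * g a) = g" unfolding s by (rule ext) (simp add: pchars(3) mult.assoc[symmetric])
  qed
  have 1: "(\<sigma> ^^ k) h = (\<lambda>a. pchar p n a ^ k * h a)" for k
    by (induction k) (simp_all add: s mult.assoc)
  have 2: "((inv_into (acar \<Lambda>) \<sigma>) ^^ k) h = (\<lambda>a. inverse (pchar p n a) ^ k * h a)" for k
  proof (induction k)
    case (Suc k)
    have "((inv_into (acar \<Lambda>) \<sigma>) ^^ Suc k) h = inv_into (acar \<Lambda>) \<sigma> (\<lambda>a. inverse (pchar p n a) ^ k * h a)"
      by (simp add: Suc)
    also have "\<dots> = (\<lambda>a. inverse (pchar p n a) ^ Suc k * h a)" unfolding inv[OF acar_mult[OF h]] by (simp add: mult.assoc)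
    finally show ?case .
  qed simp
  show ?thesis unfolding sigma_pow_def by (auto simp: 1 2 power_int_def)
qed

lemma embL_in: assumes f: "f \<in> RS {..<Suc n}" shows "embL f i \<in> acar \<Lambda>" "{a. embL f i a \<noteq> 0} \<subseteq> (\<lambda>a. a(n := 0)) ` keys f"
proof -
  show s: "{a. embL f i a \<noteq> 0} \<subseteq> (\<lambda>a. a(n := 0)) ` keys f"
  proof
    fix a assume "a \<in> {a. embL f i a \<noteq> 0}"
    then have a: "a n = 0" "lookup f (a(n := i)) \<noteq> 0" by (auto simp: embL_def split: if_splits)
    have "a = (a(n := i))(n := 0)" using a(1) by (simp add: fun_upd_idem)
    moreover have "a(n := i) \<in> keys f" using a(2) by (simp add: in_keys_iff)
    ultimately show "a \<in> (\<lambda>a. a(n := 0)) ` keys f" by (rule image_eqI)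
  qed
  have "(\<lambda>a. a(n := 0)) ` keys f \<subseteq> exps {..<n}" using f by (auto simp: RS_def exps_def subset_iff less_Suc_eq)
  then show "embL f i \<in> acar \<Lambda>" using s finite_subset[OF s] unfolding acar_torus by auto
qed

lemma embL_support: "{i. embL f i \<noteq> 0} \<subseteq> (\<lambda>a. a n) ` keys f"
proof
  fix i assume "i \<in> {i. embL f i \<noteq> 0}"
  then obtain a where "embL f i a \<noteq> 0" by (auto simp: fun_eq_iff)
  then have "a(n := i) \<in> keys f" by (auto simp: embL_def in_keys_iff split: if_splits)
  then show "i \<in> (\<lambda>a. a n) ` keys f" by (intro image_eqI[of _ _ "a(n := i)"]) simp_all
qed

lemma sl_mul_super:
  assumes G: "\<And>j. G j \<in> acar \<Lambda>"
    and I: "finite I" "{i. F i \<noteq> 0} \<subseteq> I" and J: "finite J" "{j. G j \<noteq> 0} \<subseteq> J"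
  shows "sl_mul \<Lambda> \<sigma> F G m = (\<Sum>i\<in>I. \<Sum>j\<in>J. if i + j = m then qt_mul q n (F i) (\<lambda>a. pchar p n a powi i * G j a) else 0)"
proof -
  have z: "qt_mul q n 0 v = 0" "qt_mul q n u (\<lambda>a. 0) = 0" for u v
    by (auto simp: qt_mul_def fun_eq_iff)
  have amul: "amul \<Lambda> = qt_mul q n" by (simp add: quantum_torus_def)
  have "sl_mul \<Lambda> \<sigma> F G m = (\<Sum>i\<in>{i. F i \<noteq> 0}. \<Sum>j\<in>{j. G j \<noteq> 0}. if i + j = m then qt_mul q n (F i) (\<lambda>a. pchar p n a powi i * G j a) else 0)"
    unfolding sl_mul_def sigma_pow_eq[OF G] amul by (rule refl)
  also have "\<dots> = (\<Sum>i\<in>{i. F i \<noteq> 0}. \<Sum>j\<in>J. if i + j = m then qt_mul q n (F i) (\<lambda>a. pchar p n a powi i * G j a) else 0)"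
  proof (rule sum.cong[OF refl], rule sum.mono_neutral_left[OF J], rule ballI)
    fix i j assume "j \<in> J - {j. G j \<noteq> 0}"
    then have "G j = 0" by simp
    then have "(\<lambda>a. pchar p n a powi i * G j a) = (\<lambda>a. 0)" by (simp only: zero_fun_apply mult_zero_right)
    then show "(if i + j = m then qt_mul q n (F i) (\<lambda>a. pchar p n a powi i * G j a) else 0) = 0" by (simp only: z if_cancel)
  qed
  also have "\<dots> = (\<Sum>i\<in>I. \<Sum>j\<in>J. if i + j = m then qt_mul q n (F i) (\<lambda>a. pchar p n a powi i * G j a) else 0)"
    by (rule sum.mono_neutral_left[OF I], intro ballI sum.neutral) (simp add: z)
  finally show ?thesis .
qed

text \<open>Moving \<open>Y^i\<close> past \<open>X^b\<close> costs
  \<open>pchar p n b powi i\<close>, exactly the additional factor of the cocycle. The rest matches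
  sums over a power of \<open>Y\<close> and an exponent in \<open>n\<close> coordinates with sums
  over exponents in \<open>n + 1\<close> coordinates.\<close>

lemma embL_mul:
  assumes f: "f \<in> RS {..<Suc n}" and g: "g \<in> RS {..<Suc n}"
  shows "sl_mul \<Lambda> \<sigma> (embL f) (embL g) = embL (f \<otimes> g)"
proof (intro ext)
  fix m c
  define Is where "Is = (\<lambda>a. a n) ` keys f"
  define Js where "Js = (\<lambda>a. a n) ` keys g"
  define As where "As = (\<lambda>a. a(n := 0)) ` keys f"
  define Bs where "Bs = (\<lambda>a. a(n := 0)) ` keys g"
  have fin: "finite Is" "finite Js" "finite As" "finite Bs" by (simp_all add: Is_def Js_def As_def Bs_def)
  have zn: "a n = 0" if "a \<in> As \<union> Bs" for a using that by (auto simp: As_def Bs_def)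
  have qm: "qt_mul q n (embL f i) (\<lambda>a. pchar p n a powi i * embL g j a) c
      = (\<Sum>a\<in>As. \<Sum>b\<in>Bs. if a + b = c then embL f i a * (pchar p n b powi i * embL g j b) * qt_coef q n a b else 0)" for i j
    unfolding As_def Bs_def
    by (rule qt_mul_super) (use embL_in(2)[OF f, of i] embL_in(2)[OF g, of j] in auto)
  have "sl_mul \<Lambda> \<sigma> (embL f) (embL g) m c = (\<Sum>i\<in>Is. \<Sum>j\<in>Js. (if i + j = m then qt_mul q n (embL f i) (\<lambda>a. pchar p n a powi i * embL g j a) else 0) c)"
    unfolding sl_mul_super[OF embL_in(1)[OF g] fin(1) embL_support[of f, folded Is_def] fin(2) embL_support[of g, folded Js_def]] sum_fun ..
  also have "\<dots> = (\<Sum>i\<in>Is. \<Sum>j\<in>Js. \<Sum>a\<in>As. \<Sum>b\<in>Bs. if i + j = m \<and> a + b = c then embL f i a * (pchar p n b powi i * embL g j b) * qt_coef q n a b else 0)"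
    by (intro sum.cong refl) (simp add: qm)
  finally have L: "sl_mul \<Lambda> \<sigma> (embL f) (embL g) m c = \<dots>" .
  show "sl_mul \<Lambda> \<sigma> (embL f) (embL g) m c = embL (f \<otimes> g) m c"
  proof (cases "c n = 0")
    case False
    have "a + b \<noteq> c" if "a \<in> As" "b \<in> Bs" for a b
    proof
      assume "a + b = c"
      then have "c n = a n + b n" by auto
      then show False using zn[of a] zn[of b] that False by simp
    qed
    then have "sl_mul \<Lambda> \<sigma> (embL f) (embL g) m c = 0" unfolding L by (intro sum.neutral ballI) auto
    then show ?thesis using False by (simp add: embL_def)
  next
    case True
    \<comment> \<open>Puts the power of \<open>Y\<close> back into coordinate \<open>n\<close>; this
      is injective on exponents whose coordinate \<open>n\<close> is 0.\<close>
    define \<Phi> where "\<Phi> = (\<lambda>(i::int, a::nat\<Rightarrow>int). a(n := i))"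
    have inj: "inj_on \<Phi> (X \<times> Y)" if Y: "\<And>a. a \<in> Y \<Longrightarrow> a n = 0" for X Y
    proof (rule inj_onI)
      fix u v assume uv: "u \<in> X \<times> Y" "v \<in> X \<times> Y" "\<Phi> u = \<Phi> v"
      obtain i a j b where e: "u = (i, a)" "v = (j, b)" by fastforce
      have eq: "a(n := i) = b(n := j)" using uv(3) by (simp add: e \<Phi>_def)
      have "i = j" using fun_cong[OF eq, of n] by simp
      moreover have "a n = 0" "b n = 0" using Y uv(1,2) e by auto
      then have "a t = b t" for t using fun_cong[OF eq, of t] by (cases "t = n") auto
      then have "a = b" by (rule ext)
      ultimately show "u = v" using e by simp
    qed
    have kf: "keys f \<subseteq> \<Phi> ` (Is \<times> As)" "keys g \<subseteq> \<Phi> ` (Js \<times> Bs)"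
    proof -
      show "keys f \<subseteq> \<Phi> ` (Is \<times> As)"
      proof
        fix x assume "x \<in> keys f"
        then show "x \<in> \<Phi> ` (Is \<times> As)" by (intro image_eqI[of _ _ "(x n, x(n := 0))"]) (auto simp: \<Phi>_def Is_def As_def)
      qed
      show "keys g \<subseteq> \<Phi> ` (Js \<times> Bs)"
      proof
        fix x assume "x \<in> keys g"
        then show "x \<in> \<Phi> ` (Js \<times> Bs)" by (intro image_eqI[of _ _ "(x n, x(n := 0))"]) (auto simp: \<Phi>_def Js_def Bs_def)
      qed
    qed
    have finP: "finite (\<Phi> ` (Is \<times> As))" "finite (\<Phi> ` (Js \<times> Bs))" using fin by auto
    have iA: "inj_on \<Phi> (Is \<times> As)" and iB: "inj_on \<Phi> (Js \<times> Bs)" using zn by (intro inj; simp)+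
    let ?t = "\<lambda>x y. if x + y = c(n := m) then \<kappa> x y * lookup f x * lookup g y else 0"
    have "embL (f \<otimes> g) m c = lookup (f \<otimes> g) (c(n := m))" using True by (simp add: embL_def)
    also have "\<dots> = (\<Sum>x\<in>\<Phi> ` (Is \<times> As). \<Sum>y\<in>\<Phi> ` (Js \<times> Bs). ?t x y)"
      unfolding tm_super[OF finP(1) kf(1) finP(2) kf(2)] lookup_sum lookup_single when_def ..
    also have "\<dots> = (\<Sum>u\<in>Is \<times> As. \<Sum>v\<in>Js \<times> Bs. ?t (\<Phi> u) (\<Phi> v))"
      unfolding sum.reindex[OF iA] sum.reindex[OF iB] comp_def ..
    also have "\<dots> = (\<Sum>i\<in>Is. \<Sum>a\<in>As. \<Sum>j\<in>Js. \<Sum>b\<in>Bs. ?t (a(n := i)) (b(n := j)))"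
      by (simp only: sum.cartesian_product' \<Phi>_def prod.case)
    also have "\<dots> = (\<Sum>i\<in>Is. \<Sum>j\<in>Js. \<Sum>a\<in>As. \<Sum>b\<in>Bs. ?t (a(n := i)) (b(n := j)))"
      by (intro sum.cong refl sum.swap)
    also have "\<dots> = sl_mul \<Lambda> \<sigma> (embL f) (embL g) m c"
      unfolding L
    proof (intro sum.cong refl)
      fix i j a b assume "a \<in> As" "b \<in> Bs"
      then have ab: "a n = 0" "b n = 0" using zn by auto
      have "(a(n := i) + b(n := j) = c(n := m)) \<longleftrightarrow> (i + j = m \<and> a + b = c)"
      proof
        assume e: "a(n := i) + b(n := j) = c(n := m)"
        have "(a + b) t = c t" for t using fun_cong[OF e, of t] ab True by (cases "t = n") auto
        then have "a + b = c" by (rule ext)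
        then show "i + j = m \<and> a + b = c" using fun_cong[OF e, of n] by simp
      next
        assume e: "i + j = m \<and> a + b = c"
        show "a(n := i) + b(n := j) = c(n := m)"
        proof
          fix t
          have "(a + b) t = c t" using e by (simp only:)
          then show "(a(n := i) + b(n := j)) t = (c(n := m)) t" using e by (cases "t = n") auto
        qed
      qed
      moreover have "qt_coef q n (a(n := i)) (b(n := j)) = qt_coef q n a b"
        unfolding qt_coef_def by (intro prod.cong refl) auto
      moreover have "pchar p n (b(n := j)) = pchar p n b" unfolding pchar_def by (intro prod.cong refl) auto
      ultimately show "?t (a(n := i)) (b(n := j)) = (if i + j = m \<and> a + b = c then embL f i a * (pchar p n b powi i * embL g j b) * qt_coef q n a b else 0)"
        unfolding kappa using ab by (simp add: embL_def)
    qed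
    finally show ?thesis ..
  qed
qed

lemma gk_laurent: "gk \<kappa> (skew_laurent \<Lambda> \<sigma>) {..<Suc n} embL"
proof (unfold_locales)
  show "finite {..<Suc n}" by simp
  show "embL ` RS {..<Suc n} = acar (skew_laurent \<Lambda> \<sigma>)"
  proof (intro set_eqI iffI)
    fix F assume "F \<in> embL ` RS {..<Suc n}"
    then obtain f where f: "f \<in> RS {..<Suc n}" "F = embL f" by blast
    have "finite {m. embL f m \<noteq> 0}" by (rule finite_subset[OF embL_support]) simp
    then show "F \<in> acar (skew_laurent \<Lambda> \<sigma>)" using embL_in(1)[OF f(1)] by (simp add: skew_laurent_def f(2))
  next
    fix F assume "F \<in> acar (skew_laurent \<Lambda> \<sigma>)"
    then have F: "finite {m. F m \<noteq> 0}" "\<And>m. F m \<in> acar \<Lambda>" by (auto simp: skew_laurent_def)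
    \<comment> \<open>A preimage under \<open>embL\<close>: coordinate \<open>n\<close> selects the
      coefficient and is reset to 0 before that coefficient is read.\<close>
    define h where "h = (\<lambda>a. F (a n) (a(n := 0)))"
    have sub: "{a. h a \<noteq> 0} \<subseteq> (\<Union>m\<in>{m. F m \<noteq> 0}. (\<lambda>a. a(n := m)) ` {a. F m a \<noteq> 0})"
    proof
      fix a assume "a \<in> {a. h a \<noteq> 0}"
      then have a: "F (a n) (a(n := 0)) \<noteq> 0" by (simp add: h_def)
      then have "F (a n) \<noteq> 0" by (auto simp: fun_eq_iff)
      moreover have "a \<in> (\<lambda>b. b(n := a n)) ` {b. F (a n) b \<noteq> 0}" using a by (intro image_eqI[of _ _ "a(n := 0)"]) simp_all
      ultimately show "a \<in> (\<Union>m\<in>{m. F m \<noteq> 0}. (\<lambda>a. a(n := m)) ` {a. F m a \<noteq> 0})" by (intro UN_I[of "a n"]) simp_all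
    qed
    have fin: "finite {a. h a \<noteq> 0}"
      by (rule finite_subset[OF sub]) (use F in \<open>auto simp: acar_torus\<close>)
    have hE: "{a. h a \<noteq> 0} \<subseteq> exps {..<Suc n}"
    proof
      fix a assume "a \<in> {a. h a \<noteq> 0}"
      then have "a(n := 0) \<in> exps {..<n}" using F(2)[of "a n"] by (auto simp: acar_torus h_def)
      then have "a i = 0" if "\<not> i < Suc n" for i using that by (auto simp: exps_def split: if_splits)
      then show "a \<in> exps {..<Suc n}" by (simp add: exps_def)
    qed
    have "F = embL (Abs_poly_mapping h)"
    proof (intro ext)
      fix m a
      show "F m a = embL (Abs_poly_mapping h) m a"
      proof (cases "a n = 0")
        case True
        have "(a(n := m))(n := 0) = a" by (simp add: True fun_upd_idem)
        then have "h (a(n := m)) = F m a" by (simp only: h_def fun_upd_same)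
        then show ?thesis by (simp only: embL_def True if_True lookup_Abs[OF fin] simp_thms)
      next
        case False
        have "F m a = 0"
        proof (rule ccontr)
          assume "F m a \<noteq> 0"
          then have "a \<in> exps {..<n}" using F(2)[of m] by (auto simp: acar_torus)
          then show False using False by (simp add: exps_def)
        qed
        then show ?thesis using False by (simp add: embL_def)
      qed
    qed
    moreover have "Abs_poly_mapping h \<in> RS {..<Suc n}" using hE by (auto simp: RS_def in_keys_iff lookup_Abs[OF fin])
    ultimately show "F \<in> embL ` RS {..<Suc n}" by blast
  qed
  fix f g :: "'k ta" and c
  show "aadd (skew_laurent \<Lambda> \<sigma>) (embL f) (embL g) = embL (f + g)"
    by (intro ext) (simp add: skew_laurent_def embL_def lookup_add)
  show "azero (skew_laurent \<Lambda> \<sigma>) = embL 0" by (intro ext) (simp add: skew_laurent_def embL_def)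
  show "aone (skew_laurent \<Lambda> \<sigma>) = embL (mon 0)"
  proof (intro ext)
    fix m and a :: "nat \<Rightarrow> int"
    have e: "a n = 0 \<and> a(n := m) = 0 \<longleftrightarrow> m = 0 \<and> a = 0"
      by (auto simp: fun_eq_iff split: if_splits)
    have "aone (skew_laurent \<Lambda> \<sigma>) m a = (if m = 0 \<and> a = 0 then 1 else 0)"
      by (simp add: skew_laurent_def quantum_torus_def zero_fun_def[symmetric])
    moreover have "embL (mon 0) m a = (if a n = 0 \<and> a(n := m) = 0 then 1 else 0)"
      by (auto simp: embL_def mon_def lookup_one when_def)
    ultimately show "aone (skew_laurent \<Lambda> \<sigma>) m a = embL (mon 0) m a" using e by simp
  qed
  show "asmul (skew_laurent \<Lambda> \<sigma>) c (embL f) = embL (sc c f)"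
    by (intro ext) (simp add: skew_laurent_def quantum_torus_def embL_def)
  assume "f \<in> RS {..<Suc n}" "g \<in> RS {..<Suc n}"
  then show "amul (skew_laurent \<Lambda> \<sigma>) (embL f) (embL g) = embL (f \<otimes> g)"
    using embL_mul by (simp add: skew_laurent_def)
qed

end

section \<open>Subgroups of the multiplicative group and their torsion-free rank\<close>

lemma sg_mult: assumes "a \<in> subgroup_gen S" "b \<in> subgroup_gen S" shows "a * b \<in> subgroup_gen S"
proof -
  obtain xs es ys fs where *: "a = prod_list (map2 (powi) xs es)" "set xs \<subseteq> S" "length es = length xs"
    "b = prod_list (map2 (powi) ys fs)" "set ys \<subseteq> S" "length fs = length ys"
    using assms by (auto simp: subgroup_gen_def)
  have "a * b = prod_list (map2 (powi) (xs @ ys) (es @ fs))" using * by simp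
  then show ?thesis unfolding subgroup_gen_def using * by (intro CollectI exI[of _ "xs @ ys"] exI[of _ "es @ fs"]) simp
qed

lemma sg_gen: "x \<in> S \<Longrightarrow> x powi z \<in> subgroup_gen S"
  unfolding subgroup_gen_def by (intro CollectI exI[of _ "[x]"] exI[of _ "[z]"]) simp

lemma sg_one: "1 \<in> subgroup_gen S"
  unfolding subgroup_gen_def by (intro CollectI exI[of _ "[]"]) simp

lemma sg_prod: "(\<And>i. i \<in> A \<Longrightarrow> f i \<in> subgroup_gen S) \<Longrightarrow> prod f A \<in> subgroup_gen S"
  by (induction A rule: infinite_finite_induct) (auto intro: sg_one sg_mult)

lemma sg_inverse: assumes "a \<in> subgroup_gen S" shows "inverse a \<in> subgroup_gen S"
proof -
  obtain xs es where *: "a = prod_list (map2 (powi) xs es)" "set xs \<subseteq> S" "length es = length xs"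
    using assms by (auto simp: subgroup_gen_def)
  have "inverse (prod_list (map2 (powi) xs es)) = prod_list (map2 (powi) xs (map uminus es))" using *(3)
    by (induction es xs rule: list_induct2) (simp_all add: power_int_minus)
  then show ?thesis unfolding subgroup_gen_def using * by (intro CollectI exI[of _ xs] exI[of _ "map uminus es"]) simp
qed

lemma rat_scale:
  fixes g :: "nat \<Rightarrow> rat"
  shows "\<exists>D z. D > (0::int) \<and> (\<forall>l<r. of_int (z l) = of_int D * g l)"
proof (induction r)
  case 0
  show ?case by (intro exI[of _ 1]) simp
next
  case (Suc r)
  then obtain D z where D: "D > 0" "\<forall>l<r. of_int (z l) = of_int D * g l" by blast
  obtain a b where ab: "b > 0" "g r = of_int a / of_int b" by (metis quotient_of_div quotient_of_denom_pos surj_pair)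
  define z' where "z' = (\<lambda>l. if l = r then D * a else b * z l)"
  have "of_int (z' l) = of_int (D * b) * g l" if "l < Suc r" for l
    using D(2) that ab by (cases "l = r") (auto simp: z'_def less_Suc_eq)
  moreover have "D * b > 0" using D ab by simp
  ultimately show ?case by blast
qed

text \<open>Solve over the rationals, where there are more unknowns than equations, and clear
  denominators.\<close>

lemma int_dependent:
  fixes b :: "nat \<Rightarrow> nat \<Rightarrow> int"
  assumes "finite I" "card I < r"
  shows "\<exists>z. (\<exists>l<r. z l \<noteq> 0) \<and> (\<forall>i\<in>I. (\<Sum>l<r. z l * b l i) = 0)"
proof -
  have c: "card I < card {..<r}" using assms by simp
  obtain g where g: "\<exists>l\<in>{..<r}. g l \<noteq> 0" "\<forall>i\<in>I. (\<Sum>l<r. g l * (of_int (b l i) :: rat)) = 0"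
    using kernel_nontrivial[OF finite_lessThan assms(1) c, of "\<lambda>l i. of_int (b l i)"] by blast
  obtain D z where D: "D > (0::int)" "\<forall>l<r. of_int (z l) = of_int D * g l" using rat_scale by blast
  have "(\<Sum>l<r. z l * b l i) = 0" if "i \<in> I" for i
  proof -
    have "of_int (\<Sum>l<r. z l * b l i) = (\<Sum>l<r. of_int D * g l * (of_int (b l i) :: rat))"
      using D(2) by simp
    also have "\<dots> = of_int D * (\<Sum>l<r. g l * of_int (b l i))" by (simp add: sum_distrib_left mult.assoc)
    also have "\<dots> = 0" using g(2) that by simp
    finally show ?thesis by (simp only: of_int_eq_0_iff)
  qed
  moreover obtain l where l: "l < r" "g l \<noteq> 0" using g(1) by auto
  have "(of_int (z l) :: rat) \<noteq> 0" using D l by simp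
  then have "z l \<noteq> 0" by auto
  ultimately show ?thesis using l by blast
qed

context torus
begin

lemma pchar_sum: "finite A \<Longrightarrow> pchar p n (\<Sum>l\<in>A. F l) = (\<Prod>l\<in>A. pchar p n (F l))"
proof (induction A rule: finite_induct)
  case empty
  show ?case by (simp only: sum.empty prod.empty pchars)
next
  case (insert x A)
  show ?case by (simp only: sum.insert[OF insert.hyps] prod.insert[OF insert.hyps] pchars(1) insert.IH)
qed

text \<open>The power \<open>M\<close> of each element of the group is a value of
  \<open>pchar\<close> at an exponent supported on \<open>I\<close>. More than \<open>card I\<close>
  such exponents are dependent over the integers, and the dependence is a multiplicative
  relation.\<close>

lemma tf_rank_le:
  assumes I: "finite I" and m: "\<And>j. j < n \<Longrightarrow> \<exists>m b. m \<noteq> (0::int) \<and> b \<in> exps I \<and> p j powi m = pchar p n b"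
  shows "tf_rank (subgroup_gen (p ` {..<n})) \<le> enat (card I)"
proof -
  have "\<forall>j. \<exists>m. j < n \<longrightarrow> (\<exists>b. m \<noteq> (0::int) \<and> b \<in> exps I \<and> p j powi m = pchar p n b)" using m by blast
  from choice[OF this] obtain \<mu> where mu: "\<forall>j. j < n \<longrightarrow> (\<exists>b. \<mu> j \<noteq> 0 \<and> b \<in> exps I \<and> p j powi \<mu> j = pchar p n b)" ..
  \<comment> \<open>A common multiple of the individual \<open>\<mu> j\<close>, nonzero because none
    of them vanishes.\<close>
  define M where "M = (\<Prod>j<n. \<mu> j)"
  have M0: "M \<noteq> 0" using mu by (simp add: M_def prod_zero_iff)
  have pM: "\<exists>b\<in>exps I. p j powi M = pchar p n b" if j: "j < n" for j
  proof -
    obtain b where b: "b \<in> exps I" "p j powi \<mu> j = pchar p n b" using mu j by blast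
    have "\<mu> j dvd M" unfolding M_def using j by (intro dvd_prodI) auto
    then obtain k where k: "M = \<mu> j * k" by (auto simp: dvd_def)
    have "p j powi M = pchar p n (smul k b)" by (simp add: k power_int_mult b(2) pchars(4))
    then show ?thesis using smul_exps[OF b(1)] by blast
  qed
  have H: "\<exists>b\<in>exps I. h powi M = pchar p n b" if hS: "h \<in> subgroup_gen (p ` {..<n})" for h
  proof -
    obtain xs es where h: "h = prod_list (map2 (powi) xs es)" "set xs \<subseteq> p ` {..<n}" "length es = length xs"
      using hS by (auto simp: subgroup_gen_def)
    have "\<exists>b\<in>exps I. prod_list (map2 (powi) xs es) powi M = pchar p n b" using h(3,2)
    proof (induction es xs rule: list_induct2)
      case Nil
      have "prod_list (map2 (powi) [] []) powi M = (1::'k)" by simp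
      then show ?case by (intro bexI[OF _ exps_zero]) (simp only: pchars(2))
    next
      case (Cons e es x xs)
      then obtain b where b: "b \<in> exps I" "prod_list (map2 (powi) xs es) powi M = pchar p n b" by auto
      obtain j where "j < n" "x = p j" using Cons.prems by auto
      then obtain b' where b': "b' \<in> exps I" "x powi M = pchar p n b'" using pM by blast
      have "(x powi e) powi M = (x powi M) powi e" by (simp add: power_int_mult[symmetric] mult.commute)
      then have "prod_list (map2 (powi) (x # xs) (e # es)) powi M = pchar p n (smul e b' + b)"
        by (simp add: power_int_mult_distrib b(2) b'(2) pchars(1,4))
      then show ?case using b(1) smul_exps[OF b'(1)] exps_add by blast
    qed
    then show ?thesis by (simp add: h(1))
  qed
  show ?thesis
    unfolding tf_rank_def
  proof (rule Sup_least)
    fix k assume "k \<in> {enat (length xs) |xs. distinct xs \<and> set xs \<subseteq> subgroup_gen (p ` {..<n}) \<and> mult_indep xs}"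
    then obtain xs where xs: "k = enat (length xs)" "set xs \<subseteq> subgroup_gen (p ` {..<n})" "mult_indep xs" by blast
    have "length xs \<le> card I"
    proof (rule ccontr)
      assume "\<not> ?thesis"
      then have r: "card I < length xs" by simp
      have "\<forall>l. \<exists>b. l < length xs \<longrightarrow> b \<in> exps I \<and> (xs ! l) powi M = pchar p n b" using H xs(2) by (metis nth_mem subsetD)
      from choice[OF this] obtain b where b: "\<forall>l. l < length xs \<longrightarrow> b l \<in> exps I \<and> (xs ! l) powi M = pchar p n (b l)" ..
      obtain z where z: "\<exists>l<length xs. z l \<noteq> 0" "\<forall>i\<in>I. (\<Sum>l<length xs. z l * b l i) = 0" using int_dependent[OF I r, of b] by blast
      have s0: "(\<Sum>l<length xs. smul (z l) (b l)) = 0"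
      proof (rule ext)
        fix i
        have "(\<Sum>l<length xs. smul (z l) (b l)) i = (\<Sum>l<length xs. z l * b l i)" unfolding sum_fun by (simp add: smul_def)
        also have "\<dots> = 0"
        proof (cases "i \<in> I")
          case False
          then show ?thesis using b by (intro sum.neutral ballI) (auto simp: exps_def)
        qed (use z(2) in blast)
        finally show "(\<Sum>l<length xs. smul (z l) (b l)) i = 0 i" by simp
      qed
      define es where "es = map (\<lambda>l. M * z l) [0..<length xs]"
      have le: "length es = length xs" by (simp add: es_def)
      have "prod_list (map2 (powi) xs es) = (\<Prod>l<length xs. (xs ! l) powi (M * z l))"
      proof -
        have "map2 (powi) xs es = map (\<lambda>l. (xs ! l) powi (M * z l)) [0..<length xs]"
          by (rule nth_equalityI) (simp_all add: es_def)
        then show ?thesis by (simp add: prod.distinct_set_conv_list[symmetric] atLeast0LessThan)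
      qed
      also have "\<dots> = (\<Prod>l<length xs. pchar p n (smul (z l) (b l)))"
        by (intro prod.cong refl) (use b in \<open>simp add: power_int_mult pchars(4)\<close>)
      also have "\<dots> = 1" unfolding pchar_sum[OF finite_lessThan, symmetric] s0 by (rule pchars(2))
      finally have "\<forall>e\<in>set es. e = 0" using xs(3) le unfolding mult_indep_def by blast
      then show False using z(1) M0 by (auto simp: es_def)
    qed
    then show "k \<le> enat (card I)" by (simp add: xs(1))
  qed
qed

end

text \<open>The type \<open>'m\<close> is arbitrary, so simple modules on any carrier are covered,
  not only those on sets of algebra elements. If the torsion-free rank exceeds \<open>n\<close>, the
  first set of the union is empty.\<close>

theorem theorem2:
  fixes q :: "nat \<Rightarrow> nat \<Rightarrow> 'k::field" and p :: "nat \<Rightarrow> 'k" and n :: nat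
  assumes q_nz: "\<forall>i<n. \<forall>j<n. q i j \<noteq> 0"
    and q_diag: "\<forall>i<n. q i i = 1"
    and q_anti: "\<forall>i<n. \<forall>j<n. q j i = inverse (q i j)"
    and p_nz: "\<forall>i<n. p i \<noteq> 0"
    and GH: "subgroup_gen {q i j | i j. i < n \<and> j < n} \<inter> subgroup_gen (p ` {..<n}) = {1}"
  shows "\<forall>M :: (int \<Rightarrow> (nat \<Rightarrow> int) \<Rightarrow> 'k, 'm) kmod.
           is_simple (skew_laurent (quantum_torus q n) (scalar_aut p n)) M \<longrightarrow>
           GKdim (skew_laurent (quantum_torus q n) (scalar_aut p n)) M \<in>
             {ereal (real r) | r. tf_rank (subgroup_gen (p ` {..<n})) \<le> enat r \<and> r \<le> n}
             \<union> {u + 1 | u. u \<in> GK_simple_values (quantum_torus q n)}"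
proof (intro allI impI)
  fix M :: "(int \<Rightarrow> (nat \<Rightarrow> int) \<Rightarrow> 'k, 'm) kmod"
  assume simple: "is_simple (skew_laurent (quantum_torus q n) (scalar_aut p n)) M"
  interpret torus q p n by unfold_locales (use q_nz p_nz in auto)
  interpret L: gk \<kappa> "skew_laurent \<Lambda> \<sigma>" "{..<Suc n}" embL by (rule gk_laurent)
  interpret T: gk \<kappa> \<Lambda> "{..<n}" lookup by (rule gk_torus)
  define N where "N = {..<Suc n}"
  have N: "finite N" "n \<in> N" "N - {n} = {..<n}" by (auto simp: N_def)
  note Mm = L.simple_module[OF simple]
  have "mzero M \<in> mcar M" by (rule L.kmod(1)[OF Mm])
  moreover have "mcar M \<noteq> {mzero M}" using simple by (simp add: is_simple_def)
  ultimately obtain x where x: "x \<in> mcar M" "x \<noteq> mzero M" by blast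
  define J where "J = L.kern M x"
  have J: "maximal_left N J" unfolding J_def N_def by (rule L.maximal_left_kern[OF simple x])
  have J': "left_sub N J" using J by (simp add: maximal_left_def)
  define FF where "FF = {I. I \<subseteq> N \<and> free J I}"
  have fFF: "finite FF" using N by (simp add: FF_def)
  \<comment> \<open>\<open>J\<close> contains no nonzero scalar, so the maximum \<open>e\<close> is
    taken over a nonempty family.\<close>
  have "{} \<in> FF"
  proof -
    have "f = 0" if f: "f \<in> RS {}" "f \<in> J" for f
    proof (rule ccontr)
      assume f0: "f \<noteq> 0"
      have ex0: "exps {} = {0}" by (auto simp: exps_def fun_eq_iff)
      have "f = sc (lookup f 0) (mon 0)" using mon_sum_super[of "{0}" f] f(1) by (simp add: RS_def ex0)
      moreover have "lookup f 0 \<noteq> 0"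
      proof
        assume "lookup f 0 = 0"
        then have "f = 0" using calculation by (metis sc_simps(5))
        then show False using f0 by simp
      qed
      ultimately have "mon 0 \<in> J" using f(2) sc_mem[OF J'] by metis
      then show False using J by (simp add: maximal_left_def)
    qed
    then show ?thesis by (simp add: FF_def free_def)
  qed
  then have ne: "card ` FF \<noteq> {}" by blast
  define e where "e = Max (card ` FF)"
  have emax: "card I \<le> e" if "I \<subseteq> N" "free J I" for I
    unfolding e_def using that fFF by (intro Max_ge) (auto simp: FF_def)
  have "e \<in> card ` FF" unfolding e_def using fFF ne by (intro Max_in) auto
  then obtain I0 where I0: "I0 \<subseteq> N" "free J I0" "card I0 = e" by (auto simp: FF_def)
  have GK: "GKdim (skew_laurent \<Lambda> \<sigma>) M = ereal (real e)"
    by (rule L.GKdim_cyclic[OF Mm x(1) L.simple_generated[OF simple x] emax[unfolded N_def J_def] I0[unfolded N_def J_def]])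
  show "GKdim (skew_laurent \<Lambda> \<sigma>) M \<in> {ereal (real r) | r. tf_rank (subgroup_gen (p ` {..<n})) \<le> enat r \<and> r \<le> n}
      \<union> {u + 1 | u. u \<in> GK_simple_values \<Lambda>}"
  proof (cases "\<exists>I\<subseteq>{..<n}. free J I \<and> card I = e")
    case True
    then obtain I where I: "I \<subseteq> {..<n}" "free J I" "card I = e" by blast
    have IN: "I \<subseteq> N" "n \<notin> I" "finite I" using I(1) finite_subset by (auto simp: N_def)
    have e': "card I' \<le> card I" if "I' \<subseteq> N" "free J I'" for I' using emax[OF that] I(3) by simp
    have nf: "\<not> free J (insert d I)" if "d \<in> N" "d \<notin> I" for d
      using e'[of "insert d I"] that IN by auto
    \<comment> \<open>Maximality of \<open>I\<close> provides nonzero relations over both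
      \<open>insert j I\<close> and \<open>insert n I\<close>, as needed to apply the slope argument
      to \<open>X_j\<close> and \<open>Y\<close>.\<close>
    have pj: "\<exists>m b. m \<noteq> (0::int) \<and> b \<in> exps I \<and> p j powi m = pchar p n b" if j: "j < n" for j
    proof (cases "j \<in> I")
      case True
      have "pchar p n (yexp j 1) = (\<Prod>t<n. if t = j then p j else 1)" unfolding pchar_def by (intro prod.cong refl) (auto simp: yexp_def)
      also have "\<dots> = p j" using j by simp
      finally show ?thesis using yexp_exps[OF True, of 1] by (intro exI[of _ 1] exI[of _ "yexp j 1"]) simp
    next
      case False
      have jN: "j \<in> N" "j \<noteq> n" using j by (auto simp: N_def)
      obtain \<theta> where th: "\<not> bad I j n J \<theta>" using slope_exists[OF N(1) IN(1) I(2) J' e' jN(1) N(2) False IN(2) jN(2)] by blast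
      obtain a c where ac: "a \<in> exps (insert j I)" "c \<in> exps (insert n I)" "a j \<noteq> 0" "c n \<noteq> 0" "chi c a = 1"
        using slope_commute[OF N(1) IN(1) J' jN(1) N(2) False IN(2) jN(2) nf[OF jN(1) False] nf[OF N(2) IN(2)] th] by blast
      have an: "a n = 0" using ac(1) jN IN by (auto simp: exps_def)
      have qG: "qt_coef q n u v \<in> subgroup_gen {q i j | i j. i < n \<and> j < n}" for u v
      proof -
        have "q i j \<in> {q i j | i j. i < n \<and> j < n}" if "i < n" "j < n" for i j using that by blast
        then show ?thesis unfolding qt_coef_def by (intro sg_prod sg_gen) auto
      qed
      \<comment> \<open>The part of the commutator of \<open>c\<close> and \<open>a\<close> that
        comes from \<open>Y\<close>. As \<open>a\<close> contains no \<open>Y\<close>, the other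
        parts are values of \<open>qt_coef q n\<close>, which lie in the group of the
        \<open>q i j\<close>.\<close>
      define P where "P = pchar p n a powi (c n)"
      have "\<kappa> c a = \<kappa> a c" using ac(5) by (simp add: chi_def)
      then have kk: "qt_coef q n c a * P = qt_coef q n a c" by (simp add: kappa an P_def)
      have "qt_coef q n c a \<noteq> 0" using kappa[of c a] \<kappa>_nz[of c a] by auto
      then have "P = qt_coef q n a c * inverse (qt_coef q n c a)" using kk by (simp add: field_simps)
      then have PG: "P \<in> subgroup_gen {q i j | i j. i < n \<and> j < n}" by (simp only: sg_mult sg_inverse qG)
      have "P = (\<Prod>t<n. p t powi (a t * c n))" by (simp add: P_def pchar_def prod_powi power_int_mult)
      also have "\<dots> \<in> subgroup_gen (p ` {..<n})" by (intro sg_prod sg_gen) auto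
      finally have "P = 1" using PG GH by blast
      \<comment> \<open>Separating the coordinate \<open>j\<close> in \<open>P = 1\<close> leaves a
        value of \<open>pchar\<close> on \<open>I\<close>, with the nonzero exponent
        \<open>a j * c n\<close> on \<open>p j\<close>.\<close>
      define b where "b = a(j := 0)"
      have bI: "b \<in> exps I" using ac(1) by (auto simp: b_def exps_def)
      have ab: "a = smul (a j) (yexp j 1) + b" by (auto simp: b_def smul_def yexp_def fun_eq_iff)
      have "pchar p n (yexp j 1) = (\<Prod>t<n. if t = j then p j else 1)" unfolding pchar_def by (intro prod.cong refl) (auto simp: yexp_def)
      also have "\<dots> = p j" using j by simp
      finally have "pchar p n a = p j powi (a j) * pchar p n b" by (subst ab) (simp only: pchars)
      then have "(p j powi (a j)) powi (c n) * pchar p n b powi (c n) = 1" using \<open>P = 1\<close> by (simp add: P_def power_int_mult_distrib)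
      then have "p j powi (a j * c n) = inverse (pchar p n b powi (c n))"
        by (simp add: power_int_mult field_simps pchars(3))
      also have "\<dots> = pchar p n (smul (- c n) b)" by (simp add: pchars(4) power_int_minus)
      finally show ?thesis using ac(3,4) smul_exps[OF bI, of "- c n"] by (intro exI[of _ "a j * c n"] exI[of _ "smul (- c n) b"]) simp
    qed
    have "tf_rank (subgroup_gen (p ` {..<n})) \<le> enat e" using tf_rank_le[OF IN(3) pj] I(3) by simp
    moreover have "e \<le> n" using card_mono[OF _ I(1)] I(3) by simp
    ultimately show ?thesis using GK by blast
  next
    case False
    \<comment> \<open>In this case every free set of maximal size involves \<open>Y\<close>, as
      \<open>induced_simple\<close> requires.\<close>
    have nI: "n \<in> I0"
    proof (rule ccontr)
      assume "n \<notin> I0"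
      then have "I0 \<subseteq> {..<n}" using I0(1) N(3) by blast
      then show False using False I0 by blast
    qed
    have less: "card I' < card I0" if "I' \<subseteq> N - {n}" "free J I'" for I'
    proof -
      have "card I' \<le> e" using emax that by blast
      moreover have "card I' \<noteq> e" using False that N(3) by auto
      ultimately show ?thesis using I0(3) by simp
    qed
    obtain z where z: "z \<in> RS N" "z \<notin> J" "maximal_left {..<n} (ann J z \<inter> RS {..<n})"
      using induced_simple[OF N(1) J nI I0(1,2) less] unfolding N(3) by blast
    define K where "K = ann J z \<inter> RS {..<n}"
    have K: "maximal_left {..<n} K" using z(3) by (simp add: K_def)
    have free_iff: "free K I' \<longleftrightarrow> free J I'" if I': "I' \<subseteq> {..<n}" for I'
    proof -
      have "I' \<subseteq> N" using I' by (auto simp: N_def)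
      have "free K I' \<longleftrightarrow> free (ann J z) I'" using RS_mono[OF I'] unfolding free_def K_def by blast
      then show ?thesis using free_ann_iff[OF N(1) \<open>I' \<subseteq> N\<close> J z(1,2)] by simp
    qed
    have inj: "inj_on lookup (RS {..<n} :: 'k ta set)" by (rule inj_onI) (simp only: poly_mapping_eq_iff)
    have fI0: "finite I0" using I0(1) N(1) finite_subset by auto
    \<comment> \<open>Removing \<open>Y\<close> leaves a free set of size \<open>e - 1\<close>, the
      largest possible, since free sets without \<open>Y\<close> have fewer than \<open>e\<close>
      elements.\<close>
    define I1 where "I1 = I0 - {n}"
    have I1: "I1 \<subseteq> {..<n}" "card I1 = e - 1" using I0 N(3) nI fI0 by (auto simp: I1_def)
    have "free J I1" using I0(2) RS_mono[of I1 I0] unfolding free_def I1_def by blast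
    then have "free K I1" using free_iff[OF I1(1)] by simp
    moreover have "card I' \<le> e - 1" if I': "I' \<subseteq> {..<n}" "free K I'" for I'
    proof -
      have "I' \<subseteq> N - {n}" "free J I'" using I' free_iff N(3) by auto
      from less[OF this] show ?thesis using I0(3) by simp
    qed
    ultimately have "GKdim \<Lambda> (T.quotm K) = ereal (real (e - 1))" using T.GKdim_quotm[OF K inj _ I1(1) _ I1(2)] by blast
    moreover have "is_simple \<Lambda> (T.quotm K)" by (rule T.quotm_simple[OF K inj])
    ultimately have u: "ereal (real (e - 1)) \<in> GK_simple_values \<Lambda>" unfolding GK_simple_values_def by (metis (mono_tags, lifting) mem_Collect_eq)
    \<comment> \<open>Needed because \<open>e - 1\<close> is a subtraction of natural
      numbers.\<close>
    have "0 < e" using nI fI0 I0(3) card_gt_0_iff by blast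
    then have "ereal (real e) = ereal (real (e - 1)) + 1" by (simp add: of_nat_diff)
    then have "ereal (real e) \<in> {u + 1 | u. u \<in> GK_simple_values \<Lambda>}" using u by blast
    then show ?thesis unfolding GK by (rule UnI2)
  qed
qed

end
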